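(* Let $n\ge2$, $G=\operatorname{Euc}(n)$, $H=O(n-1)$, and let $(p:\mathcal P\to N,\omega)$ be a Cartan geometry of type $(G,H)$, with induced objects $(\bar g,U,\alpha,\mathcal E,\mathcal B,\Psi)$ on $N$. Consider the reductive decomposition $\mathfrak g=\mathfrak h\oplus\mathfrak m$ and let $$\gamma:=\operatorname{pr}_{\mathfrak h}\circ\,\omega$$ be the corresponding principal connection on $\mathcal P\to N$. Then $\gamma$ induces a linear connection $\nabla^\gamma$ on $TN$ such that $$\nabla^\gamma\bar g=0,\qquad \nabla^\gamma U=0,\qquad \nabla^\gamma\alpha=0,$$ $$\nabla^\gamma\mathcal E\subset\mathcal E,\qquad \nabla^\gamma\mathcal B\subset\mathcal B,\qquad \nabla^\gamma\Psi=0.$$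
   Context: All manifolds are smooth, Hausdorff, connected and second countable. Groups. $G=\operatorname{Euc}(n)=\mathbb R^n\rtimes O(n)$ is realized as the matrices $\begin{pmatrix}1&0\\ v&A\end{pmatrix}$ with $v\in\mathbb R^n$, $A\in O(n)$; its Lie algebra $\mathfrak g$ consists of the matrices $\begin{pmatrix}0&0\\ v&B\end{pmatrix}$ with $v\in\mathbb R^n$, $B\in\mathfrak o(n)$. $H=O(n-1)\subset O(n)\subset G$ is embedded by $h\mapsto\begin{pmatrix}1&0\\0&h\end{pmatrix}\in O(n)$, with Lie algebra $\mathfrak h=\mathfrak o(n-1)$. Model. For $v_0\in\mathbb R$, $v,w\in\mathbb R^{n-1}$ put $$(v_0,v,w):=\begin{pmatrix}0&0&0\\ v_0&0&-w^t\\ v&w&0\end{pmatrix}\in\mathfrak g .$$ These matrices form an $\operatorname{Ad}(H)$-invariant complement $\mathfrak m$ of $\mathfrak h$ in $\mathfrak g$, identified with $\mathfrak g/\mathfrak h$ by the quotient map; $H$ acts on $\mathfrak m$ by $\underline{\operatorname{Ad}}(h)(v_0,v,w)=(v_0,hv,hw)$. With $(E_1,\dots,E_{n-1})$ the canonical basis of $\mathbb R^{n-1}$, put $e_0=(1,0,0)$, $e_i=(0,E_i,0)$, $b_i=(0,0,E_i)$, $E=\operatorname{span}\{e_1,\dots,e_{n-1}\}$, $B=\operatorname{span}\{b_1,\dots,b_{n-1}\}$, so $\mathfrak m=\mathbb R e_0\oplus E\oplus B$. Let $\langle\cdot,\cdot\rangle_{\mathfrak m}$ be the inner product for which $(e_0,e_1,\dots,e_{n-1},b_1,\dots,b_{n-1})$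 is orthonormal, and let $\psi:\mathfrak m\to\mathfrak m$ be the linear map with $\psi(e_0)=0$, $\psi(e_i)=b_i$, $\psi(b_i)=-e_i$. Both are $H$-equivariant. Cartan geometry of type $(G,H)$ on $N$: an $H$-principal fiber bundle $p:\mathcal P\to N$ (right action $r^h$) with a $1$-form $\omega\in\Omega^1(\mathcal P,\mathfrak g)$ (Cartan connection) such that each $\omega(u):T_u\mathcal P\to\mathfrak g$ is a linear isomorphism, $(r^h)^*\omega=\operatorname{Ad}(h^{-1})\circ\omega$ for $h\in H$, and $\omega(\zeta_X)=X$ for every $X\in\mathfrak h$, where $\zeta_X$ is the fundamental vector field of $X$. For $u\in\mathcal P$ with $p(u)=x$, there is a unique linear isomorphism $\phi_u:T_xN\to\mathfrak g/\mathfrak h\cong\mathfrak m$ such that $\phi_u(T_up\cdot\xi)=\operatorname{pr}_{\mathfrak m}(\omega(u)(\xi))$ for all $\xi\in T_u\mathcal P$; it satisfies $\phi_{uh}=\underline{\operatorname{Ad}}(h^{-1})\circ\phi_u$. Induced objects. For $x\in N$ and any $u\in p^{-1}(x)$ (the result is independent of $u$): $\bar g_x(v,w)=\langle\phi_u(v),\phi_u(w)\rangle_{\mathfrak m}$ (a Riemannian metric), $U(x)=\phi_u^{-1}(e_0)$, $\alpha=\bar g(U,\cdot)$, $\mathcal E_x=\phi_u^{-1}(E)$, $\mathcal B_x=\phi_u^{-1}(B)$, $\Psi_x=\phi_u^{-1}\circ\psi\circ\phi_u$. Induced linear connection. The map $(x,v)\mapsto[u,\phi_u(v)]$ identifies $TN$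 with the associated bundle $\mathcal P\times_H\mathfrak m$ (for $\underline{\operatorname{Ad}}$), and $\nabla^\gamma$ is the linear connection on $TN$ induced by the principal connection $\gamma$ on this associated bundle. Explicitly, for $V\in\mathfrak X(N)$ let $f_V:\mathcal P\to\mathfrak m$, $f_V(u)=\phi_u(V_{p(u)})$; for $W\in\mathfrak X(N)$ and $u\in p^{-1}(x)$ let $W^\gamma_u\in T_u\mathcal P$ be the $\gamma$-horizontal lift of $W_x$; then $\phi_u(\nabla^\gamma_{W_x}V)=T_uf_V\cdot W^\gamma_u$. Notation: $\nabla\mathcal D\subset\mathcal D$ for a distribution $\mathcal D$ means $\nabla_XV\in\Gamma(\mathcal D)$ for all $X\in\mathfrak X(N)$ and $V\in\Gamma(\mathcal D)$. *)

theory Defs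
  imports "HOL-Analysis.Analysis"
begin

section \<open>Smooth manifolds\<close>

text \<open>For open \<open>S\<close> and finite-dimensional domain this is the usual notion of a \<open>C\<^sup>k\<close> map.\<close>

primrec Ck_on :: "nat \<Rightarrow> 'a::real_normed_vector set \<Rightarrow> ('a \<Rightarrow> 'b::real_normed_vector) \<Rightarrow> bool" where
  "Ck_on 0 S f \<longleftrightarrow> continuous_on S f"
| "Ck_on (Suc k) S f \<longleftrightarrow>
     (\<forall>x\<in>S. f differentiable (at x)) \<and> (\<forall>v. Ck_on k S (\<lambda>x. frechet_derivative f (at x) v))"

text \<open>Smoothness on an arbitrary subset means that a smooth extension exists locally in the
  ambient space. On open sets this is ordinary smoothness; on an embedded submanifold, such as the
  orthogonal group inside a space of matrices, it is smoothness for the submanifold structure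
  (the submanifold may have dimension 0, which no model space of class \<open>euclidean_space\<close> has).\<close>

definition smooth_on :: "'a::real_normed_vector set \<Rightarrow> ('a \<Rightarrow> 'b::real_normed_vector) \<Rightarrow> bool" where
  "smooth_on S f \<longleftrightarrow>
     (\<forall>x\<in>S. \<exists>U F. open U \<and> x \<in> U \<and> (\<forall>k. Ck_on k U F) \<and> (\<forall>y\<in>S \<inter> U. F y = f y))"

text \<open>A chart is a pair of its domain and the coordinate map; the values of the latter outside of
  the domain are irrelevant.\<close>

type_synonym ('a, 'e) chart = "'a set \<times> ('a \<Rightarrow> 'e)"

text \<open>A manifold is a topological space that is a whole type, together with a smooth atlas.
  Hausdorffness and second countability are imposed by the type class of the points.\<close>

definition smooth_manifold ::
    "('a::{t2_space,second_countable_topology}, 'e::euclidean_space) chart set \<Rightarrow> bool" where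
  "smooth_manifold A \<longleftrightarrow>
     (\<Union>(U,\<phi>)\<in>A. U) = UNIV \<and>
     (\<forall>(U,\<phi>)\<in>A. open U \<and> open (\<phi> ` U) \<and> homeomorphism U (\<phi> ` U) \<phi> (inv_into U \<phi>)) \<and>
     (\<forall>(U,\<phi>)\<in>A. \<forall>(V,\<psi>)\<in>A. smooth_on (\<phi> ` (U \<inter> V)) (\<psi> \<circ> inv_into U \<phi>))"

definition std_atlas :: "('a, 'a) chart set" where
  "std_atlas = {(UNIV, id)}"

definition prod_atlas ::
    "('a, 'e) chart set \<Rightarrow> ('b, 'f) chart set \<Rightarrow> ('a \<times> 'b, 'e \<times> 'f) chart set" where
  "prod_atlas A B = {(U \<times> V, map_prod \<phi> \<psi>) | U \<phi> V \<psi>. (U,\<phi>) \<in> A \<and> (V,\<psi>) \<in> B}"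

text \<open>Smoothness of a map on a subset \<open>W\<close> of a manifold, with local extensions (in charts) if
  \<open>W\<close> is not open.\<close>

definition smooth_map ::
    "('a::topological_space, 'e::euclidean_space) chart set \<Rightarrow>
     ('b::topological_space, 'f::euclidean_space) chart set \<Rightarrow> 'a set \<Rightarrow> ('a \<Rightarrow> 'b) \<Rightarrow> bool" where
  "smooth_map A B W f \<longleftrightarrow>
     continuous_on W f \<and>
     (\<forall>(U,\<phi>)\<in>A. \<forall>(V,\<psi>)\<in>B.
        smooth_on (\<phi> ` (U \<inter> W \<inter> f -` V)) (\<psi> \<circ> f \<circ> inv_into U \<phi>))"

text \<open>The tangent space at \<open>x\<close> is the model space, a vector being represented by its coordinates
  in the preferred chart \<open>chart_at A x\<close>. Hence a vector field is a function from points to the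
  model space; smoothness of fields has to be tested after passing to a fixed chart.\<close>

definition chart_at :: "('a, 'e) chart set \<Rightarrow> 'a \<Rightarrow> ('a, 'e) chart" where
  "chart_at A x = (SOME c. c \<in> A \<and> x \<in> fst c)"

definition tmap ::
    "('a, 'e::euclidean_space) chart set \<Rightarrow> ('b, 'f::euclidean_space) chart set \<Rightarrow> ('a \<Rightarrow> 'b) \<Rightarrow>
     'a \<Rightarrow> 'e \<Rightarrow> 'f" where
  "tmap A B f x =
     (case chart_at A x of (U,\<phi>) \<Rightarrow> case chart_at B (f x) of (V,\<psi>) \<Rightarrow>
        frechet_derivative (\<psi> \<circ> f \<circ> inv_into U \<phi>) (at (\<phi> x)))"

definition smooth_vector_field ::
    "('a, 'e::euclidean_space) chart set \<Rightarrow> ('a \<Rightarrow> 'e) \<Rightarrow> bool" where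
  "smooth_vector_field A V \<longleftrightarrow>
     (\<forall>(U,\<phi>)\<in>A. smooth_on (\<phi> ` U)
        (\<lambda>z. tmap A std_atlas \<phi> (inv_into U \<phi> z) (V (inv_into U \<phi> z))))"

text \<open>A vector-valued 1-form is smooth if its values on the coordinate vector fields of every
  chart are smooth.\<close>

definition smooth_one_form ::
    "('a, 'e::euclidean_space) chart set \<Rightarrow> ('a \<Rightarrow> 'e \<Rightarrow> 'v::real_normed_vector) \<Rightarrow> bool" where
  "smooth_one_form A \<omega> \<longleftrightarrow>
     (\<forall>x. linear (\<omega> x)) \<and>
     (\<forall>(U,\<phi>)\<in>A. \<forall>e. smooth_on (\<phi> ` U)
        (\<lambda>z. \<omega> (inv_into U \<phi> z) (tmap std_atlas A (inv_into U \<phi>) z e)))"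

definition vderiv ::
    "('a, 'e::euclidean_space) chart set \<Rightarrow> ('a \<Rightarrow> 'e) \<Rightarrow> ('a \<Rightarrow> real) \<Rightarrow> 'a \<Rightarrow> real" where
  "vderiv A X f x = tmap A std_atlas f x (X x)"

definition sections ::
    "('a, 'e::euclidean_space) chart set \<Rightarrow> ('a \<Rightarrow> 'e set) \<Rightarrow> ('a \<Rightarrow> 'e) set" where
  "sections A D = {V. smooth_vector_field A V \<and> (\<forall>x. V x \<in> D x)}"

section \<open>Linear connections\<close>

definition linear_connection ::
    "('a::topological_space, 'e::euclidean_space) chart set \<Rightarrow>
     (('a \<Rightarrow> 'e) \<Rightarrow> ('a \<Rightarrow> 'e) \<Rightarrow> 'a \<Rightarrow> 'e) \<Rightarrow> bool" where
  "linear_connection A D \<longleftrightarrow>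
     (\<forall>X V. smooth_vector_field A X \<longrightarrow> smooth_vector_field A V \<longrightarrow>
        smooth_vector_field A (D X V)) \<and>
     (\<forall>X Y V. smooth_vector_field A X \<longrightarrow> smooth_vector_field A Y \<longrightarrow> smooth_vector_field A V \<longrightarrow>
        (\<forall>x. D (\<lambda>y. X y + Y y) V x = D X V x + D Y V x)) \<and>
     (\<forall>f X V. smooth_map A std_atlas UNIV f \<longrightarrow> smooth_vector_field A X \<longrightarrow>
        smooth_vector_field A V \<longrightarrow>
        (\<forall>x. D (\<lambda>y. f y *\<^sub>R X y) V x = f x *\<^sub>R D X V x)) \<and>
     (\<forall>X V W. smooth_vector_field A X \<longrightarrow> smooth_vector_field A V \<longrightarrow> smooth_vector_field A W \<longrightarrow>
        (\<forall>x. D X (\<lambda>y. V y + W y) x = D X V x + D X W x)) \<and>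
     (\<forall>f X V. smooth_map A std_atlas UNIV f \<longrightarrow> smooth_vector_field A X \<longrightarrow>
        smooth_vector_field A V \<longrightarrow>
        (\<forall>x. D X (\<lambda>y. f y *\<^sub>R V y) x = vderiv A X f x *\<^sub>R V x + f x *\<^sub>R D X V x))"

definition parallel_metric where
  "parallel_metric A D (g :: 'a \<Rightarrow> 'e::euclidean_space \<Rightarrow> 'e \<Rightarrow> real) \<longleftrightarrow>
     (\<forall>X Y Z. smooth_vector_field A X \<longrightarrow> smooth_vector_field A Y \<longrightarrow> smooth_vector_field A Z \<longrightarrow>
        (\<forall>x. vderiv A X (\<lambda>y. g y (Y y) (Z y)) x - g x (D X Y x) (Z x) - g x (Y x) (D X Z x) = 0))"

definition parallel_field where
  "parallel_field A D (V :: 'a \<Rightarrow> 'e::euclidean_space) \<longleftrightarrow>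
     (\<forall>X. smooth_vector_field A X \<longrightarrow> (\<forall>x. D X V x = 0))"

definition parallel_one_form where
  "parallel_one_form A D (\<alpha> :: 'a \<Rightarrow> 'e::euclidean_space \<Rightarrow> real) \<longleftrightarrow>
     (\<forall>X Y. smooth_vector_field A X \<longrightarrow> smooth_vector_field A Y \<longrightarrow>
        (\<forall>x. vderiv A X (\<lambda>y. \<alpha> y (Y y)) x - \<alpha> x (D X Y x) = 0))"

definition parallel_endo where
  "parallel_endo A D (\<Psi> :: 'a \<Rightarrow> 'e::euclidean_space \<Rightarrow> 'e) \<longleftrightarrow>
     (\<forall>X Y. smooth_vector_field A X \<longrightarrow> smooth_vector_field A Y \<longrightarrow>
        (\<forall>x. D X (\<lambda>y. \<Psi> y (Y y)) x - \<Psi> x (D X Y x) = 0))"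

definition preserves_distribution where
  "preserves_distribution A D (\<D> :: 'a \<Rightarrow> 'e::euclidean_space set) \<longleftrightarrow>
     (\<forall>X V. smooth_vector_field A X \<longrightarrow> V \<in> sections A \<D> \<longrightarrow> D X V \<in> sections A \<D>)"

section \<open>Principal bundles and Cartan geometries for matrix groups\<close>

primrec mat_pow :: "real^'i^'i \<Rightarrow> nat \<Rightarrow> real^'i^'i" where
  "mat_pow X 0 = mat 1"
| "mat_pow X (Suc k) = X ** mat_pow X k"

definition mat_exp :: "real^'i^'i \<Rightarrow> real^'i^'i" where
  "mat_exp X = (\<Sum>k. (1 / fact k) *\<^sub>R mat_pow X k)"

definition Ad :: "real^'i^'i \<Rightarrow> real^'i^'i \<Rightarrow> real^'i^'i" where
  "Ad h X = h ** X ** matrix_inv h"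

text \<open>\<open>r u h\<close> is the right action; it is only relevant for \<open>h \<in> H\<close>, where \<open>H\<close> is a closed
  matrix group. Each local trivialization is \<open>u \<mapsto> (p u, \<theta> u)\<close>, a diffeomorphism onto
  \<open>W \<times> H\<close> that is equivariant.\<close>

definition principal_bundle ::
    "(real^'i^'i) set \<Rightarrow>
     ('p::{t2_space,second_countable_topology}, 'q::euclidean_space) chart set \<Rightarrow>
     ('x::{t2_space,second_countable_topology}, 'e::euclidean_space) chart set \<Rightarrow>
     ('p \<Rightarrow> 'x) \<Rightarrow> ('p \<Rightarrow> real^'i^'i \<Rightarrow> 'p) \<Rightarrow> bool" where
  "principal_bundle H P N p r \<longleftrightarrow>
     smooth_manifold P \<and> smooth_manifold N \<and> smooth_map P N UNIV p \<and>
     smooth_map (prod_atlas P std_atlas) P (UNIV \<times> H) (\<lambda>(u,h). r u h) \<and>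
     (\<forall>u. r u (mat 1) = u) \<and>
     (\<forall>u. \<forall>h\<in>H. \<forall>k\<in>H. r (r u h) k = r u (h ** k)) \<and>
     (\<forall>u. \<forall>h\<in>H. p (r u h) = p u) \<and>
     (\<forall>x. \<exists>W \<theta>. open W \<and> x \<in> W \<and>
        smooth_map P std_atlas (p -` W) \<theta> \<and>
        bij_betw (\<lambda>u. (p u, \<theta> u)) (p -` W) (W \<times> H) \<and>
        smooth_map (prod_atlas N std_atlas) P (W \<times> H) (inv_into (p -` W) (\<lambda>u. (p u, \<theta> u))) \<and>
        (\<forall>u\<in>p -` W. \<forall>h\<in>H. \<theta> (r u h) = \<theta> u ** h))"

definition fundamental_field ::
    "('p, 'q::euclidean_space) chart set \<Rightarrow> ('p \<Rightarrow> real^'i^'i \<Rightarrow> 'p) \<Rightarrow> real^'i^'i \<Rightarrow> 'p \<Rightarrow> 'q" where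
  "fundamental_field P r X u = tmap std_atlas P (\<lambda>t::real. r u (mat_exp (t *\<^sub>R X))) 0 1"

text \<open>Here \<open>g\<close> and \<open>h\<close> are the Lie algebras of the two groups.\<close>

definition cartan_connection where
  "cartan_connection H g h P r (\<omega> :: 'p \<Rightarrow> 'q::euclidean_space \<Rightarrow> real^'i^'i) \<longleftrightarrow>
     smooth_one_form P \<omega> \<and>
     (\<forall>u. bij_betw (\<omega> u) UNIV g) \<and>
     (\<forall>a\<in>H. \<forall>u \<xi>. \<omega> (r u a) (tmap P P (\<lambda>u. r u a) u \<xi>) = Ad (matrix_inv a) (\<omega> u \<xi>)) \<and>
     (\<forall>X\<in>h. \<forall>u. \<omega> u (fundamental_field P r X u) = X)"

definition cartan_geometry where
  "cartan_geometry H g h P N p r \<omega> \<longleftrightarrow>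
     principal_bundle H P N p r \<and> cartan_connection H g h P r \<omega>"

definition principal_connection where
  "principal_connection H h P r (\<gamma> :: 'p \<Rightarrow> 'q::euclidean_space \<Rightarrow> real^'i^'i) \<longleftrightarrow>
     smooth_one_form P \<gamma> \<and>
     (\<forall>u \<xi>. \<gamma> u \<xi> \<in> h) \<and>
     (\<forall>a\<in>H. \<forall>u \<xi>. \<gamma> (r u a) (tmap P P (\<lambda>u. r u a) u \<xi>) = Ad (matrix_inv a) (\<gamma> u \<xi>)) \<and>
     (\<forall>X\<in>h. \<forall>u. \<gamma> u (fundamental_field P r X u) = X)"

definition horizontal_lift where
  "horizontal_lift P N p \<gamma> w u = (THE \<xi>. tmap P N p u \<xi> = w \<and> \<gamma> u \<xi> = 0)"

section \<open>The model\<close>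

text \<open>Throughout, \<open>CARD('k) = n - 1\<close>, so that \<open>n \<ge> 2\<close> is automatic. Vectors of dimension \<open>n\<close> are
  indexed by \<open>'k option\<close>, and the matrices of size \<open>n + 1\<close> by \<open>'k option option\<close>; in both cases
  \<open>None\<close> is the index that comes first.\<close>

type_synonym 'k emat = "real^('k option option)^('k option option)"

definition aff :: "real \<Rightarrow> real^'n \<Rightarrow> real^'n^'n \<Rightarrow> real^('n option)^('n option)" where
  "aff a v A = (\<chi> i j. case (i, j) of
      (None, None) \<Rightarrow> a
    | (None, Some _) \<Rightarrow> 0
    | (Some i', None) \<Rightarrow> v $ i'
    | (Some i', Some j') \<Rightarrow> A $ i' $ j')"

definition euc_group :: "('k::finite) emat set" where
  "euc_group = {aff 1 v A | v A. orthogonal_matrix A}"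

definition euc_algebra :: "('k::finite) emat set" where
  "euc_algebra = {aff 0 v B | v B. transpose B = - B}"

definition orth_group :: "('k::finite) emat set" where
  "orth_group = {aff 1 0 (aff 1 0 h) | h. orthogonal_matrix h}"

definition orth_algebra :: "('k::finite) emat set" where
  "orth_algebra = {aff 0 0 (aff 0 0 B) | B. transpose B = - B}"

text \<open>The complement \<open>\<mm>\<close> is coordinatized by the triples \<open>(v\<^sub>0, v, w)\<close>, and \<open>m_mat\<close> is
  the inclusion into the matrices. The inner product of the product type is the one for which
  the basis \<open>(e\<^sub>0, e\<^sub>i, b\<^sub>i)\<close> is orthonormal.\<close>

type_synonym 'k mspace = "real \<times> (real^'k) \<times> (real^'k)"

definition m_mat :: "('k::finite) mspace \<Rightarrow> 'k emat" where
  "m_mat = (\<lambda>(v0,v,w). \<chi> i j. case (i, j) of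
      (Some None, None) \<Rightarrow> v0
    | (Some (Some a), None) \<Rightarrow> v $ a
    | (Some None, Some (Some b)) \<Rightarrow> - w $ b
    | (Some (Some a), Some None) \<Rightarrow> w $ a
    | _ \<Rightarrow> 0)"

definition pr_m :: "('k::finite) emat \<Rightarrow> 'k mspace" where
  "pr_m X = (THE t. X - m_mat t \<in> orth_algebra)"

definition pr_h :: "('k::finite) emat \<Rightarrow> 'k emat" where
  "pr_h X = (THE Y. Y \<in> orth_algebra \<and> X - Y \<in> range m_mat)"

definition e0 :: "('k::finite) mspace" where
  "e0 = (1, 0, 0)"

definition E_space :: "('k::finite) mspace set" where
  "E_space = span (range (\<lambda>i. (0, axis i 1, 0)))"

definition B_space :: "('k::finite) mspace set" where
  "B_space = span (range (\<lambda>i. (0, 0, axis i 1)))"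

definition psi :: "('k::finite) mspace \<Rightarrow> 'k mspace" where
  "psi = (\<lambda>(v0,v,w). (0, - w, v))"

lemma orth_group_subset_euc_group: "orth_group \<subseteq> euc_group"
proof -
  have "orthogonal_matrix (aff 1 0 h)" if "orthogonal_matrix h" for h :: "real^'k^'k"
  proof -
    have fin: "(\<Sum>i\<in>UNIV. F i) = F None + (\<Sum>i\<in>UNIV. F (Some i))" for F :: "'k option \<Rightarrow> real"
      by (simp add: UNIV_option_conv sum.reindex)
    have "transpose (aff 1 0 h) ** aff 1 0 h = aff 1 0 (transpose h ** h)"
      by (auto simp: vec_eq_iff matrix_matrix_mult_def transpose_def aff_def fin split: option.split)
    also have "\<dots> = mat 1"
      using that by (auto simp: orthogonal_matrix vec_eq_iff aff_def mat_def split: option.split)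
    finally show ?thesis by (simp add: orthogonal_matrix)
  qed
  then show ?thesis unfolding orth_group_def euc_group_def by blast
qed

section \<open>Induced objects\<close>

text \<open>The isomorphism \<open>\<phi>\<^sub>u\<close>.\<close>

definition phi where
  "phi P N p (\<omega> :: 'p \<Rightarrow> 'q::euclidean_space \<Rightarrow> ('k::finite) emat) u =
     (THE f. linear f \<and> bij f \<and> (\<forall>\<xi>. f (tmap P N p u \<xi>) = pr_m (\<omega> u \<xi>)))"

definition fibre_point :: "('p \<Rightarrow> 'x) \<Rightarrow> 'x \<Rightarrow> 'p" where
  "fibre_point p x = (SOME u. p u = x)"

definition ind_metric where
  "ind_metric P N p \<omega> x v w =
     phi P N p \<omega> (fibre_point p x) v \<bullet> phi P N p \<omega> (fibre_point p x) w"

definition ind_U where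
  "ind_U P N p \<omega> x = inv (phi P N p \<omega> (fibre_point p x)) e0"

definition ind_alpha where
  "ind_alpha P N p \<omega> x v = ind_metric P N p \<omega> x (ind_U P N p \<omega> x) v"

definition ind_E where
  "ind_E P N p \<omega> x = phi P N p \<omega> (fibre_point p x) -` E_space"

definition ind_B where
  "ind_B P N p \<omega> x = phi P N p \<omega> (fibre_point p x) -` B_space"

definition ind_Psi where
  "ind_Psi P N p \<omega> x v =
     inv (phi P N p \<omega> (fibre_point p x)) (psi (phi P N p \<omega> (fibre_point p x) v))"

definition gamma_conn where
  "gamma_conn (\<omega> :: 'p \<Rightarrow> 'q::euclidean_space \<Rightarrow> ('k::finite) emat) u \<xi> = pr_h (\<omega> u \<xi>)"

text \<open>The right-hand side \<open>T\<^sub>u f\<^sub>V \<cdot> W\<^sup>\<gamma>\<^sub>u\<close> of the formula for the induced connection.\<close>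

definition assoc_deriv where
  "assoc_deriv P N p \<omega> \<gamma> W V u =
     tmap P std_atlas (\<lambda>u. phi P N p \<omega> u (V (p u))) u (horizontal_lift P N p \<gamma> (W (p u)) u)"

definition nabla where
  "nabla P N p \<omega> \<gamma> W V x =
     inv (phi P N p \<omega> (fibre_point p x)) (assoc_deriv P N p \<omega> \<gamma> W V (fibre_point p x))"

end

theory Submission
  imports Defs
begin

text \<open>
  A vector field \<open>V\<close> on \<open>N\<close> is the same thing as the function
  \<open>f\<^sub>V u = \<phi>\<^sub>u (V (p u))\<close> on the total space with values in \<open>\<mm>\<close>, which is
  equivariant because \<open>\<phi>\<close> is (\<open>phi_r\<close>), and \<open>\<nabla>\<close> is the derivative of \<open>f\<^sub>V\<close> along
  horizontal lifts. Each of the objects to be shown parallel is the transport under \<open>\<phi>\<^sub>u\<close> of an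
  \<open>H\<close>-invariant object on \<open>\<mm>\<close> that does not depend on \<open>u\<close>: the inner product, \<open>e\<^sub>0\<close>,
  the subspaces \<open>E\<close> and \<open>B\<close>, and \<open>\<psi>\<close>. So in terms of the functions \<open>f\<^sub>V\<close> these objects are
  constant, and the derivative passes through them.

  The algebraic part is that \<open>\<gg> = \<hh> \<oplus> \<mm>\<close> is an \<open>H\<close>-invariant splitting
  (\<open>euc_algebra_decompose\<close>, \<open>mpart_conj\<close>, \<open>hpart_conj\<close>). The geometric part is that the kernel of
  \<open>T\<^sub>u p\<close> is exactly the preimage of \<open>\<hh>\<close> under \<open>\<omega> u\<close>. One inclusion holds since the fundamental fields
  are tangent to the fibres. For the other, a trivialization \<open>(p, \<theta>)\<close> has an injective derivative
  (\<open>triv_immersion\<close>), and \<open>T\<theta>\<close> maps vertical vectors to vectors tangent to \<open>H\<close>, which are also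
  reached by fundamental vectors (\<open>vertical_if_Tp_zero\<close>). The existence of \<open>\<phi>\<^sub>u\<close> and of
  horizontal lifts follows.

  What remains is regularity. Over a local section \<open>s\<close> with \<open>\<theta> \<circ> s = 1\<close> one has
  \<open>f\<^sub>V (u) = \<theta>(u)\<inverse> f\<^sub>V (s (p u))\<close>, so that \<open>f\<^sub>V\<close> is differentiable and the derivative along a
  horizontal lift at \<open>s x\<close> is \<open>D\<^sub>w (f\<^sub>V \<circ> s) + (s\<^sup>*\<gamma>)(w) \<cdot> f\<^sub>V\<close> (\<open>AD_section\<close>). The pull-backs
  of the \<open>\<hh>\<close>- and the \<open>\<mm>\<close>-part of \<open>\<omega>\<close> are smooth forms, the latter being a coframe, and solving
  a linear equation with smooth invertible coefficients gives a smooth result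
  (\<open>Ck_on_inverse_family\<close>); hence \<open>\<nabla>\<close> maps smooth fields to smooth fields (\<open>DD_smooth\<close>).
\<close>

section \<open>Smooth maps between open sets of Euclidean spaces\<close>

definition Cinf :: "'a::real_normed_vector set \<Rightarrow> ('a \<Rightarrow> 'b::real_normed_vector) \<Rightarrow> bool" where
  "Cinf S f \<longleftrightarrow> (\<forall>k. Ck_on k S f)"

lemma Ck_on_subset: "Ck_on k S f \<Longrightarrow> T \<subseteq> S \<Longrightarrow> Ck_on k T f"
proof (induction k arbitrary: f)
  case 0
  then show ?case by (auto intro: continuous_on_subset)
next
  case (Suc k)
  then show ?case by (auto simp: subset_eq)
qed

lemma Ck_on_cong:
  assumes "open S" "Ck_on k S f" "\<And>x. x \<in> S \<Longrightarrow> f x = g x"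
  shows "Ck_on k S g"
  using assms(2,3)
proof (induction k arbitrary: f g)
  case 0
  then show ?case by (auto cong: continuous_on_cong)
next
  case (Suc k)
  have hd: "(g has_derivative frechet_derivative f (at x)) (at x)" if "x \<in> S" for x
    using Suc.prems that assms(1) frechet_derivative_works
    by (metis Ck_on.simps(2) has_derivative_transform_within_open)
  have eq: "frechet_derivative f (at x) = frechet_derivative g (at x)" if "x \<in> S" for x
    using hd[OF that] frechet_derivative_at by blast
  have "Ck_on k S (\<lambda>x. frechet_derivative g (at x) v)" for v
    by (rule Suc.IH[of "\<lambda>x. frechet_derivative f (at x) v"]) (use Suc.prems eq in auto)
  then show ?case using hd by (auto simp: differentiable_def)
qed

lemma Ck_on_local:
  assumes "\<And>x. x \<in> S \<Longrightarrow> \<exists>U. open U \<and> x \<in> U \<and> Ck_on k U f"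
  shows "Ck_on k S f"
  using assms
proof (induction k arbitrary: f)
  case 0
  show ?case unfolding Ck_on.simps
  proof (rule continuous_at_imp_continuous_on, safe)
    fix x assume "x \<in> S"
    then obtain U where "open U" "x \<in> U" "continuous_on U f" using 0 by auto
    then show "isCont f x" by (simp add: continuous_on_eq_continuous_at)
  qed
next
  case (Suc k)
  have "f differentiable at x" if "x \<in> S" for x
    using Suc.prems[OF that] by auto
  moreover have "Ck_on k S (\<lambda>x. frechet_derivative f (at x) v)" for v
    by (rule Suc.IH) (use Suc.prems in fastforce)
  ultimately show ?case by simp
qed

lemma Ck_on_SucD: "Ck_on (Suc k) S f \<Longrightarrow> Ck_on k S f"
proof (induction k arbitrary: f)
  case 0
  then show ?case
    by (auto intro!: continuous_at_imp_continuous_on differentiable_imp_continuous_within)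
next
  case (Suc k)
  then show ?case by (metis Ck_on.simps(2))
qed

lemma Ck_on_SucI:
  assumes "open S" "\<And>x. x \<in> S \<Longrightarrow> (f has_derivative f' x) (at x)" "\<And>v. Ck_on k S (\<lambda>x. f' x v)"
  shows "Ck_on (Suc k) S f"
proof -
  have "frechet_derivative f (at x) = f' x" if "x \<in> S" for x
    using assms(2)[OF that] frechet_derivative_at by metis
  then have "Ck_on k S (\<lambda>x. frechet_derivative f (at x) v)" for v
    by (intro Ck_on_cong[OF assms(1) assms(3)]) auto
  then show ?thesis using assms(2) by (auto simp: differentiable_def)
qed

lemma Ck_on_has_derivative:
  "Ck_on (Suc k) S f \<Longrightarrow> x \<in> S \<Longrightarrow> (f has_derivative frechet_derivative f (at x)) (at x)"
  by (simp add: frechet_derivative_works)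

lemma Ck_on_const: "Ck_on k S (\<lambda>x. c)"
  by (induction k arbitrary: c) auto

lemma Ck_on_add:
  assumes "open S" "Ck_on k S f" "Ck_on k S g"
  shows "Ck_on k S (\<lambda>x. f x + g x)"
  using assms(2,3)
proof (induction k arbitrary: f g)
  case 0
  then show ?case by (auto intro: continuous_on_add)
next
  case (Suc k)
  show ?case
    by (rule Ck_on_SucI[OF assms(1) has_derivative_add[OF Ck_on_has_derivative Ck_on_has_derivative]])
      (use Suc in auto)
qed

lemma Ck_on_sum:
  assumes "open S" "\<And>i. i \<in> I \<Longrightarrow> Ck_on k S (f i)"
  shows "Ck_on k S (\<lambda>x. \<Sum>i\<in>I. f i x)"
  using assms(2)
  by (induction I rule: infinite_finite_induct) (auto intro: Ck_on_const Ck_on_add[OF assms(1)])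

lemma Ck_on_bilinear:
  assumes "bounded_bilinear h" "open S" "Ck_on k S f" "Ck_on k S g"
  shows "Ck_on k S (\<lambda>x. h (f x) (g x))"
  using assms(3,4)
proof (induction k arbitrary: f g)
  case 0
  then show ?case by (auto intro: bounded_bilinear.continuous_on[OF assms(1)])
next
  case (Suc k)
  have f: "Ck_on k S f" and g: "Ck_on k S g" using Suc.prems Ck_on_SucD by auto
  show ?case
    by (rule Ck_on_SucI[OF assms(2) bounded_bilinear.FDERIV[OF assms(1) Ck_on_has_derivative Ck_on_has_derivative]])
      (use Suc f g in \<open>auto intro!: Ck_on_add[OF assms(2)]\<close>)
qed

lemma Ck_on_linear:
  assumes "bounded_linear h" "open S" "Ck_on k S f"
  shows "Ck_on k S (\<lambda>x. h (f x))"
  using assms(3)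
proof (induction k arbitrary: f)
  case 0
  then show ?case by (auto intro: bounded_linear.continuous_on[OF assms(1)])
next
  case (Suc k)
  show ?case
    by (rule Ck_on_SucI[OF assms(2) bounded_linear.has_derivative[OF assms(1) Ck_on_has_derivative]])
      (use Suc in auto)
qed

lemma linear_basis_expansion:
  fixes l :: "'a::euclidean_space \<Rightarrow> 'b::real_vector"
  assumes "linear l"
  shows "l e = (\<Sum>b\<in>Basis. (e \<bullet> b) *\<^sub>R l b)"
proof -
  have "l e = l (\<Sum>b\<in>Basis. (e \<bullet> b) *\<^sub>R b)" by (simp add: euclidean_representation)
  then show ?thesis using assms by (simp add: linear_sum linear_cmul)
qed

text \<open>Expanding the argument in a basis reduces a family of linear maps to its values on fixed
  vectors; this is how all parameter-dependent linear maps below are handled.\<close>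

lemma Ck_on_linear_family:
  fixes Y :: "'a::real_normed_vector \<Rightarrow> 'b::euclidean_space"
  assumes "open S" "\<And>x. x \<in> S \<Longrightarrow> linear (L x)" "\<And>e. Ck_on k S (\<lambda>x. L x e)" "Ck_on k S Y"
  shows "Ck_on k S (\<lambda>x. L x (Y x))"
proof (rule Ck_on_cong[OF assms(1)])
  show "Ck_on k S (\<lambda>x. \<Sum>b\<in>Basis. (Y x \<bullet> b) *\<^sub>R L x b)"
    by (intro Ck_on_sum Ck_on_bilinear[OF bounded_bilinear_scaleR] assms
        Ck_on_linear[OF bounded_linear_inner_left])
  show "(\<Sum>b\<in>Basis. (Y x \<bullet> b) *\<^sub>R L x b) = L x (Y x)" if "x \<in> S" for x
    by (rule linear_basis_expansion[OF assms(2)[OF that], symmetric])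
qed

lemma Ck_on_compose:
  fixes f :: "'a::real_normed_vector \<Rightarrow> 'b::euclidean_space"
  assumes "open S" "open T" "Ck_on k S f" "Ck_on k T g" "\<And>x. x \<in> S \<Longrightarrow> f x \<in> T"
  shows "Ck_on k S (\<lambda>x. g (f x))"
  using assms(3,4)
proof (induction k arbitrary: g)
  case 0
  then show ?case using assms(5)
    by (auto intro: continuous_on_compose2)
next
  case (Suc k)
  have f: "Ck_on k S f" using Suc.prems Ck_on_SucD by auto
  show ?case
  proof (rule Ck_on_SucI[OF assms(1)])
    show "((\<lambda>x. g (f x)) has_derivative
      (\<lambda>v. frechet_derivative g (at (f x)) (frechet_derivative f (at x) v))) (at x)" if "x \<in> S" for x
      using has_derivative_compose[OF Ck_on_has_derivative[OF Suc.prems(1) that]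
          Ck_on_has_derivative[OF Suc.prems(2) assms(5)[OF that]]] .
    show "Ck_on k S (\<lambda>x. frechet_derivative g (at (f x)) (frechet_derivative f (at x) v))" for v
    proof (rule Ck_on_linear_family[OF assms(1)])
      show "linear (frechet_derivative g (at (f x)))" if "x \<in> S" for x
        using Suc.prems(2) assms(5)[OF that] by (auto intro: linear_frechet_derivative)
      show "Ck_on k S (\<lambda>x. frechet_derivative g (at (f x)) e)" for e
        by (rule Suc.IH[OF f]) (use Suc.prems in auto)
      show "Ck_on k S (\<lambda>x. frechet_derivative f (at x) v)" using Suc.prems by auto
    qed
  qed
qed

text \<open>Continuity at each fixed vector gives continuity in the operator norm, by finite dimension.\<close>

lemma continuous_linear_family:
  fixes L :: "'a::real_normed_vector \<Rightarrow> 'b::euclidean_space \<Rightarrow> 'c::real_normed_vector"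
  assumes "open S" "x \<in> S" "\<And>x. x \<in> S \<Longrightarrow> linear (L x)" "\<And>e. isCont (\<lambda>x. L x e) x" "\<epsilon> > 0"
  shows "eventually (\<lambda>y. \<forall>e. norm (L y e - L x e) \<le> \<epsilon> * norm e) (nhds x)"
proof -
  define n where "n = real (card (Basis :: 'b set))"
  have n: "n > 0" by (simp add: n_def)
  have "eventually (\<lambda>y. dist (L y b) (L x b) < \<epsilon> / n) (nhds x)" for b
    using assms(4)[of b] n assms(5)
    by (intro tendstoD) (simp_all add: isCont_def tendsto_at_iff_tendsto_nhds[of "\<lambda>y. L y b"])
  then have "eventually (\<lambda>y. \<forall>b\<in>Basis. dist (L y b) (L x b) < \<epsilon> / n) (nhds x)"
    by (simp add: eventually_ball_finite)
  moreover have "eventually (\<lambda>y. y \<in> S) (nhds x)" using assms(1,2) by (simp add: eventually_nhds_in_open)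
  ultimately show ?thesis
  proof eventually_elim
    case (elim y)
    show ?case
    proof
      fix e :: 'b
      have lin: "linear (\<lambda>e. L y e - L x e)" using assms(3)[OF elim(2)] assms(3)[OF assms(2)]
        by (rule linear_compose_sub)
      have "L y e - L x e = (\<Sum>b\<in>Basis. (e \<bullet> b) *\<^sub>R (L y b - L x b))"
        by (rule linear_basis_expansion[OF lin])
      also have "norm \<dots> \<le> (\<Sum>b\<in>(Basis :: 'b set). norm e * (\<epsilon> / n))"
      proof (rule sum_norm_le)
        fix b :: 'b assume b: "b \<in> Basis"
        show "norm ((e \<bullet> b) *\<^sub>R (L y b - L x b)) \<le> norm e * (\<epsilon> / n)"
          using elim(1) b Basis_le_norm[OF b, of e] unfolding norm_scaleR dist_norm
          by (intro mult_mono) (auto intro: less_imp_le)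
      qed
      also have "\<dots> = \<epsilon> * norm e" using n by (simp add: n_def)
      finally show "norm (L y e - L x e) \<le> \<epsilon> * norm e" .
    qed
  qed
qed

text \<open>If \<open>L x (G x) = Y x\<close>, then \<open>G\<close> is as smooth as \<open>L\<close> and \<open>Y\<close>: subtracting the equations at
  two points shows that \<open>G\<close> is continuous and then differentiable, with a derivative that solves an
  equation of the same kind.\<close>

lemma isCont_inverse_family:
  fixes L :: "'a::real_normed_vector \<Rightarrow> 'b::euclidean_space \<Rightarrow> 'c::euclidean_space"
  assumes "open S" "x \<in> S" "\<And>x. x \<in> S \<Longrightarrow> linear (L x)" "inj (L x)" "\<And>e. isCont (\<lambda>x. L x e) x"
    and Y: "isCont Y x" and G: "\<And>x. x \<in> S \<Longrightarrow> L x (G x) = Y x"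
  shows "isCont G x"
proof -
  obtain c where c: "c > 0" "\<And>e. norm (L x e) \<ge> c * norm e"
    using linear_inj_bounded_below_pos[OF assms(3)[OF assms(2)] assms(4)] by (auto simp: mult.commute)
  have ev: "eventually (\<lambda>y. norm (G y - G x) \<le> 2 / c * norm (Y y - L y (G x))) (nhds x)"
  proof -
    have "eventually (\<lambda>y. \<forall>e. norm (L y e - L x e) \<le> c / 2 * norm e) (nhds x)"
      using c(1) by (intro continuous_linear_family[OF assms(1,2)]) (auto intro: assms(3,5))
    then show ?thesis
      using eventually_nhds_in_open[OF assms(1,2)]
  proof eventually_elim
    case (elim y)
    have "c * norm (G y - G x) \<le> norm (L x (G y - G x))" by (rule c)
    also have "\<dots> \<le> norm (L y (G y - G x)) + norm (L y (G y - G x) - L x (G y - G x))"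
      using norm_triangle_sub[of "L x (G y - G x)" "L y (G y - G x)"] by (simp add: norm_minus_commute)
    also have "\<dots> \<le> norm (L y (G y - G x)) + c / 2 * norm (G y - G x)" using elim(1)[rule_format, of "G y - G x"] by simp
    also have "L y (G y - G x) = Y y - L y (G x)"
      using linear_diff[OF assms(3)[OF elim(2)]] G[OF elim(2)] by simp
    finally have "c / 2 * norm (G y - G x) \<le> norm (Y y - L y (G x))" by (simp add: field_simps)
    then show ?case using c(1) by (simp add: field_simps)
  qed
  qed
  have "((\<lambda>y. 2 / c * norm (Y y - L y (G x))) \<longlongrightarrow> 2 / c * norm (Y x - L x (G x))) (at x)"
    using Y assms(5)[of "G x"] by (intro tendsto_intros) (auto simp: isCont_def)
  then have "((\<lambda>y. 2 / c * norm (Y y - L y (G x))) \<longlongrightarrow> 0) (at x)" using G[OF assms(2)] by simp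
  then have "((\<lambda>y. G y - G x) \<longlongrightarrow> 0) (at x)"
    by (rule Lim_null_comparison[rotated])
      (use ev in \<open>auto simp: eventually_nhds_conv_at\<close>)
  then show ?thesis by (simp add: isCont_def LIM_zero_cancel)
qed

text \<open>A product rule that needs only continuity of the factor \<open>G\<close>, since the other factor vanishes
  at the point in question. It breaks the circle in the differentiation of an inverse, where \<open>G\<close> is
  the function whose differentiability is to be shown.\<close>

lemma has_derivative_linear_family_vanishing:
  fixes G :: "'a::real_normed_vector \<Rightarrow> 'b::euclidean_space"
  assumes "open S" "x \<in> S" "\<And>x. x \<in> S \<Longrightarrow> linear (M x)" "\<And>e. M x e = 0"
    and "\<And>e. ((\<lambda>x. M x e) has_derivative (\<lambda>v. M' v e)) (at x)" "\<And>v. linear (M' v)" "isCont G x"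
  shows "((\<lambda>x. M x (G x)) has_derivative (\<lambda>v. M' v (G x))) (at x)"
proof (rule has_derivative_transform_within_open[OF _ assms(1,2)])
  have *: "((\<lambda>y. g y *\<^sub>R m y) has_derivative (\<lambda>v. g x *\<^sub>R m' v)) (at x)"
    if g: "isCont g x" and m: "(m has_derivative m') (at x)" and m0: "m x = 0" for g :: "'a \<Rightarrow> real" and m m'
  proof (subst has_derivative_iff_Ex, intro conjI)
    have bl: "bounded_linear m'" using m by (rule has_derivative_bounded_linear)
    then show "bounded_linear (\<lambda>v. g x *\<^sub>R m' v)" by (rule bounded_linear_const_scaleR)
    obtain e where e: "\<And>h. m (x+h) = m x + m' h + e h" "((\<lambda>h. norm (e h) / norm h) \<longlongrightarrow> 0) (at 0)"
      using m unfolding has_derivative_iff_Ex by blast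
    obtain K where K: "\<And>h. norm (m' h) \<le> norm h * K" using bounded_linear.bounded[OF bl] by blast
    define d where "d h = (g (x+h) - g x) *\<^sub>R m' h + g (x+h) *\<^sub>R e h" for h
    have gl: "((\<lambda>h. g (x+h)) \<longlongrightarrow> g x) (at 0)" using g by (simp add: isCont_def LIM_offset_zero_iff)
    have "((\<lambda>h. norm (g (x+h) - g x) * K + norm (g (x+h)) * (norm (e h) / norm h)) \<longlongrightarrow>
        norm (g x - g x) * K + norm (g x) * 0) (at 0)"
      by (intro tendsto_intros gl e(2))
    then have lim: "((\<lambda>h. norm (g (x+h) - g x) * K + norm (g (x+h)) * (norm (e h) / norm h)) \<longlongrightarrow> 0) (at 0)"
      by simp
    have "((\<lambda>h. norm (d h) / norm h) \<longlongrightarrow> 0) (at 0)"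
    proof (rule Lim_null_comparison[OF _ lim], rule always_eventually, rule allI)
      fix h
      have "norm (d h) \<le> norm (g (x+h) - g x) * (norm h * K) + norm (g (x+h)) * norm (e h)"
        unfolding d_def using K[of h]
        by (intro norm_triangle_le add_mono) (auto intro: mult_left_mono)
      then show "norm (norm (d h) / norm h) \<le> norm (g (x+h) - g x) * K + norm (g (x+h)) * (norm (e h) / norm h)"
        by (cases "h = 0") (auto simp: field_simps e d_def)
    qed
    moreover have "\<forall>h. g (x + h) *\<^sub>R m (x + h) = g x *\<^sub>R m x + g x *\<^sub>R m' h + d h"
      using e(1) m0 by (simp add: d_def algebra_simps)
    ultimately show "\<exists>e. (\<forall>h. g (x + h) *\<^sub>R m (x + h) = g x *\<^sub>R m x + g x *\<^sub>R m' h + e h) \<and>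
        ((\<lambda>h. norm (e h) / norm h) \<longlongrightarrow> 0) (at 0)" by blast
  qed
  have "((\<lambda>x. \<Sum>b\<in>Basis. (G x \<bullet> b) *\<^sub>R M x b) has_derivative (\<lambda>v. \<Sum>b\<in>Basis. (G x \<bullet> b) *\<^sub>R M' v b)) (at x)"
    using assms(4,5,7) by (intro has_derivative_sum *) auto
  then show "((\<lambda>x. \<Sum>b\<in>Basis. (G x \<bullet> b) *\<^sub>R M x b) has_derivative (\<lambda>v. M' v (G x))) (at x)"
    by (simp flip: linear_basis_expansion[OF assms(6)])
  show "(\<Sum>b\<in>Basis. (G y \<bullet> b) *\<^sub>R M y b) = M y (G y)" if "y \<in> S" for y
    by (rule linear_basis_expansion[OF assms(3)[OF that], symmetric])
qed

lemma linear_inv_bij: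
  assumes "linear f" "bij f"
  shows "linear (inv f)"
proof (rule linearI)
  have f: "f (inv f y) = y" for y using assms(2) by (simp add: bij_is_surj surj_f_inv_f)
  have g: "inv f (f x) = x" for x using assms(2) by (simp add: bij_is_inj)
  show "inv f (a + b) = inv f a + inv f b" for a b
    using g[of "inv f a + inv f b"] by (simp add: linear_add[OF assms(1)] f)
  show "inv f (c *\<^sub>R a) = c *\<^sub>R inv f a" for c a
    using g[of "c *\<^sub>R inv f a"] by (simp add: linear_cmul[OF assms(1)] f)
qed

lemma Ck_on_inverse_family:
  fixes L :: "'a::real_normed_vector \<Rightarrow> 'b::euclidean_space \<Rightarrow> 'c::euclidean_space"
  assumes "open S" "\<And>x. x \<in> S \<Longrightarrow> linear (L x)" "\<And>x. x \<in> S \<Longrightarrow> bij (L x)" "\<And>e. Ck_on k S (\<lambda>x. L x e)"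
    and Y: "Ck_on k S Y" and G: "\<And>x. x \<in> S \<Longrightarrow> L x (G x) = Y x"
  shows "Ck_on k S G"
  using assms(4) Y G
proof (induction k arbitrary: Y G)
  case 0
  have "isCont G x" if "x \<in> S" for x
    by (rule isCont_inverse_family[OF assms(1) that, of L Y])
      (use 0 that assms(1-3) in \<open>auto simp: continuous_on_eq_continuous_at bij_is_inj\<close>)
  then show ?case by (simp add: continuous_at_imp_continuous_on)
next
  case (Suc k)
  have k: "\<And>e. Ck_on k S (\<lambda>x. L x e)" "Ck_on k S Y" using Suc.prems Ck_on_SucD by blast+
  have Gk: "Ck_on k S G" by (rule Suc.IH[OF k Suc.prems(3)])
  define L' where "L' x v e = frechet_derivative (\<lambda>x. L x e) (at x) v" for x v e
  define Y' where "Y' x = frechet_derivative Y (at x)" for x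
  have L': "((\<lambda>x. L x e) has_derivative (\<lambda>v. L' x v e)) (at x)" if "x \<in> S" for x e
    unfolding L'_def using Ck_on_has_derivative[OF Suc.prems(1) that] by simp
  have Y': "(Y has_derivative Y' x) (at x)" if "x \<in> S" for x
    unfolding Y'_def using Ck_on_has_derivative[OF Suc.prems(2) that] by simp
  have linL': "linear (L' x v)" if x: "x \<in> S" for x v
  proof (rule linearI)
    fix a b c
    have "((\<lambda>x. L x (a + b)) has_derivative (\<lambda>v. L' x v a + L' x v b)) (at x)"
      by (rule has_derivative_transform_within_open[OF has_derivative_add[OF L'[OF x, of a] L'[OF x, of b]] assms(1) x])
        (simp add: linear_add assms(2))
    then show "L' x v (a + b) = L' x v a + L' x v b"
      using has_derivative_unique L'[OF x] by metis
    have "((\<lambda>x. L x (c *\<^sub>R a)) has_derivative (\<lambda>v. c *\<^sub>R L' x v a)) (at x)"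
      by (rule has_derivative_transform_within_open[OF has_derivative_scaleR_right[OF L'[OF x, of a]] assms(1) x])
        (simp add: linear_cmul assms(2))
    then show "L' x v (c *\<^sub>R a) = c *\<^sub>R L' x v a"
      using has_derivative_unique L'[OF x] by metis
  qed
  define R where "R x v = inv (L x) (Y' x v - L' x v (G x))" for x v
  have LR: "L x (R x v) = Y' x v - L' x v (G x)" if "x \<in> S" for x v
    using assms(3)[OF that] by (simp add: R_def bij_is_surj surj_f_inv_f)
  have Gcont: "isCont G x" if x: "x \<in> S" for x
  proof (rule isCont_inverse_family[OF assms(1) x, of L Y])
    show "inj (L x)" using assms(3) x by (simp add: bij_is_inj)
    show "isCont (\<lambda>x. L x e) x" for e using L'[OF x] by (rule has_derivative_continuous)
    show "isCont Y x" using Y'[OF x] by (rule has_derivative_continuous)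
  qed (use Suc.prems(3) assms(2) in auto)
  show ?case
  proof (rule Ck_on_SucI[OF assms(1)])
    fix x assume x: "x \<in> S"
    have blinv: "bounded_linear (inv (L x))"
      using assms(2,3)[OF x] by (simp add: linear_conv_bounded_linear[symmetric] bij_is_inj bij_is_surj linear_inv_bij)
    have lin: "linear (\<lambda>e. L y e - L x e)" if "y \<in> S" for y
      by (rule linear_compose_sub) (use assms(2) x that in auto)
    \<comment> \<open>\<open>G y\<close> is expressed through \<open>Y y\<close> and the variation of \<open>L\<close>, with only \<open>L x\<close> inverted\<close>
    have "((\<lambda>y. L y (G y) - L x (G y)) has_derivative (\<lambda>v. L' x v (G x))) (at x)"
      by (rule has_derivative_linear_family_vanishing[OF assms(1) x lin, where M'="L' x"])
         (use L'[OF x] linL'[OF x] Gcont[OF x] in \<open>auto intro!: derivative_eq_intros\<close>)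
    then have "((\<lambda>y. inv (L x) (Y y - (L y (G y) - L x (G y)))) has_derivative (\<lambda>v. R x v)) (at x)"
      unfolding R_def
      by (intro bounded_linear.has_derivative[OF blinv] has_derivative_diff Y'[OF x])
    then show "(G has_derivative R x) (at x)"
      by (rule has_derivative_transform_within_open[OF _ assms(1) x])
        (simp add: Suc.prems(3) assms(3)[OF x] bij_is_inj)
  next
    fix v
    have "Ck_on k S (\<lambda>x. L' x v (G x))"
      by (rule Ck_on_linear_family[OF assms(1) linL' _ Gk]) (use Suc.prems(1) in \<open>auto simp: L'_def\<close>)
    then have "Ck_on k S (\<lambda>x. (-1) *\<^sub>R L' x v (G x))"
      by (rule Ck_on_linear[OF bounded_linear_scaleR_right assms(1)])
    then have "Ck_on k S (\<lambda>x. Y' x v + (-1) *\<^sub>R L' x v (G x))"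
      using Suc.prems(2) by (intro Ck_on_add[OF assms(1)]) (auto simp: Y'_def)
    then show "Ck_on k S (\<lambda>x. R x v)"
      by (intro Suc.IH[OF k(1)]) (auto simp: LR)
  qed
qed

lemma Cinf_subset: "Cinf S f \<Longrightarrow> T \<subseteq> S \<Longrightarrow> Cinf T f"
  unfolding Cinf_def using Ck_on_subset by blast

lemma Cinf_cong: "open S \<Longrightarrow> Cinf S f \<Longrightarrow> (\<And>x. x \<in> S \<Longrightarrow> f x = g x) \<Longrightarrow> Cinf S g"
  unfolding Cinf_def using Ck_on_cong by blast

lemma Cinf_const: "Cinf S (\<lambda>x. c)"
  unfolding Cinf_def by (simp add: Ck_on_const)

lemma Cinf_ident: "open S \<Longrightarrow> Cinf S (\<lambda>x. x)"
  unfolding Cinf_def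
proof
  show "Ck_on k S (\<lambda>x. x)" if "open S" for k
    by (cases k) (auto intro!: Ck_on_SucI[OF that has_derivative_ident] Ck_on_const)
qed

lemma Cinf_add: "open S \<Longrightarrow> Cinf S f \<Longrightarrow> Cinf S g \<Longrightarrow> Cinf S (\<lambda>x. f x + g x)"
  unfolding Cinf_def using Ck_on_add by blast

lemma Cinf_linear: "bounded_linear h \<Longrightarrow> open S \<Longrightarrow> Cinf S f \<Longrightarrow> Cinf S (\<lambda>x. h (f x))"
  unfolding Cinf_def using Ck_on_linear by blast

lemma Cinf_bilinear:
  "bounded_bilinear h \<Longrightarrow> open S \<Longrightarrow> Cinf S f \<Longrightarrow> Cinf S g \<Longrightarrow> Cinf S (\<lambda>x. h (f x) (g x))"
  unfolding Cinf_def using Ck_on_bilinear by blast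

lemma Cinf_linear_family:
  fixes Y :: "'a::real_normed_vector \<Rightarrow> 'b::euclidean_space"
  shows "open S \<Longrightarrow> (\<And>x. x \<in> S \<Longrightarrow> linear (L x)) \<Longrightarrow> (\<And>e. Cinf S (\<lambda>x. L x e)) \<Longrightarrow> Cinf S Y \<Longrightarrow>
    Cinf S (\<lambda>x. L x (Y x))"
  unfolding Cinf_def using Ck_on_linear_family by blast

lemma Cinf_inverse_family:
  fixes L :: "'a::real_normed_vector \<Rightarrow> 'b::euclidean_space \<Rightarrow> 'c::euclidean_space"
  shows "open S \<Longrightarrow> (\<And>x. x \<in> S \<Longrightarrow> linear (L x)) \<Longrightarrow> (\<And>x. x \<in> S \<Longrightarrow> bij (L x)) \<Longrightarrow>
    (\<And>e. Cinf S (\<lambda>x. L x e)) \<Longrightarrow> Cinf S Y \<Longrightarrow> (\<And>x. x \<in> S \<Longrightarrow> L x (G x) = Y x) \<Longrightarrow> Cinf S G"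
  unfolding Cinf_def using Ck_on_inverse_family by blast

lemma Cinf_compose:
  fixes f :: "'a::real_normed_vector \<Rightarrow> 'b::euclidean_space"
  shows "open S \<Longrightarrow> open T \<Longrightarrow> Cinf S f \<Longrightarrow> Cinf T g \<Longrightarrow> (\<And>x. x \<in> S \<Longrightarrow> f x \<in> T) \<Longrightarrow>
    Cinf S (\<lambda>x. g (f x))"
  unfolding Cinf_def using Ck_on_compose by blast

lemma Cinf_has_derivative:
  "Cinf S f \<Longrightarrow> x \<in> S \<Longrightarrow> (f has_derivative frechet_derivative f (at x)) (at x)"
  unfolding Cinf_def using Ck_on_has_derivative by blast

lemma Cinf_derivative: "Cinf S f \<Longrightarrow> Cinf S (\<lambda>x. frechet_derivative f (at x) v)"
  unfolding Cinf_def by (metis Ck_on.simps(2))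

lemma Cinf_frechet:
  fixes f :: "'a::euclidean_space \<Rightarrow> 'b::real_normed_vector"
  assumes "open S" "Cinf S f" "Cinf S Y"
  shows "Cinf S (\<lambda>x. frechet_derivative f (at x) (Y x))"
  by (rule Cinf_linear_family[OF assms(1) _ Cinf_derivative[OF assms(2)] assms(3)])
    (use Cinf_has_derivative[OF assms(2)] has_derivative_linear in blast)

lemma smooth_on_open_iff:
  assumes "open S"
  shows "smooth_on S f \<longleftrightarrow> Cinf S f"
proof
  assume "Cinf S f"
  then show "smooth_on S f" unfolding smooth_on_def Cinf_def using assms by blast
next
  assume *: "smooth_on S f"
  show "Cinf S f" unfolding Cinf_def
  proof (intro allI Ck_on_local)
    fix k x assume "x \<in> S"
    then obtain U F where U: "open U" "x \<in> U" "\<forall>k. Ck_on k U F" "\<forall>y\<in>S \<inter> U. F y = f y"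
      using * unfolding smooth_on_def by meson
    have "Ck_on k (S \<inter> U) f"
      by (rule Ck_on_cong[of _ _ F]) (use U assms in \<open>auto intro: Ck_on_subset\<close>)
    then show "\<exists>U. open U \<and> x \<in> U \<and> Ck_on k U f" using U assms \<open>x \<in> S\<close> by blast
  qed
qed

lemma smooth_on_local_Cinf:
  assumes "open S" "\<And>x. x \<in> S \<Longrightarrow> \<exists>U. open U \<and> x \<in> U \<and> Cinf U f"
  shows "smooth_on S f"
  unfolding smooth_on_open_iff[OF assms(1)] Cinf_def
  using assms(2) by (intro allI Ck_on_local) (auto simp: Cinf_def)

section \<open>Derivatives of maps between manifolds\<close>

text \<open>Tangent vectors are given in preferred charts, so the derivative is the ordinary one of the
  expression in preferred charts. Unlike \<^const>\<open>tmap\<close>, the predicate carries the existence of the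
  derivative, and continuity, without which the chart expression would say nothing about \<open>f\<close>.\<close>

definition has_mderiv ::
    "('a::t2_space, 'e::euclidean_space) chart set \<Rightarrow>
     ('b::topological_space, 'f::euclidean_space) chart set \<Rightarrow> ('a \<Rightarrow> 'b) \<Rightarrow> ('e \<Rightarrow> 'f) \<Rightarrow> 'a \<Rightarrow> bool" where
  "has_mderiv A B f D x \<longleftrightarrow> isCont f x \<and>
     ((snd (chart_at B (f x)) \<circ> f \<circ> inv_into (fst (chart_at A x)) (snd (chart_at A x)))
        has_derivative D) (at (snd (chart_at A x) x))"

lemma tmap_eq: "has_mderiv A B f D x \<Longrightarrow> tmap A B f x = D"
  unfolding has_mderiv_def tmap_def
  by (auto split: prod.splits dest: frechet_derivative_at)

lemma has_mderiv_tmap: "has_mderiv A B f D x \<Longrightarrow> has_mderiv A B f (tmap A B f x) x"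
  by (simp add: tmap_eq)

lemma has_mderiv_unique: "has_mderiv A B f D x \<Longrightarrow> has_mderiv A B f E x \<Longrightarrow> D = E"
  using tmap_eq by blast

lemma has_mderiv_linear: "has_mderiv A B f D x \<Longrightarrow> linear D"
  unfolding has_mderiv_def using has_derivative_linear by blast

lemma smooth_manifold_chart:
  assumes "smooth_manifold A" "(U,\<phi>) \<in> A"
  shows "open U" "open (\<phi> ` U)" "continuous_on U \<phi>" "continuous_on (\<phi> ` U) (inv_into U \<phi>)"
    "\<And>x. x \<in> U \<Longrightarrow> inv_into U \<phi> (\<phi> x) = x"
proof -
  have h: "homeomorphism U (\<phi> ` U) \<phi> (inv_into U \<phi>)" and o: "open U" "open (\<phi> ` U)"
    using assms unfolding smooth_manifold_def by fast+
  show "open U" "open (\<phi> ` U)" by fact+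
  show "continuous_on U \<phi>" "continuous_on (\<phi> ` U) (inv_into U \<phi>)"
    "\<And>x. x \<in> U \<Longrightarrow> inv_into U \<phi> (\<phi> x) = x"
    using h unfolding homeomorphism_def by auto
qed

lemma chart_open_image:
  assumes "smooth_manifold A" "(U,\<phi>) \<in> A" "open W" "W \<subseteq> U"
  shows "open (\<phi> ` W)"
proof -
  note c = smooth_manifold_chart[OF assms(1,2)]
  have "\<phi> ` W = \<phi> ` U \<inter> inv_into U \<phi> -` W"
    using assms(4) c(5) by (auto simp: image_iff)
  then show ?thesis using continuous_open_preimage[OF c(4,2) assms(3)] by simp
qed

lemma chart_isCont:
  assumes "smooth_manifold A" "(U,\<phi>) \<in> A" "x \<in> U"
  shows "isCont \<phi> x" "isCont (inv_into U \<phi>) (\<phi> x)"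
  using smooth_manifold_chart[OF assms(1,2)] assms(3)
  by (auto simp: continuous_on_eq_continuous_at)

lemma chart_at_chart:
  assumes "smooth_manifold A"
  shows "(fst (chart_at A x), snd (chart_at A x)) \<in> A" "x \<in> fst (chart_at A x)"
proof -
  have "\<exists>c. c \<in> A \<and> x \<in> fst c"
  proof -
    have "(\<Union>(U,\<phi>)\<in>A. U) = UNIV" using assms unfolding smooth_manifold_def by (rule conjunct1)
    then have "x \<in> (\<Union>(U,\<phi>)\<in>A. U)" by simp
    then show ?thesis by force
  qed
  then have "chart_at A x \<in> A \<and> x \<in> fst (chart_at A x)"
    unfolding chart_at_def by (rule someI_ex)
  then show "(fst (chart_at A x), snd (chart_at A x)) \<in> A" "x \<in> fst (chart_at A x)" by auto
qed

lemma smooth_map_chart_Cinf: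
  assumes A: "smooth_manifold A" and B: "smooth_manifold B" and f: "smooth_map A B W f" and W: "open W"
    and c: "(U,\<phi>) \<in> A" and d: "(V,\<psi>) \<in> B"
  shows "open (U \<inter> W \<inter> f -` V)" "open (\<phi> ` (U \<inter> W \<inter> f -` V))"
    "Cinf (\<phi> ` (U \<inter> W \<inter> f -` V)) (\<psi> \<circ> f \<circ> inv_into U \<phi>)"
proof -
  have "open (W \<inter> f -` V)"
    using f smooth_manifold_chart(1)[OF B d] W unfolding smooth_map_def
    by (auto intro: continuous_open_preimage)
  then show o: "open (U \<inter> W \<inter> f -` V)"
    using smooth_manifold_chart(1)[OF A c] by (simp add: Int_assoc open_Int)
  show o': "open (\<phi> ` (U \<inter> W \<inter> f -` V))"
    by (rule chart_open_image[OF A c o]) auto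
  show "Cinf (\<phi> ` (U \<inter> W \<inter> f -` V)) (\<psi> \<circ> f \<circ> inv_into U \<phi>)"
    using f c d unfolding smooth_map_def smooth_on_open_iff[OF o', symmetric] by fast
qed

lemma smooth_map_has_mderiv:
  assumes A: "smooth_manifold A" and B: "smooth_manifold B" and f: "smooth_map A B W f" and W: "open W"
    and x: "x \<in> W"
  shows "has_mderiv A B f (tmap A B f x) x"
proof -
  define U \<phi> V \<psi> where "U = fst (chart_at A x)" and "\<phi> = snd (chart_at A x)"
    and "V = fst (chart_at B (f x))" and "\<psi> = snd (chart_at B (f x))"
  have c: "(U,\<phi>) \<in> A" "x \<in> U" and d: "(V,\<psi>) \<in> B" "f x \<in> V"
    using chart_at_chart[OF A] chart_at_chart[OF B] by (auto simp: U_def \<phi>_def V_def \<psi>_def)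
  have "\<phi> x \<in> \<phi> ` (U \<inter> W \<inter> f -` V)" using c d x by auto
  from Cinf_has_derivative[OF smooth_map_chart_Cinf(3)[OF A B f W c(1) d(1)] this]
  have "has_mderiv A B f (frechet_derivative (\<psi> \<circ> f \<circ> inv_into U \<phi>) (at (\<phi> x))) x"
    using f W x unfolding has_mderiv_def U_def \<phi>_def V_def \<psi>_def smooth_map_def
    by (simp add: continuous_on_eq_continuous_at)
  then show ?thesis by (rule has_mderiv_tmap)
qed

lemma has_mderiv_cong:
  assumes A: "smooth_manifold A" and f: "has_mderiv A B f D x"
    and W: "open W" "x \<in> W" and eq: "\<And>y. y \<in> W \<Longrightarrow> f y = g y"
  shows "has_mderiv A B g D x"
proof -
  define U \<phi> where "U = fst (chart_at A x)" and "\<phi> = snd (chart_at A x)"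
  have c: "(U,\<phi>) \<in> A" "x \<in> U" using chart_at_chart[OF A] by (auto simp: U_def \<phi>_def)
  note ch = smooth_manifold_chart[OF A c(1)]
  have fx: "f x = g x" using W eq by auto
  have o: "open (\<phi> ` (U \<inter> W))" by (rule chart_open_image[OF A c(1)]) (use ch W in auto)
  have "isCont f x = isCont g x"
    using W eq by (intro isCont_cong) (auto simp: eventually_nhds)
  moreover have "((snd (chart_at B (g x)) \<circ> g \<circ> inv_into U \<phi>) has_derivative D) (at (\<phi> x))"
  proof (rule has_derivative_transform_within_open[OF _ o])
    show "((snd (chart_at B (g x)) \<circ> f \<circ> inv_into U \<phi>) has_derivative D) (at (\<phi> x))"
      using f by (simp add: has_mderiv_def U_def \<phi>_def fx)
  qed (use c W ch eq in auto)
  ultimately show ?thesis using f by (simp add: has_mderiv_def U_def \<phi>_def)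
qed

lemma isCont_eventually_mem:
  assumes "isCont f x" "open V" "f x \<in> V"
  shows "eventually (\<lambda>y. f y \<in> V) (nhds x)"
proof -
  have "(f \<longlongrightarrow> f x) (nhds x)" using assms(1) by (simp add: isCont_def tendsto_at_iff_tendsto_nhds)
  then show ?thesis using assms(2,3) by (rule topological_tendstoD)
qed

lemma has_mderiv_compose:
  assumes A: "smooth_manifold A" and B: "smooth_manifold B"
    and f: "has_mderiv A B f D x" and g: "has_mderiv B C g E (f x)"
  shows "has_mderiv A C (\<lambda>x. g (f x)) (\<lambda>v. E (D v)) x"
proof -
  define U \<phi> V \<psi> \<eta> where "U = fst (chart_at A x)" and "\<phi> = snd (chart_at A x)"
    and "V = fst (chart_at B (f x))" and "\<psi> = snd (chart_at B (f x))" and "\<eta> = snd (chart_at C (g (f x)))"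
  have c: "(U,\<phi>) \<in> A" "x \<in> U" and d: "(V,\<psi>) \<in> B" "f x \<in> V"
    using chart_at_chart[OF A] chart_at_chart[OF B] by (auto simp: U_def \<phi>_def V_def \<psi>_def)
  note cA = smooth_manifold_chart[OF A c(1)] and cB = smooth_manifold_chart[OF B d(1)]
  have cf: "isCont f x" and cg: "isCont g (f x)" using f g by (auto simp: has_mderiv_def)
  have df: "((\<psi> \<circ> f \<circ> inv_into U \<phi>) has_derivative D) (at (\<phi> x))"
    using f by (simp add: has_mderiv_def U_def \<phi>_def \<psi>_def)
  have dg: "((\<eta> \<circ> g \<circ> inv_into V \<psi>) has_derivative E) (at ((\<psi> \<circ> f \<circ> inv_into U \<phi>) (\<phi> x)))"
    using g c by (simp add: has_mderiv_def V_def \<psi>_def \<eta>_def cA)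
  have comp: "((\<lambda>y. (\<eta> \<circ> g \<circ> inv_into V \<psi>) ((\<psi> \<circ> f \<circ> inv_into U \<phi>) y)) has_derivative (\<lambda>v. E (D v))) (at (\<phi> x))"
    by (rule has_derivative_compose[OF df dg])
  have "isCont (f \<circ> inv_into U \<phi>) (\<phi> x)"
    using chart_isCont[OF A c] cf by (intro continuous_at_compose) (simp_all add: cA c)
  then have "eventually (\<lambda>y. (f \<circ> inv_into U \<phi>) y \<in> V) (nhds (\<phi> x))"
    by (rule isCont_eventually_mem[OF _ cB(1)]) (simp add: cA c d)
  then have "eventually (\<lambda>y. (\<eta> \<circ> g \<circ> inv_into V \<psi>) ((\<psi> \<circ> f \<circ> inv_into U \<phi>) y)
       = (\<eta> \<circ> (\<lambda>x. g (f x)) \<circ> inv_into U \<phi>) y) (nhds (\<phi> x))"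
    by eventually_elim (simp add: cB)
  then obtain O' where "open O'" "\<phi> x \<in> O'" "\<And>y. y \<in> O' \<Longrightarrow> (\<eta> \<circ> g \<circ> inv_into V \<psi>) ((\<psi> \<circ> f \<circ> inv_into U \<phi>) y)
       = (\<eta> \<circ> (\<lambda>x. g (f x)) \<circ> inv_into U \<phi>) y"
    unfolding eventually_nhds by blast
  from has_derivative_transform_within_open[OF comp this]
  have "((\<eta> \<circ> (\<lambda>x. g (f x)) \<circ> inv_into U \<phi>) has_derivative (\<lambda>v. E (D v))) (at (\<phi> x))" .
  moreover have "isCont (\<lambda>x. g (f x)) x"
    using continuous_at_compose[OF cf cg] by (simp add: o_def)
  ultimately show ?thesis by (simp add: has_mderiv_def U_def \<phi>_def \<eta>_def)
qed

lemma tmap_compose: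
  assumes "smooth_manifold A" "smooth_manifold B" "has_mderiv A B f D x" "has_mderiv B C g E (f x)"
  shows "tmap A C (\<lambda>x. g (f x)) x v = tmap B C g (f x) (tmap A B f x v)"
  using tmap_eq[OF has_mderiv_compose[OF assms]] tmap_eq[OF assms(3)] tmap_eq[OF assms(4)] by simp

lemma has_mderiv_ident:
  assumes A: "smooth_manifold A"
  shows "has_mderiv A A (\<lambda>x. x) (\<lambda>v. v) x"
proof -
  define U \<phi> where "U = fst (chart_at A x)" and "\<phi> = snd (chart_at A x)"
  have c: "(U,\<phi>) \<in> A" "x \<in> U" using chart_at_chart[OF A] by (auto simp: U_def \<phi>_def)
  note ch = smooth_manifold_chart[OF A c(1)]
  have "((\<phi> \<circ> (\<lambda>x. x) \<circ> inv_into U \<phi>) has_derivative (\<lambda>v. v)) (at (\<phi> x))"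
    by (rule has_derivative_transform_within_open[OF has_derivative_ident ch(2)])
      (use c ch in \<open>auto simp: f_inv_into_f\<close>)
  then show ?thesis by (simp add: has_mderiv_def U_def \<phi>_def)
qed

lemma has_mderiv_const:
  "has_mderiv A B (\<lambda>x. c) (\<lambda>v. 0) x"
  by (simp add: has_mderiv_def o_def)

lemma chart_at_std [simp]: "chart_at std_atlas x = (UNIV, id)"
  unfolding chart_at_def std_atlas_def by (rule some_equality) auto

lemma inv_into_id [simp]: "inv_into UNIV id = id"
  by (simp add: inv_id)

lemma smooth_manifold_std [simp]: "smooth_manifold (std_atlas :: ('a::euclidean_space,'a) chart set)"
proof -
  have "homeomorphism (UNIV :: 'a set) (id ` UNIV) id (inv_into UNIV id)"
    by (auto intro!: homeomorphismI)
  moreover have "smooth_on (UNIV :: 'a set) id"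
    using Cinf_ident[of "UNIV :: 'a set"] by (simp add: smooth_on_open_iff id_def)
  ultimately show ?thesis
    unfolding smooth_manifold_def std_atlas_def by simp
qed

lemma has_mderiv_std_std [simp]: "has_mderiv std_atlas std_atlas f D x \<longleftrightarrow> (f has_derivative D) (at x)"
  by (auto simp: has_mderiv_def has_derivative_continuous)

text \<open>For a vector-valued map, continuity can be read off from the chart expression.\<close>

lemma has_mderiv_std_chart:
  fixes A :: "('a::{t2_space,second_countable_topology}, 'e::euclidean_space) chart set"
    and f :: "'a \<Rightarrow> 'b::euclidean_space"
  assumes A: "smooth_manifold A"
    and f: "((f \<circ> inv_into (fst (chart_at A x)) (snd (chart_at A x))) has_derivative D) (at (snd (chart_at A x) x))"
  shows "has_mderiv A std_atlas f D x"
proof -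
  define U \<phi> where "U = fst (chart_at A x)" and "\<phi> = snd (chart_at A x)"
  have c: "(U,\<phi>) \<in> A" "x \<in> U" using chart_at_chart[OF A] by (auto simp: U_def \<phi>_def)
  note ch = smooth_manifold_chart[OF A c(1)]
  have "isCont (f \<circ> inv_into U \<phi>) (\<phi> x)"
    using f by (auto simp: U_def \<phi>_def has_derivative_continuous)
  then have "isCont ((f \<circ> inv_into U \<phi>) \<circ> \<phi>) x"
    by (rule continuous_at_compose[OF chart_isCont(1)[OF A c]])
  moreover have "isCont ((f \<circ> inv_into U \<phi>) \<circ> \<phi>) x = isCont f x"
    using c ch by (intro isCont_cong) (auto simp: eventually_nhds)
  ultimately show ?thesis using f by (simp add: has_mderiv_def)
qed

lemma has_mderiv_bilinear:
  assumes h: "bounded_bilinear h" and A: "smooth_manifold A"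
    and f: "has_mderiv A std_atlas f D x" and g: "has_mderiv A std_atlas g E x"
  shows "has_mderiv A std_atlas (\<lambda>x. h (f x) (g x)) (\<lambda>v. h (f x) (E v) + h (D v) (g x)) x"
proof (rule has_mderiv_std_chart[OF A])
  let ?i = "inv_into (fst (chart_at A x)) (snd (chart_at A x))" and ?x = "snd (chart_at A x) x"
  have i: "?i ?x = x" using smooth_manifold_chart(5)[OF A chart_at_chart(1)[OF A]] chart_at_chart(2)[OF A] .
  have "((f \<circ> ?i) has_derivative D) (at ?x)" "((g \<circ> ?i) has_derivative E) (at ?x)"
    using f g by (simp_all add: has_mderiv_def)
  from bounded_bilinear.FDERIV[OF h this]
  show "(((\<lambda>x. h (f x) (g x)) \<circ> ?i) has_derivative (\<lambda>v. h (f x) (E v) + h (D v) (g x))) (at ?x)"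
    by (simp add: o_def i)
qed

lemma has_mderiv_add:
  assumes A: "smooth_manifold A"
    and f: "has_mderiv A std_atlas f D x" and g: "has_mderiv A std_atlas g E x"
  shows "has_mderiv A std_atlas (\<lambda>x. f x + g x) (\<lambda>v. D v + E v) x"
proof (rule has_mderiv_std_chart[OF A])
  let ?i = "inv_into (fst (chart_at A x)) (snd (chart_at A x))" and ?x = "snd (chart_at A x) x"
  have "((f \<circ> ?i) has_derivative D) (at ?x)" "((g \<circ> ?i) has_derivative E) (at ?x)"
    using f g by (simp_all add: has_mderiv_def)
  from has_derivative_add[OF this]
  show "(((\<lambda>x. f x + g x) \<circ> ?i) has_derivative (\<lambda>v. D v + E v)) (at ?x)"
    by (simp add: o_def)
qed

lemma has_mderiv_Pair:
  assumes A: "smooth_manifold A"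
    and f: "has_mderiv A std_atlas f D x" and g: "has_mderiv A std_atlas g E x"
  shows "has_mderiv A std_atlas (\<lambda>x. (f x, g x)) (\<lambda>v. (D v, E v)) x"
proof (rule has_mderiv_std_chart[OF A])
  let ?i = "inv_into (fst (chart_at A x)) (snd (chart_at A x))" and ?x = "snd (chart_at A x) x"
  have "((f \<circ> ?i) has_derivative D) (at ?x)" "((g \<circ> ?i) has_derivative E) (at ?x)"
    using f g by (simp_all add: has_mderiv_def)
  from has_derivative_Pair[OF this]
  show "(((\<lambda>x. (f x, g x)) \<circ> ?i) has_derivative (\<lambda>v. (D v, E v))) (at ?x)"
    by (simp add: o_def)
qed

lemma has_mderiv_bounded_linear:
  assumes A: "smooth_manifold A" and h: "bounded_linear h" and f: "has_mderiv A std_atlas f D x"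
  shows "has_mderiv A std_atlas (\<lambda>x. h (f x)) (\<lambda>v. h (D v)) x"
  using has_mderiv_compose[OF A smooth_manifold_std f, of std_atlas h h] bounded_linear.has_derivative[OF h has_derivative_ident]
  by simp

lemma transition_Cinf:
  assumes A: "smooth_manifold A" and c: "(U,\<phi>) \<in> A" and d: "(V,\<psi>) \<in> A"
  shows "open (\<phi> ` (U \<inter> V))" "Cinf (\<phi> ` (U \<inter> V)) (\<psi> \<circ> inv_into U \<phi>)"
proof -
  show o: "open (\<phi> ` (U \<inter> V))"
    by (rule chart_open_image[OF A c]) (use smooth_manifold_chart(1)[OF A] c d in auto)
  show "Cinf (\<phi> ` (U \<inter> V)) (\<psi> \<circ> inv_into U \<phi>)"
    using A c d unfolding smooth_manifold_def smooth_on_open_iff[OF o, symmetric] by fast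
qed

lemma chart_has_mderiv:
  assumes A: "smooth_manifold A" and c: "(U,\<phi>) \<in> A" "x \<in> U"
  shows "has_mderiv A std_atlas \<phi> (tmap A std_atlas \<phi> x) x"
    "has_mderiv std_atlas A (inv_into U \<phi>) (tmap std_atlas A (inv_into U \<phi>) (\<phi> x)) (\<phi> x)"
proof -
  let ?V = "fst (chart_at A x)" and ?p = "snd (chart_at A x)"
  note d = chart_at_chart[OF A, of x]
  have "?p x \<in> ?p ` (?V \<inter> U)" using c d by auto
  from has_mderiv_std_chart[OF A Cinf_has_derivative[OF transition_Cinf(2)[OF A d(1) c(1)] this]]
  show "has_mderiv A std_atlas \<phi> (tmap A std_atlas \<phi> x) x" by (rule has_mderiv_tmap)
  have "\<phi> x \<in> \<phi> ` (U \<inter> ?V)" using c d by auto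
  from Cinf_has_derivative[OF transition_Cinf(2)[OF A c(1) d(1)] this]
  have "has_mderiv std_atlas A (inv_into U \<phi>)
     (frechet_derivative (?p \<circ> inv_into U \<phi>) (at (\<phi> x))) (\<phi> x)"
    using chart_isCont(2)[OF A c] smooth_manifold_chart(5)[OF A c] by (simp add: has_mderiv_def)
  then show "has_mderiv std_atlas A (inv_into U \<phi>) (tmap std_atlas A (inv_into U \<phi>) (\<phi> x)) (\<phi> x)"
    by (rule has_mderiv_tmap)
qed

text \<open>The derivative of a chart is the change of coordinates from the preferred chart; it is through
  these isomorphisms that fields are expressed in a fixed chart.\<close>

lemma chart_tmap_inverse:
  assumes A: "smooth_manifold A" and c: "(U,\<phi>) \<in> A" "x \<in> U"
  shows "tmap A std_atlas \<phi> x (tmap std_atlas A (inv_into U \<phi>) (\<phi> x) v) = v"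
    "tmap std_atlas A (inv_into U \<phi>) (\<phi> x) (tmap A std_atlas \<phi> x w) = w"
proof -
  note h = chart_has_mderiv[OF A c] and ch = smooth_manifold_chart[OF A c(1)]
  have i: "inv_into U \<phi> (\<phi> x) = x" using ch c by simp
  have "has_mderiv std_atlas std_atlas (\<lambda>z. \<phi> (inv_into U \<phi> z))
      (\<lambda>v. tmap A std_atlas \<phi> x (tmap std_atlas A (inv_into U \<phi>) (\<phi> x) v)) (\<phi> x)"
    by (rule has_mderiv_compose[OF smooth_manifold_std A h(2)]) (simp add: i h)
  moreover have "has_mderiv std_atlas std_atlas (\<lambda>z. \<phi> (inv_into U \<phi> z)) (\<lambda>v. v) (\<phi> x)"
    by (rule has_mderiv_cong[OF smooth_manifold_std has_mderiv_ident ch(2)])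
      (use c in \<open>auto simp: f_inv_into_f\<close>)
  ultimately show "tmap A std_atlas \<phi> x (tmap std_atlas A (inv_into U \<phi>) (\<phi> x) v) = v"
    by (rule has_mderiv_unique[THEN fun_cong])
  have "has_mderiv A A (\<lambda>x. inv_into U \<phi> (\<phi> x))
      (\<lambda>v. tmap std_atlas A (inv_into U \<phi>) (\<phi> x) (tmap A std_atlas \<phi> x v)) x"
    by (rule has_mderiv_compose[OF A smooth_manifold_std h])
  moreover have "has_mderiv A A (\<lambda>x. inv_into U \<phi> (\<phi> x)) (\<lambda>v. v) x"
    by (rule has_mderiv_cong[OF A has_mderiv_ident[OF A] ch(1)]) (use c ch in auto)
  ultimately show "tmap std_atlas A (inv_into U \<phi>) (\<phi> x) (tmap A std_atlas \<phi> x w) = w"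
    by (rule has_mderiv_unique[THEN fun_cong])
qed

text \<open>The chart in which a parametrized patch \<open>s\<close> is known to be smooth need not be the preferred
  one; the tangent map of the inverse of that chart corrects for this.\<close>

lemma patch_has_mderiv:
  assumes A: "smooth_manifold A" and c: "(U,\<phi>) \<in> A" and S: "open S" "z \<in> S"
    and s: "\<And>z. z \<in> S \<Longrightarrow> s z \<in> U" and d: "((\<lambda>z. \<phi> (s z)) has_derivative D) (at z)"
  shows "has_mderiv std_atlas A s (\<lambda>v. tmap std_atlas A (inv_into U \<phi>) (\<phi> (s z)) (D v)) z"
proof (rule has_mderiv_cong[OF smooth_manifold_std _ S])
  have "has_mderiv std_atlas std_atlas (\<lambda>z. \<phi> (s z)) D z" using d by simp
  from has_mderiv_compose[OF smooth_manifold_std smooth_manifold_std this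
      chart_has_mderiv(2)[OF A c s[OF S(2)]]]
  show "has_mderiv std_atlas A (\<lambda>z. inv_into U \<phi> (\<phi> (s z)))
     (\<lambda>v. tmap std_atlas A (inv_into U \<phi>) (\<phi> (s z)) (D v)) z" .
qed (use s smooth_manifold_chart(5)[OF A c] in auto)

text \<open>In a chart, the pull-back is the composition of the coefficients of the form with \<open>s\<close>,
  applied to the derivative of \<open>s\<close>.\<close>

lemma smooth_one_form_pullback:
  fixes \<omega> :: "'a::{t2_space,second_countable_topology} \<Rightarrow> 'e::euclidean_space \<Rightarrow> 'v::real_normed_vector"
    and s :: "'b::euclidean_space \<Rightarrow> 'a"
  assumes A: "smooth_manifold A" and c: "(U,\<phi>) \<in> A" and S: "open S"
    and s: "\<And>z. z \<in> S \<Longrightarrow> s z \<in> U" and d: "Cinf S (\<lambda>z. \<phi> (s z))"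
    and \<omega>: "smooth_one_form A \<omega>"
  shows "Cinf S (\<lambda>z. \<omega> (s z) (tmap std_atlas A s z e))"
proof (rule Cinf_cong[OF S])
  note ch = smooth_manifold_chart[OF A c]
  define w where "w y e = \<omega> (inv_into U \<phi> y) (tmap std_atlas A (inv_into U \<phi>) y e)" for y e
  have w: "Cinf (\<phi> ` U) (\<lambda>y. w y e)" for e
    using \<omega> c unfolding smooth_one_form_def w_def smooth_on_open_iff[OF ch(2), symmetric] by fast
  show "Cinf S (\<lambda>z. w (\<phi> (s z)) (frechet_derivative (\<lambda>z. \<phi> (s z)) (at z) e))"
  proof (rule Cinf_linear_family[OF S])
    show "linear (w (\<phi> (s z)))" if "z \<in> S" for z
      unfolding w_def using \<omega> has_mderiv_linear[OF chart_has_mderiv(2)[OF A c s[OF that]]]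
      by (auto simp: smooth_one_form_def intro: linear_compose[unfolded o_def])
    show "Cinf S (\<lambda>z. w (\<phi> (s z)) e)" for e
      by (rule Cinf_compose[OF S ch(2) d w]) (use s in auto)
    show "Cinf S (\<lambda>z. frechet_derivative (\<lambda>z. \<phi> (s z)) (at z) e)" by (rule Cinf_derivative[OF d])
  qed
  show "w (\<phi> (s z)) (frechet_derivative (\<lambda>z. \<phi> (s z)) (at z) e) = \<omega> (s z) (tmap std_atlas A s z e)"
    if z: "z \<in> S" for z
    using tmap_eq[OF patch_has_mderiv[OF A c S z s Cinf_has_derivative[OF d z]]] ch(5)[OF s[OF z]]
    by (simp add: w_def)
qed

lemma smooth_one_form_linear:
  assumes \<omega>: "smooth_one_form A \<omega>" and h: "bounded_linear h" and A: "smooth_manifold A"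
  shows "smooth_one_form A (\<lambda>x v. h (\<omega> x v))"
  unfolding smooth_one_form_def
proof (intro conjI allI ballI)
  show "linear (\<lambda>v. h (\<omega> x v))" for x
    using \<omega> linear_compose[of "\<omega> x" h] bounded_linear.linear[OF h]
    by (simp add: smooth_one_form_def o_def)
next
  fix c assume "c \<in> A"
  obtain U \<phi> where c: "c = (U,\<phi>)" by (cases c)
  then have mem: "(U,\<phi>) \<in> A" using \<open>c \<in> A\<close> by simp
  note ch = smooth_manifold_chart[OF A mem]
  have "Cinf (\<phi> ` U) (\<lambda>z. \<omega> (inv_into U \<phi> z) (tmap std_atlas A (inv_into U \<phi>) z e))" for e
    using \<omega> mem unfolding smooth_one_form_def smooth_on_open_iff[OF ch(2), symmetric] by fast
  from Cinf_linear[OF h ch(2) this]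
  show "case c of (U, \<phi>) \<Rightarrow> \<forall>e. smooth_on (\<phi> ` U)
      (\<lambda>z. h (\<omega> (inv_into U \<phi> z) (tmap std_atlas A (inv_into U \<phi>) z e)))"
    by (simp add: c smooth_on_open_iff[OF ch(2)])
qed

text \<open>A smooth map on \<open>W \<times> H\<close>, where \<open>H\<close> need not be open, agrees in charts and locally with a
  smooth map on an open set; the latter can be differentiated.\<close>

lemma smooth_map_prod_extension:
  fixes A :: "('a::{t2_space,second_countable_topology}, 'e::euclidean_space) chart set"
    and B :: "('b::{t2_space,second_countable_topology}, 'f::euclidean_space) chart set"
    and f :: "'a \<times> 'm::euclidean_space \<Rightarrow> 'b"
  assumes A: "smooth_manifold A" and f: "smooth_map (prod_atlas A std_atlas) B (W \<times> H) f"
    and c: "(U,\<phi>) \<in> A" and d: "(V,\<psi>) \<in> B" and x: "x \<in> U \<inter> W" "h \<in> H" "f (x,h) \<in> V"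
  obtains T F where "open T" "(\<phi> x, h) \<in> T" "Cinf T F"
    "\<And>y k. y \<in> U \<inter> W \<Longrightarrow> k \<in> H \<Longrightarrow> f (y,k) \<in> V \<Longrightarrow> (\<phi> y, k) \<in> T \<Longrightarrow> F (\<phi> y, k) = \<psi> (f (y,k))"
proof -
  note ch = smooth_manifold_chart[OF A c]
  have inj: "inj_on (map_prod \<phi> id) (U \<times> (UNIV :: 'm set))"
    using ch(5) by (auto simp: inj_on_def) metis
  have inv: "inv_into (U \<times> UNIV) (map_prod \<phi> id) (\<phi> y, k) = (y, k)" if "y \<in> U" for y and k :: 'm
    using inv_into_f_f[OF inj, of "(y,k)"] that by simp
  have "(U \<times> UNIV, map_prod \<phi> (id :: 'm \<Rightarrow> 'm)) \<in> prod_atlas A std_atlas"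
    using c unfolding prod_atlas_def std_atlas_def by blast
  then have s: "smooth_on (map_prod \<phi> id ` ((U \<times> UNIV) \<inter> (W \<times> H) \<inter> f -` V))
     (\<psi> \<circ> f \<circ> inv_into (U \<times> UNIV) (map_prod \<phi> id))"
    using f d unfolding smooth_map_def by fast
  have mem: "(\<phi> y, k) \<in> map_prod \<phi> id ` ((U \<times> UNIV) \<inter> (W \<times> H) \<inter> f -` V)"
    if "y \<in> U \<inter> W" "k \<in> H" "f (y,k) \<in> V" for y k
    using that by (intro image_eqI[of _ _ "(y,k)"]) auto
  obtain T F where T: "open T" "(\<phi> x, h) \<in> T" "\<forall>k. Ck_on k T F"
    "\<forall>y \<in> map_prod \<phi> id ` ((U \<times> UNIV) \<inter> (W \<times> H) \<inter> f -` V) \<inter> T.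
       F y = (\<psi> \<circ> f \<circ> inv_into (U \<times> UNIV) (map_prod \<phi> id)) y"
    using s mem[OF x] unfolding smooth_on_def by meson
  show thesis
  proof (rule that[of T F])
    show "Cinf T F" using T by (simp add: Cinf_def)
    show "F (\<phi> y, k) = \<psi> (f (y,k))"
      if "y \<in> U \<inter> W" "k \<in> H" "f (y,k) \<in> V" "(\<phi> y, k) \<in> T" for y k
      using bspec[OF T(4), of "(\<phi> y, k)"] mem[OF that(1-3)] that(1,4) inv by simp
  qed (use T in auto)
qed

lemma smooth_vector_field_local:
  assumes A: "smooth_manifold A"
    and "\<And>U \<phi> z. (U,\<phi>) \<in> A \<Longrightarrow> z \<in> \<phi> ` U \<Longrightarrow> \<exists>S. open S \<and> z \<in> S \<and>
       Cinf S (\<lambda>z. tmap A std_atlas \<phi> (inv_into U \<phi> z) (V (inv_into U \<phi> z)))"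
  shows "smooth_vector_field A V"
  unfolding smooth_vector_field_def
  using assms(2) by (auto intro!: smooth_on_local_Cinf smooth_manifold_chart(2)[OF A])

lemma smooth_vector_field_chart:
  assumes "smooth_manifold A" "smooth_vector_field A V" "(U,\<phi>) \<in> A"
  shows "Cinf (\<phi> ` U) (\<lambda>z. tmap A std_atlas \<phi> (inv_into U \<phi> z) (V (inv_into U \<phi> z)))"
  using assms(2,3) unfolding smooth_vector_field_def
    smooth_on_open_iff[OF smooth_manifold_chart(2)[OF assms(1,3)], symmetric] by fast

section \<open>The model\<close>

text \<open>The group \<open>H\<close> and its Lie algebra consist of block matrices; \<open>emb c Y\<close> has the lower right
  block \<open>Y\<close> and \<open>c\<close> times the identity in the upper left corner, so that \<open>c = 1\<close> gives elements of the
  group and \<open>c = 0\<close> of the algebra.\<close>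

definition emb :: "real \<Rightarrow> real^'k^'k \<Rightarrow> ('k::finite) emat" where
  "emb c Y = aff c 0 (aff c 0 Y)"

definition blk :: "('k::finite) emat \<Rightarrow> real^'k^'k" where
  "blk X = (\<chi> i j. X $ Some (Some i) $ Some (Some j))"

text \<open>The representation of \<open>H\<close> on \<open>\<mm>\<close> and its derivative. They are defined for all matrices,
  and \<open>dact\<close> is bilinear, so that they can be differentiated with respect to the matrix.\<close>

definition mact :: "('k::finite) emat \<Rightarrow> 'k mspace \<Rightarrow> 'k mspace" where
  "mact A = (\<lambda>(v0,v,w). (v0, blk A *v v, blk A *v w))"

definition dact :: "('k::finite) emat \<Rightarrow> 'k mspace \<Rightarrow> 'k mspace" where
  "dact X = (\<lambda>(v0,v,w). (0, blk X *v v, blk X *v w))"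

text \<open>On \<open>euc_algebra\<close> the projections are given by matrix entries; the formulas make sense for
  all matrices, which gives linear extensions.\<close>

definition mpart :: "('k::finite) emat \<Rightarrow> 'k mspace" where
  "mpart X = (X $ Some None $ None, \<chi> i. X $ Some (Some i) $ None, \<chi> i. X $ Some (Some i) $ Some None)"

definition hpart :: "('k::finite) emat \<Rightarrow> 'k emat" where
  "hpart X = emb 0 (blk X)"

lemma sum_option: "(\<Sum>i\<in>UNIV. F i) = F None + (\<Sum>i\<in>UNIV. F (Some i))"
  for F :: "'a::finite option \<Rightarrow> 'b::comm_monoid_add"
  by (simp add: UNIV_option_conv sum.reindex)

lemma aff_mult: "aff a 0 A ** aff b 0 B = aff (a * b) 0 (A ** B)"
  by (auto simp: vec_eq_iff matrix_matrix_mult_def aff_def sum_option split: option.split)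

lemma aff_transpose: "transpose (aff a 0 A) = aff a 0 (transpose A)"
  by (auto simp: vec_eq_iff transpose_def aff_def split: option.split)

lemma aff_mat1: "aff 1 0 (mat 1) = mat 1"
  by (auto simp: vec_eq_iff aff_def mat_def split: option.split)

lemma emb_outer_entry:
  assumes "\<nexists>a b. i = Some (Some a) \<and> j = Some (Some b)"
  shows "emb c Y $ i $ j = (if i = j then c else 0)"
proof (cases i)
  case None
  then show ?thesis by (cases j) (auto simp: emb_def aff_def)
next
  case (Some i')
  then show ?thesis using assms
    by (cases i'; cases j) (auto simp: emb_def aff_def split: option.split)
qed

lemma emb_mult: "emb a A ** emb b B = emb (a * b) (A ** B)"
  by (simp add: emb_def aff_mult)

lemma emb_transpose: "transpose (emb a A) = emb a (transpose A)"
  by (simp add: emb_def aff_transpose)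

lemma emb_mat1: "emb 1 (mat 1) = mat 1"
  by (simp add: emb_def aff_mat1)

lemma blk_emb [simp]: "blk (emb c Y) = Y"
  by (simp add: blk_def emb_def aff_def vec_eq_iff)

lemma blk_transpose: "blk (transpose X) = transpose (blk X)"
  by (simp add: blk_def transpose_def vec_eq_iff)

lemma blk_mat1 [simp]: "blk (mat 1) = mat 1"
  by (metis blk_emb emb_mat1)

lemma blk_uminus: "blk (- X) = - blk X"
  by (simp add: blk_def vec_eq_iff)

lemma emb0_uminus: "emb 0 (- Y) = - emb 0 Y"
  by (auto simp: vec_eq_iff emb_def aff_def split: option.split)

lemma orth_group_iff: "A \<in> orth_group \<longleftrightarrow> orthogonal_matrix (blk A) \<and> emb 1 (blk A) = A"
  unfolding orth_group_def emb_def[symmetric] by (auto intro!: exI[of _ "blk A"])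

lemma orth_algebra_iff: "X \<in> orth_algebra \<longleftrightarrow> transpose (blk X) = - blk X \<and> emb 0 (blk X) = X"
  unfolding orth_algebra_def emb_def[symmetric] by (auto intro!: exI[of _ "blk X"])

lemma orth_group_iff': "A \<in> orth_group \<longleftrightarrow> transpose A ** A = mat 1 \<and> emb 1 (blk A) = A"
proof (cases "emb 1 (blk A) = A")
  case True
  have "transpose A ** A = emb 1 (transpose (blk A) ** blk A)"
    using True by (metis emb_transpose emb_mult mult_1)
  then show ?thesis using True unfolding orth_group_iff orthogonal_matrix
    by (metis blk_emb emb_mat1)
qed (simp add: orth_group_iff)

lemma orth_algebra_iff': "X \<in> orth_algebra \<longleftrightarrow> transpose X = - X \<and> emb 0 (blk X) = X"
  unfolding orth_algebra_iff by (metis blk_transpose blk_uminus emb_transpose emb0_uminus)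

lemma orth_group_mat1: "mat 1 \<in> orth_group"
  by (simp add: orth_group_iff' emb_mat1 transpose_mat)

lemma orth_group_transpose: "A \<in> orth_group \<Longrightarrow> transpose A \<in> orth_group"
  unfolding orth_group_iff by (metis blk_transpose emb_transpose orthogonal_matrix_transpose)

lemma orth_group_inverse:
  assumes "A \<in> orth_group"
  shows "transpose A ** A = mat 1" "A ** transpose A = mat 1"
  using assms orth_group_transpose[OF assms] by (simp_all add: orth_group_iff')

lemma orth_group_mult: "A \<in> orth_group \<Longrightarrow> B \<in> orth_group \<Longrightarrow> A ** B \<in> orth_group"
  unfolding orth_group_iff by (metis blk_emb emb_mult mult_1 orthogonal_matrix_mul)

lemma orth_group_matrix_inv:
  assumes "A \<in> orth_group"
  shows "matrix_inv A = transpose A"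
proof -
  have "\<exists>A'. A ** A' = mat 1 \<and> A' ** A = mat 1" using orth_group_inverse[OF assms] by blast
  from someI_ex[OF this] have "A ** matrix_inv A = mat 1" by (simp add: matrix_inv_def)
  then have "transpose A ** (A ** matrix_inv A) = transpose A" by simp
  then show ?thesis using orth_group_inverse[OF assms] by (simp add: matrix_mul_assoc)
qed

lemma Ad_matrix_inv:
  assumes "A \<in> orth_group"
  shows "Ad (matrix_inv A) X = transpose A ** X ** A"
  using orth_group_matrix_inv[OF orth_group_transpose[OF assms]]
  by (simp add: Ad_def orth_group_matrix_inv[OF assms])

lemma emb_conj_entries:
  "(emb 1 (transpose k) ** X ** emb 1 k) $ Some None $ None = X $ Some None $ None"
  "(emb 1 (transpose k) ** X ** emb 1 k) $ Some (Some i) $ None = (\<Sum>l\<in>UNIV. k $ l $ i * X $ Some (Some l) $ None)"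
  "(emb 1 (transpose k) ** X ** emb 1 k) $ Some (Some i) $ Some None = (\<Sum>l\<in>UNIV. k $ l $ i * X $ Some (Some l) $ Some None)"
  by (simp_all add: matrix_matrix_mult_def emb_def aff_def sum_option transpose_def)

text \<open>Together with \<open>hpart_conj\<close>, this is the \<open>Ad(H)\<close>-invariance of the splitting \<open>\<gg> = \<hh> \<oplus> \<mm>\<close>.\<close>

lemma mpart_conj:
  assumes "A \<in> orth_group"
  shows "mpart (transpose A ** X ** A) = mact (transpose A) (mpart X)"
proof -
  have A: "A = emb 1 (blk A)" using assms by (simp add: orth_group_iff)
  have "mpart (emb 1 (transpose (blk A)) ** X ** emb 1 (blk A)) = mact (transpose A) (mpart X)"
    unfolding mpart_def mact_def emb_conj_entries blk_transpose
    by (simp add: vec_eq_iff matrix_vector_mult_def transpose_def del: transpose_matrix_vector)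
  then show ?thesis using A by (metis emb_transpose)
qed

lemma blk_conj:
  assumes "A \<in> orth_group"
  shows "blk (transpose A ** X ** A) = transpose (blk A) ** blk X ** blk A"
proof -
  have A: "A = emb 1 (blk A)" using assms by (simp add: orth_group_iff)
  have "blk (emb 1 (transpose k) ** X ** emb 1 k) = transpose k ** blk X ** k" for k
    by (simp add: vec_eq_iff blk_def matrix_matrix_mult_def emb_def aff_def sum_option transpose_def)
  then show ?thesis using A by (metis emb_transpose)
qed

lemma hpart_conj:
  assumes "A \<in> orth_group"
  shows "hpart (transpose A ** X ** A) = transpose A ** hpart X ** A"
proof -
  have A: "A = emb 1 (blk A)" using assms by (simp add: orth_group_iff)
  have "emb 1 (transpose k) ** emb 0 Y ** emb 1 k = emb 0 (transpose k ** Y ** k)" for k Y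
    by (simp add: emb_mult)
  then show ?thesis using A blk_conj[OF assms] unfolding hpart_def by (metis emb_transpose)
qed

lemma linear_mpart: "linear mpart"
  by (rule linearI) (auto simp: mpart_def vec_eq_iff)

lemma linear_hpart: "linear hpart"
  by (rule linearI) (auto simp: hpart_def blk_def emb_def aff_def vec_eq_iff split: option.split)

lemma bounded_linear_mpart: "bounded_linear mpart"
  using linear_mpart by (rule linear_conv_bounded_linear[THEN iffD1])

lemma bounded_linear_hpart: "bounded_linear hpart"
  using linear_hpart by (rule linear_conv_bounded_linear[THEN iffD1])

lemma linear_m_mat: "linear m_mat"
  by (rule linearI) (auto simp: m_mat_def vec_eq_iff algebra_simps split: option.split)

lemma mpart_m_mat [simp]: "mpart (m_mat t) = t"
  by (cases t) (simp add: mpart_def m_mat_def vec_eq_iff)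

lemma hpart_m_mat [simp]: "hpart (m_mat t) = 0"
  by (auto simp: hpart_def emb_def aff_def blk_def m_mat_def vec_eq_iff split: option.split prod.split)

lemma mpart_orth_algebra: "X \<in> orth_algebra \<Longrightarrow> mpart X = 0"
  unfolding orth_algebra_def mpart_def by (auto simp: aff_def vec_eq_iff zero_prod_def)

lemma hpart_orth_algebra: "X \<in> orth_algebra \<Longrightarrow> hpart X = X"
  by (simp add: hpart_def orth_algebra_iff)

lemma euc_algebra_entries:
  assumes "X \<in> euc_algebra"
  shows "X $ None $ i = 0" "X $ Some a $ Some b = - X $ Some b $ Some a"
proof -
  obtain v B where X: "X = aff 0 v B" "transpose B = - B" using assms by (auto simp: euc_algebra_def)
  have "B $ a $ b = - B $ b $ a" for a b
  proof -
    have "B $ a $ b = transpose B $ b $ a" by (simp add: transpose_def)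
    also have "\<dots> = - B $ b $ a" by (simp only: X(2) vector_uminus_component)
    finally show ?thesis .
  qed
  moreover have "X $ Some a $ Some b = B $ a $ b" for a b by (simp add: X(1) aff_def)
  ultimately show "X $ Some a $ Some b = - X $ Some b $ Some a" by metis
  show "X $ None $ i = 0" by (auto simp: X(1) aff_def split: option.split)
qed

lemma euc_algebra_decompose:
  assumes "X \<in> euc_algebra"
  shows "X = hpart X + m_mat (mpart X)" "hpart X \<in> orth_algebra"
proof -
  note e = euc_algebra_entries[OF assms]
  have "X $ Some None $ Some None = 0" using e(2)[of None None] by simp
  then show "X = hpart X + m_mat (mpart X)"
    using e(1) e(2)[of None "Some b" for b]
    by (auto simp: vec_eq_iff hpart_def emb_def aff_def blk_def m_mat_def mpart_def split: option.split)
  have "transpose (blk X) = - blk X"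
    by (simp add: vec_eq_iff blk_def transpose_def) (metis e(2))
  then show "hpart X \<in> orth_algebra" by (simp add: orth_algebra_iff hpart_def)
qed

lemma m_mat_euc_algebra: "m_mat t \<in> euc_algebra"
proof -
  obtain v0 v w where t: "t = (v0,v,w)" by (cases t) auto
  define V where "V = (\<chi> i. case i of None \<Rightarrow> v0 | Some a \<Rightarrow> v $ a)"
  define B where "B = (\<chi> i j. case (i,j) of (None, Some b) \<Rightarrow> - w $ b | (Some a, None) \<Rightarrow> w $ a | _ \<Rightarrow> 0)"
  have "m_mat t = aff 0 V B" "transpose B = - B"
    by (auto simp: t V_def B_def m_mat_def aff_def vec_eq_iff transpose_def split: option.split)
  then show ?thesis by (auto simp: euc_algebra_def)
qed

lemma pr_m_eq:
  assumes "X \<in> euc_algebra"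
  shows "pr_m X = mpart X"
  unfolding pr_m_def
proof (rule the_equality)
  show "X - m_mat (mpart X) \<in> orth_algebra"
    using euc_algebra_decompose[OF assms] by (metis add_diff_cancel_right')
  show "t = mpart X" if "X - m_mat t \<in> orth_algebra" for t
    using mpart_orth_algebra[OF that] by (simp add: linear_diff[OF linear_mpart])
qed

lemma pr_h_eq:
  assumes "X \<in> euc_algebra"
  shows "pr_h X = hpart X"
  unfolding pr_h_def
proof (rule the_equality)
  have "X - hpart X = m_mat (mpart X)"
    using euc_algebra_decompose(1)[OF assms] by (metis add_diff_cancel_left')
  then show "hpart X \<in> orth_algebra \<and> X - hpart X \<in> range m_mat"
    using euc_algebra_decompose(2)[OF assms] by simp
  show "Y = hpart X" if Y: "Y \<in> orth_algebra \<and> X - Y \<in> range m_mat" for Y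
  proof -
    obtain t where "X - Y = m_mat t" using Y by auto
    then have "hpart (X - Y) = 0" by simp
    then show ?thesis using Y by (simp add: linear_diff[OF linear_hpart] hpart_orth_algebra)
  qed
qed

lemma bounded_bilinear_dact: "bounded_bilinear dact"
proof (rule bilinear_conv_bounded_bilinear[THEN iffD1], unfold bilinear_def, intro conjI allI)
  show "linear (dact X)" for X
    by (rule linearI) (auto simp: dact_def matrix_vector_right_distrib matrix_vector_mult_scaleR)
  show "linear (\<lambda>X. dact X t)" for t
    by (rule linearI) (auto simp: dact_def blk_def vec_eq_iff matrix_vector_mult_def
        sum.distrib algebra_simps sum_distrib_left split: prod.split)
qed

lemma bounded_bilinear_matrix_mult:
  "bounded_bilinear ((**) :: real^'n^'m \<Rightarrow> real^'p^'n \<Rightarrow> real^'p^'m)"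
proof (rule bilinear_conv_bounded_bilinear[THEN iffD1], unfold bilinear_def, intro conjI allI)
  show "linear ((**) A)" for A :: "real^'n^'m"
    by (rule linearI) (auto simp: vec_eq_iff matrix_matrix_mult_def sum.distrib algebra_simps sum_distrib_left)
  show "linear (\<lambda>A. A ** B)" for B :: "real^'p^'n"
    by (rule linearI) (auto simp: vec_eq_iff matrix_matrix_mult_def sum.distrib algebra_simps sum_distrib_left)
qed

lemma bounded_linear_transpose: "bounded_linear (transpose :: real^'n^'m \<Rightarrow> real^'m^'n)"
  by (rule linear_conv_bounded_linear[THEN iffD1], rule linearI) (auto simp: vec_eq_iff transpose_def)

lemma mact_eq_dact: "mact A t = (fst t, 0) + dact A t"
  by (simp add: mact_def dact_def split: prod.split)

lemma bounded_linear_fst0: "bounded_linear (\<lambda>t :: real \<times> ('a::real_normed_vector). (fst t, 0 :: 'a))"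
  by (intro bounded_linear_Pair bounded_linear_fst bounded_linear_zero)

lemma linear_mact: "linear (mact A)"
  by (rule linearI) (auto simp: mact_def matrix_vector_right_distrib matrix_vector_mult_scaleR split: prod.split)

lemma mact_mat1 [simp]: "mact (mat 1) t = t"
  by (simp add: mact_def split: prod.split)

lemma mact_inverse:
  assumes "A \<in> orth_group"
  shows "mact A (mact (transpose A) t) = t" "mact (transpose A) (mact A t) = t"
proof -
  have "blk A ** transpose (blk A) = mat 1" "transpose (blk A) ** blk A = mat 1"
    using assms by (simp_all add: orth_group_iff orthogonal_matrix_def)
  then show "mact A (mact (transpose A) t) = t" "mact (transpose A) (mact A t) = t"
    by (simp_all add: mact_def blk_transpose matrix_vector_mul_assoc del: transpose_matrix_vector split: prod.split)
qed

lemma mact_inner: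
  assumes "A \<in> orth_group"
  shows "mact A s \<bullet> mact A t = s \<bullet> t"
proof -
  have "orthogonal_transformation (\<lambda>v. blk A *v v)"
    using assms by (simp add: orth_group_iff orthogonal_transformation_matrix)
  then show ?thesis
    by (simp add: mact_def orthogonal_transformation_def inner_prod_def split: prod.split)
qed

lemma mact_e0: "mact A e0 = e0"
  by (simp add: mact_def e0_def)

lemma mact_psi: "mact A (psi t) = psi (mact A t)"
  by (cases t) (simp add: mact_def psi_def linear_neg[OF matrix_vector_mul_linear])

lemma bounded_linear_psi: "bounded_linear psi"
  by (rule linear_conv_bounded_linear[THEN iffD1], rule linearI) (auto simp: psi_def)

lemma span_axis_UNIV: "span (range (\<lambda>i. axis i (1::real))) = (UNIV :: (real^'k) set)"
proof -
  have "Basis = range (\<lambda>i::'k. axis i (1::real))" by (auto simp: Basis_vec_def)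
  then show ?thesis using span_Basis by metis
qed

lemma E_space_eq: "E_space = {t. \<exists>v. t = (0, v, 0)}"
proof -
  have lin: "linear (\<lambda>v :: real^'k. (0::real, v, 0::real^'k))" by (rule linearI) auto
  show ?thesis
    using linear_span_image[OF lin, of "range (\<lambda>i. axis i 1)"]
    by (auto simp: E_space_def image_image span_axis_UNIV)
qed

lemma B_space_eq: "B_space = {t. \<exists>w. t = (0, 0, w)}"
proof -
  have lin: "linear (\<lambda>w :: real^'k. (0::real, 0::real^'k, w))" by (rule linearI) auto
  show ?thesis
    using linear_span_image[OF lin, of "range (\<lambda>i. axis i 1)"]
    by (auto simp: B_space_def image_image span_axis_UNIV)
qed

lemma mact_E_space: "mact A t \<in> E_space" if "t \<in> E_space"
  using that by (auto simp: E_space_eq mact_def)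

lemma mact_B_space: "mact A t \<in> B_space" if "t \<in> B_space"
  using that by (auto simp: B_space_eq mact_def)

text \<open>The Lie algebra of \<open>H\<close> contains the left-translated derivatives of all maps into \<open>H\<close>:
  differentiate the equations \<open>A\<^sup>t A = 1\<close> and \<open>emb 1 (blk A) = A\<close> that define \<open>H\<close>.\<close>

lemma orth_group_tangent:
  fixes f :: "'a::real_normed_vector \<Rightarrow> ('k::finite) emat"
  assumes S: "open S" "y \<in> S" and f: "\<And>z. z \<in> S \<Longrightarrow> f z \<in> orth_group" and d: "(f has_derivative D) (at y)"
  shows "transpose (f y) ** D v \<in> orth_algebra"
proof -
  have "((\<lambda>z. transpose (f z) ** f z) has_derivative
       (\<lambda>v. transpose (f y) ** D v + transpose (D v) ** f y)) (at y)"
    by (rule bounded_bilinear.FDERIV[OF bounded_bilinear_matrix_mult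
        bounded_linear.has_derivative[OF bounded_linear_transpose d] d])
  moreover have "((\<lambda>z. transpose (f z) ** f z) has_derivative (\<lambda>v. 0)) (at y)"
    by (rule has_derivative_transform_within_open[OF has_derivative_const S])
      (simp add: f orth_group_inverse)
  ultimately have "transpose (f y) ** D v + transpose (D v) ** f y = 0"
    by (rule has_derivative_unique[THEN fun_cong])
  then have skew: "transpose (transpose (f y) ** D v) = - (transpose (f y) ** D v)"
    by (simp add: matrix_transpose_mul add_eq_0_iff)
  have "((\<lambda>z. emb 1 0 + hpart (f z)) has_derivative (\<lambda>v. hpart (D v))) (at y)"
    using has_derivative_add[OF has_derivative_const bounded_linear.has_derivative[OF bounded_linear_hpart d]]
    by simp
  then have "(f has_derivative (\<lambda>v. hpart (D v))) (at y)"
  proof (rule has_derivative_transform_within_open[OF _ S])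
    fix z assume "z \<in> S"
    have "emb 1 0 + emb 0 Y = (emb 1 Y :: 'k emat)" for Y
      by (auto simp: vec_eq_iff emb_def aff_def split: option.split)
    then show "emb 1 0 + hpart (f z) = f z"
      using f[OF \<open>z \<in> S\<close>] by (simp add: hpart_def orth_group_iff)
  qed
  then have D: "D v = emb 0 (blk (D v))"
    using has_derivative_unique[OF d] by (metis hpart_def)
  have "transpose (f y) = emb 1 (transpose (blk (f y)))"
    using f[OF S(2)] by (metis emb_transpose orth_group_iff)
  then have "transpose (f y) ** D v = emb 0 (transpose (blk (f y)) ** blk (D v))"
    using D by (metis emb_mult mult_1)
  then show ?thesis using skew by (simp add: orth_algebra_iff')
qed

subsection \<open>The matrix exponential\<close>

lemma mat_pow_scaleR: "mat_pow (t *\<^sub>R X) k = t ^ k *\<^sub>R mat_pow X k"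
  by (induction k) (simp_all add: vec_eq_iff matrix_matrix_mult_def sum_distrib_left algebra_simps)

lemma mat_pow_bound:
  fixes X :: "real^'i^'i"
  shows "\<bar>mat_pow X k $ i $ j\<bar> \<le> (\<Sum>i\<in>UNIV. \<Sum>j\<in>UNIV. \<bar>X $ i $ j\<bar>) ^ k"
proof (induction k arbitrary: i)
  case 0
  show ?case by (simp add: mat_def)
next
  case (Suc k)
  define M where "M = (\<Sum>i\<in>UNIV. \<Sum>j\<in>UNIV. \<bar>X $ i $ j\<bar>)"
  have "M \<ge> 0" unfolding M_def by (intro sum_nonneg) auto
  have row: "(\<Sum>l\<in>UNIV. \<bar>X $ i $ l\<bar>) \<le> M" unfolding M_def
    by (rule member_le_sum) (auto intro: sum_nonneg)
  have "\<bar>mat_pow X (Suc k) $ i $ j\<bar> \<le> (\<Sum>l\<in>UNIV. \<bar>X $ i $ l * mat_pow X k $ l $ j\<bar>)"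
    by (simp add: matrix_matrix_mult_def)
  also have "\<dots> \<le> (\<Sum>l\<in>UNIV. \<bar>X $ i $ l\<bar> * M ^ k)"
    unfolding abs_mult M_def by (intro sum_mono mult_left_mono Suc.IH) auto
  also have "\<dots> = (\<Sum>l\<in>UNIV. \<bar>X $ i $ l\<bar>) * M ^ k" by (simp add: sum_distrib_right)
  also have "\<dots> \<le> M * M ^ k" using \<open>M \<ge> 0\<close> by (intro mult_right_mono row) auto
  finally show ?case by (simp add: M_def)
qed

lemma mat_pow_summable:
  fixes X :: "real^'i^'i"
  shows "summable (\<lambda>k. mat_pow X k $ i $ j / fact k * t ^ k)"
proof (rule summable_comparison_test)
  define M where "M = (\<Sum>i\<in>UNIV. \<Sum>j\<in>UNIV. \<bar>X $ i $ j\<bar>)"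
  show "\<exists>N. \<forall>k\<ge>N. norm (mat_pow X k $ i $ j / fact k * t ^ k) \<le> inverse (fact k) * (M * \<bar>t\<bar>) ^ k"
    using mult_left_mono[OF mat_pow_bound[of X _ i j, folded M_def], of "\<bar>t\<bar> ^ k / fact k" for k]
    by (auto simp: abs_mult power_mult_distrib power_abs field_simps intro!: exI[of _ 0])
  show "summable (\<lambda>k. inverse (fact k) * (M * \<bar>t\<bar>) ^ k)" by (rule summable_exp)
qed

lemma mat_exp_entry:
  fixes X :: "real^'i^'i"
  shows "mat_exp (t *\<^sub>R X) $ i $ j = (\<Sum>k. mat_pow X k $ i $ j / fact k * t ^ k)"
proof -
  have "(\<lambda>k. (1 / fact k) *\<^sub>R mat_pow (t *\<^sub>R X) k) sums (\<chi> i j. \<Sum>k. mat_pow X k $ i $ j / fact k * t ^ k)"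
    unfolding sums_def
  proof (intro vec_tendstoI)
    fix i j
    have "(\<lambda>k. mat_pow X k $ i $ j / fact k * t ^ k) sums (\<Sum>k. mat_pow X k $ i $ j / fact k * t ^ k)"
      by (rule summable_sums[OF mat_pow_summable])
    then show "(\<lambda>n. (\<Sum>k<n. (1 / fact k) *\<^sub>R mat_pow (t *\<^sub>R X) k) $ i $ j)
       \<longlonglongrightarrow> (\<chi> i j. \<Sum>k. mat_pow X k $ i $ j / fact k * t ^ k) $ i $ j"
      by (simp add: sums_def mat_pow_scaleR mult_ac)
  qed
  then have "mat_exp (t *\<^sub>R X) = (\<chi> i j. \<Sum>k. mat_pow X k $ i $ j / fact k * t ^ k)"
    unfolding mat_exp_def by (rule sums_unique[symmetric])
  then show ?thesis by simp
qed

lemma mat_exp_zero [simp]: "mat_exp (0 *\<^sub>R X) = mat 1"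
  by (simp only: vec_eq_iff mat_exp_entry powser_zero) simp

text \<open>Every entry of \<open>mat_exp (t *\<^sub>R X)\<close> is an everywhere convergent power series in \<open>t\<close>, and can be
  differentiated term by term.\<close>

lemma mat_exp_has_derivative:
  fixes X :: "real^'i^'i"
  shows "((\<lambda>t. mat_exp (t *\<^sub>R X)) has_derivative (\<lambda>s. s *\<^sub>R (X ** mat_exp (t *\<^sub>R X)))) (at t)"
proof -
  have "((\<lambda>t. mat_exp (t *\<^sub>R X) $ i $ j) has_derivative (\<lambda>s. s * (X ** mat_exp (t *\<^sub>R X)) $ i $ j)) (at t)" for i j
  proof -
    define c where "c k = mat_pow X k $ i $ j / fact k" for k
    have "((\<lambda>t. mat_exp (t *\<^sub>R X) $ i $ j) has_field_derivative (\<Sum>k. diffs c k * t ^ k)) (at t)"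
      unfolding mat_exp_entry c_def[symmetric]
      by (rule termdiffs_strong_converges_everywhere) (unfold c_def, rule mat_pow_summable)
    moreover have "(\<lambda>k. \<Sum>l\<in>UNIV. X $ i $ l * (mat_pow X k $ l $ j / fact k * t ^ k)) sums
        (\<Sum>l\<in>UNIV. X $ i $ l * mat_exp (t *\<^sub>R X) $ l $ j)"
      unfolding mat_exp_entry by (intro sums_sum sums_mult summable_sums mat_pow_summable)
    moreover have "(\<Sum>l\<in>UNIV. X $ i $ l * (mat_pow X k $ l $ j / fact k * t ^ k)) = diffs c k * t ^ k" for k
      by (simp add: diffs_def c_def matrix_matrix_mult_def sum_divide_distrib sum_distrib_left sum_distrib_right field_simps del: of_nat_Suc)
    ultimately have "((\<lambda>t. mat_exp (t *\<^sub>R X) $ i $ j) has_field_derivative (X ** mat_exp (t *\<^sub>R X)) $ i $ j) (at t)"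
      by (simp add: sums_unique[symmetric] matrix_matrix_mult_def)
    then show ?thesis by (simp add: has_field_derivative_def mult_commute_abs)
  qed
  then show ?thesis
    by (subst has_derivative_componentwise_within) (auto simp: Basis_vec_def inner_axis)
qed

text \<open>The derivative of \<open>E(t)\<^sup>t E(t)\<close> is \<open>E(t)\<^sup>t (X\<^sup>t + X) E(t) = 0\<close>, and outside the lower right
  block every power of \<open>X\<close> but the zeroth vanishes.\<close>

lemma mat_exp_orth_group:
  fixes X :: "('k::finite) emat"
  assumes X: "X \<in> orth_algebra"
  shows "mat_exp (t *\<^sub>R X) \<in> orth_group"
proof -
  define E where "E t = mat_exp (t *\<^sub>R X)" for t
  have XE: "X = emb 0 (blk X)" and skew: "transpose X = - X" using X by (auto simp: orth_algebra_iff')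
  have "((\<lambda>t. transpose (E t) ** E t) has_derivative (\<lambda>s. 0)) (at t)" for t
  proof -
    have "((\<lambda>t. transpose (E t) ** E t) has_derivative (\<lambda>s. transpose (E t) ** (s *\<^sub>R (X ** E t))
        + transpose (s *\<^sub>R (X ** E t)) ** E t)) (at t)"
      unfolding E_def
      by (rule bounded_bilinear.FDERIV[OF bounded_bilinear_matrix_mult
        bounded_linear.has_derivative[OF bounded_linear_transpose mat_exp_has_derivative] mat_exp_has_derivative])
    moreover have "transpose (E t) ** (s *\<^sub>R (X ** E t)) + transpose (s *\<^sub>R (X ** E t)) ** E t = 0" for s
    proof -
      interpret m: bounded_bilinear "(**) :: 'k emat \<Rightarrow> 'k emat \<Rightarrow> 'k emat" by (rule bounded_bilinear_matrix_mult)
      have "transpose (s *\<^sub>R (X ** E t)) = s *\<^sub>R (transpose (E t) ** (- X))"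
        by (simp add: linear_cmul[OF bounded_linear.linear[OF bounded_linear_transpose]] matrix_transpose_mul skew)
      then show ?thesis
        by (simp add: m.scaleR_left m.scaleR_right m.minus_left m.minus_right matrix_mul_assoc)
    qed
    ultimately show ?thesis by simp
  qed
  then have "\<exists>c. \<forall>t\<in>UNIV. transpose (E t) ** E t = c"
    by (intro has_derivative_zero_constant) (auto simp: has_derivative_at_withinI)
  then have orth: "transpose (E t) ** E t = mat 1"
    by (metis E_def UNIV_I mat_exp_zero transpose_mat matrix_mul_lid)
  have pow: "mat_pow X k = emb (if k = 0 then 1 else 0) (mat_pow (blk X) k)" for k
  proof (induction k)
    case (Suc k)
    then show ?case using XE emb_mult[of 0 "blk X"] by simp
  qed (simp add: emb_mat1)
  have const: "(\<Sum>k. emb (if k = 0 then 1 else 0) (mat_pow (blk X) k) $ i $ j / fact k * t ^ k) = emb 1 Y $ i $ j"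
    if "\<And>k c. emb c (mat_pow (blk X) k) $ i $ j = c * emb 1 Y $ i $ j" for i j Y
  proof -
    have "(\<lambda>k. (if k = 0 then emb 1 Y $ i $ j else 0)) sums (emb 1 Y $ i $ j)"
      using sums_single[of 0 "\<lambda>_. emb 1 Y $ i $ j"] by simp
    moreover have "(\<lambda>k. (if k = 0 then emb 1 Y $ i $ j else 0)) =
      (\<lambda>k. emb (if k = 0 then 1 else 0) (mat_pow (blk X) k) $ i $ j / fact k * t ^ k)"
      unfolding that by auto
    ultimately show ?thesis by (metis sums_unique)
  qed
  have "emb 1 (blk (E t)) $ i $ j = E t $ i $ j" for i j
  proof (cases "\<exists>a b. i = Some (Some a) \<and> j = Some (Some b)")
    case True
    then show ?thesis by (auto simp: emb_def aff_def blk_def)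
  next
    case False
    have "E t $ i $ j = emb 1 (blk (E t)) $ i $ j"
      unfolding E_def mat_exp_entry pow
      by (rule const) (use False in \<open>simp add: emb_outer_entry\<close>)
    then show ?thesis by simp
  qed
  then have "emb 1 (blk (E t)) = E t" by (simp add: vec_eq_iff)
  then show ?thesis using orth by (simp add: orth_group_iff' E_def)
qed

section \<open>Cartan geometries\<close>

locale euc_cartan_geometry =
  fixes P :: "('p::{t2_space,second_countable_topology}, 'q::euclidean_space) chart set"
    and N :: "('x::{t2_space,second_countable_topology}, 'e::euclidean_space) chart set"
    and p :: "'p \<Rightarrow> 'x"
    and r :: "'p \<Rightarrow> ('k::finite) emat \<Rightarrow> 'p"
    and \<omega> :: "'p \<Rightarrow> 'q \<Rightarrow> 'k emat"
  assumes geo: "cartan_geometry orth_group euc_algebra orth_algebra P N p r \<omega>"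
begin

abbreviation "Tp u \<equiv> tmap P N p u"

definition triv :: "'x set \<Rightarrow> ('p \<Rightarrow> 'k emat) \<Rightarrow> bool" where
  "triv W \<theta> \<longleftrightarrow> open W \<and> smooth_map P std_atlas (p -` W) \<theta> \<and>
     bij_betw (\<lambda>u. (p u, \<theta> u)) (p -` W) (W \<times> orth_group) \<and>
     smooth_map (prod_atlas N std_atlas) P (W \<times> orth_group) (inv_into (p -` W) (\<lambda>u. (p u, \<theta> u))) \<and>
     (\<forall>u\<in>p -` W. \<forall>h\<in>orth_group. \<theta> (r u h) = \<theta> u ** h)"

text \<open>The section of the trivialization on which \<open>\<theta>\<close> has the constant value \<open>h\<close>.\<close>

definition triv_section :: "'x set \<Rightarrow> ('p \<Rightarrow> 'k emat) \<Rightarrow> 'k emat \<Rightarrow> 'x \<Rightarrow> 'p" where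
  "triv_section W \<theta> h x = inv_into (p -` W) (\<lambda>u. (p u, \<theta> u)) (x, h)"

lemma principal: "principal_bundle orth_group P N p r"
  and connection: "cartan_connection orth_group euc_algebra orth_algebra P r \<omega>"
  using geo by (auto simp: cartan_geometry_def)

lemma mfP: "smooth_manifold P" and mfN: "smooth_manifold N" and smooth_p: "smooth_map P N UNIV p"
  and smooth_r: "smooth_map (prod_atlas P std_atlas) P (UNIV \<times> orth_group) (\<lambda>(u,h). r u h)"
  and r_one: "r u (mat 1) = u"
  and p_r: "h \<in> orth_group \<Longrightarrow> p (r u h) = p u"
  using principal unfolding principal_bundle_def by auto

lemma triv_exists: "\<exists>W \<theta>. x \<in> W \<and> triv W \<theta>"
proof -
  have "\<forall>x. \<exists>W \<theta>. open W \<and> x \<in> W \<and> smooth_map P std_atlas (p -` W) \<theta> \<and>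
        bij_betw (\<lambda>u. (p u, \<theta> u)) (p -` W) (W \<times> orth_group) \<and>
        smooth_map (prod_atlas N std_atlas) P (W \<times> orth_group) (inv_into (p -` W) (\<lambda>u. (p u, \<theta> u))) \<and>
        (\<forall>u\<in>p -` W. \<forall>h\<in>orth_group. \<theta> (r u h) = \<theta> u ** h)"
    using principal unfolding principal_bundle_def by (elim conjE) assumption
  then show ?thesis unfolding triv_def by meson
qed

lemma smooth_\<omega>: "smooth_one_form P \<omega>"
  and \<omega>_bij: "bij_betw (\<omega> u) UNIV euc_algebra"
  and \<omega>_r: "a \<in> orth_group \<Longrightarrow> \<omega> (r u a) (tmap P P (\<lambda>u. r u a) u \<xi>) = Ad (matrix_inv a) (\<omega> u \<xi>)"
  and \<omega>_fundamental: "X \<in> orth_algebra \<Longrightarrow> \<omega> u (fundamental_field P r X u) = X"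
  using connection unfolding cartan_connection_def by auto

lemma \<omega>_linear: "linear (\<omega> u)"
  using smooth_\<omega> by (simp add: smooth_one_form_def)

lemma \<omega>_mem: "\<omega> u \<xi> \<in> euc_algebra"
  using \<omega>_bij[of u] by (auto simp: bij_betw_def)

lemma \<omega>_inj: "\<omega> u \<xi> = \<omega> u \<eta> \<Longrightarrow> \<xi> = \<eta>"
  using \<omega>_bij[of u] by (auto simp: bij_betw_def inj_on_def)

lemma \<omega>_surj: "X \<in> euc_algebra \<Longrightarrow> \<exists>\<xi>. \<omega> u \<xi> = X"
  using \<omega>_bij[of u] by (metis bij_betw_imp_surj_on imageE)

lemma p_mderiv: "has_mderiv P N p (Tp u) u"
  by (rule smooth_map_has_mderiv[OF mfP mfN smooth_p]) auto

lemma linear_Tp: "linear (Tp u)"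
  by (rule has_mderiv_linear[OF p_mderiv])

lemma p_continuous: "continuous_on UNIV p"
  using smooth_p by (simp add: smooth_map_def)

lemma open_p_vimage: "open W \<Longrightarrow> open (p -` W)"
  using p_continuous by (simp add: open_vimage)

lemma r_continuous: "continuous_on (UNIV \<times> orth_group) (\<lambda>(u,h). r u h)"
  using smooth_r by (simp add: smooth_map_def)

text \<open>Right translations are only given as part of a smooth action of the non-open set \<open>H\<close>. Fixing
  \<open>a\<close> in a local extension of the action exhibits them as restrictions of smooth maps.\<close>

lemma r_mderiv:
  assumes a: "a \<in> orth_group"
  shows "has_mderiv P P (\<lambda>u. r u a) (tmap P P (\<lambda>u. r u a) u) u"
proof -
  define U \<phi> V \<psi> where "U = fst (chart_at P u)" and "\<phi> = snd (chart_at P u)"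
    and "V = fst (chart_at P (r u a))" and "\<psi> = snd (chart_at P (r u a))"
  have c: "(U,\<phi>) \<in> P" "u \<in> U" and d: "(V,\<psi>) \<in> P" "r u a \<in> V"
    using chart_at_chart[OF mfP] by (auto simp: U_def \<phi>_def V_def \<psi>_def)
  note ch = smooth_manifold_chart[OF mfP c(1)]
  obtain T F where T: "open T" "(\<phi> u, a) \<in> T" "Cinf T F"
    and F: "\<And>y k. y \<in> U \<inter> UNIV \<Longrightarrow> k \<in> orth_group \<Longrightarrow> (\<lambda>(u,h). r u h) (y,k) \<in> V \<Longrightarrow>
      (\<phi> y, k) \<in> T \<Longrightarrow> F (\<phi> y, k) = \<psi> ((\<lambda>(u,h). r u h) (y,k))"
    by (rule smooth_map_prod_extension[OF mfP smooth_r c(1) d(1), of u a]) (use c d a in auto)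
  have cont: "continuous_on UNIV (\<lambda>u. r u a)"
  proof -
    have "continuous_on UNIV (\<lambda>u. (\<lambda>(u,h). r u h) (u,a))"
      by (rule continuous_on_compose2[OF r_continuous]) (use a in \<open>auto intro!: continuous_intros\<close>)
    then show ?thesis by simp
  qed
  have "open ((\<lambda>u. r u a) -` V)"
    by (rule open_vimage[OF smooth_manifold_chart(1)[OF mfP d(1)] cont])
  then have o: "open (\<phi> ` (U \<inter> (\<lambda>u. r u a) -` V))"
    by (intro chart_open_image[OF mfP c(1)]) (use ch in auto)
  have oT: "open ((\<lambda>y. (y,a)) -` T)"
    by (rule open_vimage[OF T(1)]) (auto intro!: continuous_intros)
  have "((\<lambda>y. (y,a)) has_derivative (\<lambda>v. (v,0))) (at (\<phi> u))"
    by (auto intro!: derivative_eq_intros)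
  from has_derivative_compose[OF this Cinf_has_derivative[OF T(3,2)]]
  have "((\<psi> \<circ> (\<lambda>u. r u a) \<circ> inv_into U \<phi>) has_derivative
       (\<lambda>v. frechet_derivative F (at (\<phi> u, a)) (v, 0))) (at (\<phi> u))"
    by (rule has_derivative_transform_within_open[OF _ open_Int[OF o oT]])
      (use c d T F a ch in auto)
  then show ?thesis
    using cont by (intro has_mderiv_tmap)
      (simp add: has_mderiv_def U_def \<phi>_def \<psi>_def continuous_on_eq_continuous_at)
qed

lemma fundamental_mderiv:
  assumes X: "X \<in> orth_algebra"
  shows "has_mderiv std_atlas P (\<lambda>t. r u (mat_exp (t *\<^sub>R X)))
      (tmap std_atlas P (\<lambda>t. r u (mat_exp (t *\<^sub>R X))) 0) 0"
proof -
  define E where "E t = mat_exp (t *\<^sub>R X)" for t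
  define V \<psi> where "V = fst (chart_at P u)" and "\<psi> = snd (chart_at P u)"
  have d: "(V,\<psi>) \<in> P" "u \<in> V" using chart_at_chart[OF mfP] by (auto simp: V_def \<psi>_def)
  have E: "E t \<in> orth_group" for t unfolding E_def by (rule mat_exp_orth_group[OF X])
  have E0: "E 0 = mat 1" by (simp only: E_def mat_exp_zero)
  have contE: "continuous_on UNIV E"
    unfolding E_def by (rule has_derivative_continuous_on)
      (rule has_derivative_at_withinI[OF mat_exp_has_derivative])
  obtain T F where T: "open T" "(\<psi> u, mat 1) \<in> T" "Cinf T F"
    and F: "\<And>y k. y \<in> V \<inter> UNIV \<Longrightarrow> k \<in> orth_group \<Longrightarrow> (\<lambda>(u,h). r u h) (y,k) \<in> V \<Longrightarrow>
      (\<psi> y, k) \<in> T \<Longrightarrow> F (\<psi> y, k) = \<psi> ((\<lambda>(u,h). r u h) (y,k))"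
    by (rule smooth_map_prod_extension[OF mfP smooth_r d(1) d(1), of u "mat 1"])
      (use d in \<open>auto simp: r_one orth_group_mat1\<close>)
  have cont: "continuous_on UNIV (\<lambda>t. r u (E t))"
  proof -
    have "continuous_on UNIV (\<lambda>t. (\<lambda>(u,h). r u h) (u,E t))"
      by (rule continuous_on_compose2[OF r_continuous]) (use E contE in \<open>auto intro!: continuous_intros\<close>)
    then show ?thesis by simp
  qed
  have o: "open ((\<lambda>t. r u (E t)) -` V)"
    by (rule open_vimage[OF smooth_manifold_chart(1)[OF mfP d(1)] cont])
  have oT: "open ((\<lambda>t. (\<psi> u, E t)) -` T)"
    by (rule open_vimage[OF T(1)]) (auto intro!: continuous_intros contE)
  define S where "S = (\<lambda>t. r u (E t)) -` V \<inter> (\<lambda>t. (\<psi> u, E t)) -` T"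
  have S: "open S" "0 \<in> S" using o oT d T by (auto simp: S_def E0 r_one)
  have "((\<lambda>t. (\<psi> u, E t)) has_derivative (\<lambda>s. (0, s *\<^sub>R (X ** E 0)))) (at 0)"
    unfolding E_def by (rule has_derivative_Pair[OF has_derivative_const mat_exp_has_derivative])
  moreover have "(F has_derivative frechet_derivative F (at (\<psi> u, E 0))) (at (\<psi> u, E 0))"
    using Cinf_has_derivative[OF T(3,2)] by (simp add: E0)
  ultimately have "((\<lambda>t. F (\<psi> u, E t)) has_derivative
       (\<lambda>s. frechet_derivative F (at (\<psi> u, E 0)) (0, s *\<^sub>R (X ** E 0)))) (at 0)"
    by (rule has_derivative_compose)
  then have "((\<lambda>t. \<psi> (r u (E t))) has_derivative
       (\<lambda>s. frechet_derivative F (at (\<psi> u, E 0)) (0, s *\<^sub>R (X ** E 0)))) (at 0)"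
    by (rule has_derivative_transform_within_open[OF _ S]) (use F[OF _ E] d in \<open>auto simp: S_def\<close>)
  from patch_has_mderiv[OF mfP d(1) S _ this]
  show ?thesis unfolding E_def[symmetric] by (intro has_mderiv_tmap) (auto simp: S_def)
qed

text \<open>The curve defining the fundamental vector stays in one fibre.\<close>

lemma Tp_fundamental:
  assumes X: "X \<in> orth_algebra"
  shows "Tp u (fundamental_field P r X u) = 0"
proof -
  have u: "r u (mat_exp (0 *\<^sub>R X)) = u" by (simp only: mat_exp_zero r_one)
  have "has_mderiv std_atlas N (\<lambda>t. p (r u (mat_exp (t *\<^sub>R X))))
     (\<lambda>t. Tp u (tmap std_atlas P (\<lambda>t. r u (mat_exp (t *\<^sub>R X))) 0 t)) 0"
    by (rule has_mderiv_compose[OF smooth_manifold_std mfP fundamental_mderiv[OF X]])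
      (use p_mderiv in \<open>simp only: u\<close>)
  moreover have "has_mderiv std_atlas N (\<lambda>t::real. p (r u (mat_exp (t *\<^sub>R X)))) (\<lambda>t. 0) 0"
    using p_r[OF mat_exp_orth_group[OF X]] has_mderiv_const by simp
  ultimately show ?thesis
    unfolding fundamental_field_def by (rule has_mderiv_unique[THEN fun_cong])
qed

lemma Tp_zero_if_vertical:
  assumes "\<omega> u \<xi> \<in> orth_algebra"
  shows "Tp u \<xi> = 0"
  using \<omega>_inj[OF \<omega>_fundamental[OF assms]] Tp_fundamental[OF assms, of u] by simp

lemma triv_D:
  assumes "triv W \<theta>"
  shows "open W" "p u \<in> W \<Longrightarrow> \<theta> u \<in> orth_group"
    "p u \<in> W \<Longrightarrow> triv_section W \<theta> (\<theta> u) (p u) = u"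
    "x \<in> W \<Longrightarrow> h \<in> orth_group \<Longrightarrow> p (triv_section W \<theta> h x) = x"
    "x \<in> W \<Longrightarrow> h \<in> orth_group \<Longrightarrow> \<theta> (triv_section W \<theta> h x) = h"
    "p u \<in> W \<Longrightarrow> h \<in> orth_group \<Longrightarrow> \<theta> (r u h) = \<theta> u ** h"
proof -
  have b: "bij_betw (\<lambda>u. (p u, \<theta> u)) (p -` W) (W \<times> orth_group)"
    using assms by (simp add: triv_def)
  show "open W" "p u \<in> W \<Longrightarrow> h \<in> orth_group \<Longrightarrow> \<theta> (r u h) = \<theta> u ** h"
    using assms by (auto simp: triv_def)
  show "\<theta> u \<in> orth_group" if "p u \<in> W"
    using bij_betwE[OF b] that by auto
  show "triv_section W \<theta> (\<theta> u) (p u) = u" if "p u \<in> W"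
    unfolding triv_section_def using inv_into_f_f[OF bij_betw_imp_inj_on[OF b], of u] that by simp
  show "p (triv_section W \<theta> h x) = x" "\<theta> (triv_section W \<theta> h x) = h" if "x \<in> W" "h \<in> orth_group"
    using f_inv_into_f[of "(x,h)" "\<lambda>u. (p u, \<theta> u)" "p -` W"] bij_betw_imp_surj_on[OF b] that
    by (simp_all add: triv_section_def)
qed

lemma triv_eq:
  assumes "triv W \<theta>" "p u \<in> W" "p u = p v" "\<theta> u = \<theta> v"
  shows "u = v"
  using triv_D(3)[OF assms(1)] assms(2-4) by metis

lemma fibre_transitive:
  assumes "p u = p v"
  shows "\<exists>a\<in>orth_group. v = r u a"
proof -
  obtain W \<theta> where W: "p u \<in> W" "triv W \<theta>" using triv_exists by blast
  define a where "a = transpose (\<theta> u) ** \<theta> v"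
  have "\<theta> u \<in> orth_group" "\<theta> v \<in> orth_group" using triv_D(2)[OF W(2)] W(1) assms by auto
  then have a: "a \<in> orth_group" "\<theta> u ** a = \<theta> v"
    unfolding a_def by (auto simp: matrix_mul_assoc orth_group_inverse orth_group_mult orth_group_transpose)
  have "v = r u a"
    by (rule triv_eq[OF W(2)]) (use W a assms in \<open>auto simp: p_r triv_D(6)[OF W(2)]\<close>)
  then show ?thesis using a by blast
qed

lemma theta_mderiv:
  assumes "triv W \<theta>" "p u \<in> W"
  shows "has_mderiv P std_atlas \<theta> (tmap P std_atlas \<theta> u) u"
  by (rule smooth_map_has_mderiv[OF mfP smooth_manifold_std, of "p -` W"])
    (use assms in \<open>auto simp: triv_def open_p_vimage\<close>)

lemma triv_section_continuous:
  assumes "triv W \<theta>" "h \<in> orth_group"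
  shows "continuous_on W (triv_section W \<theta> h)"
proof -
  have "continuous_on (W \<times> orth_group) (inv_into (p -` W) (\<lambda>u. (p u, \<theta> u)))"
    using assms by (simp add: triv_def smooth_map_def)
  then show ?thesis
    unfolding triv_section_def
    by (rule continuous_on_compose2) (use assms(2) in \<open>auto intro!: continuous_intros\<close>)
qed

text \<open>The inverse of a trivialization has a smooth extension to an open set, so that the
  trivialization has an injective derivative.\<close>

lemma triv_immersion:
  assumes W: "triv W \<theta>" "p u \<in> W" and \<xi>: "Tp u \<xi> = 0" "tmap P std_atlas \<theta> u \<xi> = 0"
  shows "\<xi> = 0"
proof -
  define U \<phi> V \<psi> where "U = fst (chart_at N (p u))" and "\<phi> = snd (chart_at N (p u))"
    and "V = fst (chart_at P u)" and "\<psi> = snd (chart_at P u)"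
  have c: "(U,\<phi>) \<in> N" "p u \<in> U" and d: "(V,\<psi>) \<in> P" "u \<in> V"
    using chart_at_chart[OF mfP] chart_at_chart[OF mfN] by (auto simp: U_def \<phi>_def V_def \<psi>_def)
  note chN = smooth_manifold_chart[OF mfN c(1)] and chP = smooth_manifold_chart[OF mfP d(1)]
  have sm: "smooth_map (prod_atlas N std_atlas) P (W \<times> orth_group) (inv_into (p -` W) (\<lambda>u. (p u, \<theta> u)))"
    using W by (simp add: triv_def)
  note tD = triv_D[OF W(1)]
  obtain T F where T: "open T" "(\<phi> (p u), \<theta> u) \<in> T" "Cinf T F"
    and F: "\<And>y k. y \<in> U \<inter> W \<Longrightarrow> k \<in> orth_group \<Longrightarrow> triv_section W \<theta> k y \<in> V \<Longrightarrow>
      (\<phi> y, k) \<in> T \<Longrightarrow> F (\<phi> y, k) = \<psi> (triv_section W \<theta> k y)"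
    unfolding triv_section_def
    by (rule smooth_map_prod_extension[OF mfN sm c(1) d(1), of "p u" "\<theta> u"])
      (use c d W tD(2,3) in \<open>auto simp: triv_section_def\<close>)
  define K where "K u' = (\<phi> (p u'), \<theta> u')" for u'
  have K: "has_mderiv P std_atlas K (\<lambda>\<xi>. (tmap N std_atlas \<phi> (p u) (Tp u \<xi>), tmap P std_atlas \<theta> u \<xi>)) u"
    unfolding K_def
    by (intro has_mderiv_Pair[OF mfP] theta_mderiv[OF W]
        has_mderiv_compose[OF mfP mfN p_mderiv chart_has_mderiv(1)[OF mfN c]])
  have FK: "has_mderiv P std_atlas (\<lambda>u. F (K u))
      (\<lambda>\<xi>. frechet_derivative F (at (K u)) (tmap N std_atlas \<phi> (p u) (Tp u \<xi>), tmap P std_atlas \<theta> u \<xi>)) u"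
    by (rule has_mderiv_compose[OF mfP smooth_manifold_std K])
      (use Cinf_has_derivative[OF T(3,2)] in \<open>simp add: K_def\<close>)
  have "isCont K u" using K by (simp add: has_mderiv_def)
  from isCont_eventually_mem[OF this T(1)] T(2)
  have "eventually (\<lambda>y. K y \<in> T) (nhds u)" by (simp add: K_def)
  moreover have "eventually (\<lambda>y. y \<in> p -` (U \<inter> W) \<inter> V) (nhds u)"
    using c d W chN(1) chP(1) tD(1) by (intro eventually_nhds_in_open open_Int open_p_vimage) auto
  ultimately have "eventually (\<lambda>y. F (K y) = \<psi> y) (nhds u)"
  proof eventually_elim
    case (elim y)
    then show ?case using F[of "p y" "\<theta> y"] tD(2,3)[of y] by (simp add: K_def)
  qed
  then obtain O' where "open O'" "u \<in> O'" "\<And>y. y \<in> O' \<Longrightarrow> F (K y) = \<psi> y"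
    unfolding eventually_nhds by blast
  from fun_cong[OF has_mderiv_unique[OF has_mderiv_cong[OF mfP FK this] chart_has_mderiv(1)[OF mfP d]], of \<xi>]
  have "tmap P std_atlas \<psi> u \<xi> =
     frechet_derivative F (at (K u)) (tmap N std_atlas \<phi> (p u) (Tp u \<xi>), tmap P std_atlas \<theta> u \<xi>)"
    by (rule sym)
  also have "\<dots> = 0"
    using linear_0[OF has_mderiv_linear[OF chart_has_mderiv(1)[OF mfN c]]]
      linear_0[OF has_derivative_linear[OF Cinf_has_derivative[OF T(3,2)]]]
    by (simp add: \<xi> K_def zero_prod_def)
  finally show ?thesis
    using chart_tmap_inverse(2)[OF mfP d, of \<xi>] linear_0[OF has_mderiv_linear[OF chart_has_mderiv(2)[OF mfP d]]]
    by simp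
qed

text \<open>If \<open>\<eta>\<close> is killed by \<open>Tp\<close>, then \<open>X = \<theta>(u)\<inverse> T\<theta>(\<eta>)\<close> lies in \<open>\<hh>\<close>, since \<open>\<theta>\<close> takes its
  values in \<open>H\<close>. The fundamental vector of \<open>X\<close> has the same image under \<open>Tp\<close> and \<open>T\<theta>\<close> as \<open>\<eta>\<close>, so it
  equals \<open>\<eta>\<close>, and \<open>\<omega>\<close> maps it to \<open>X\<close>.\<close>

lemma vertical_if_Tp_zero:
  assumes W: "triv W \<theta>" "p u \<in> W" and \<eta>: "Tp u \<eta> = 0"
  shows "\<omega> u \<eta> \<in> orth_algebra" "tmap P std_atlas \<theta> u \<eta> = \<theta> u ** \<omega> u \<eta>"
proof -
  define V \<psi> where "V = fst (chart_at P u)" and "\<psi> = snd (chart_at P u)"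
  have d: "(V,\<psi>) \<in> P" "u \<in> V" using chart_at_chart[OF mfP] by (auto simp: V_def \<psi>_def)
  note ch = smooth_manifold_chart[OF mfP d(1)] and tD = triv_D[OF W(1)]
  note th = theta_mderiv[OF W]
  define X where "X = transpose (\<theta> u) ** tmap P std_atlas \<theta> u \<eta>"
  have o: "open (\<psi> ` (V \<inter> p -` W))"
    by (rule chart_open_image[OF mfP d(1)]) (use ch open_p_vimage[OF tD(1)] in auto)
  have X: "X \<in> orth_algebra"
  proof -
    have "((\<theta> \<circ> inv_into V \<psi>) has_derivative tmap P std_atlas \<theta> u) (at (\<psi> u))"
      using th by (simp add: has_mderiv_def V_def \<psi>_def)
    moreover have "(\<theta> \<circ> inv_into V \<psi>) z \<in> orth_group" if "z \<in> \<psi> ` (V \<inter> p -` W)" for z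
      using that tD(2) ch(5) by auto
    moreover have "\<psi> u \<in> \<psi> ` (V \<inter> p -` W)" using d W by auto
    ultimately show ?thesis
      using orth_group_tangent[OF o, of "\<psi> u" "\<theta> \<circ> inv_into V \<psi>"] d ch(5) by (simp add: X_def)
  qed
  have u: "r u (mat_exp (0 *\<^sub>R X)) = u" by (simp only: mat_exp_zero r_one)
  let ?\<zeta> = "fundamental_field P r X u"
  have "has_mderiv std_atlas std_atlas (\<lambda>t. \<theta> (r u (mat_exp (t *\<^sub>R X))))
     (\<lambda>t. tmap P std_atlas \<theta> u (tmap std_atlas P (\<lambda>t. r u (mat_exp (t *\<^sub>R X))) 0 t)) 0"
    by (rule has_mderiv_compose[OF smooth_manifold_std mfP fundamental_mderiv[OF X]])
      (use th in \<open>simp only: u\<close>)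
  moreover have "has_mderiv std_atlas std_atlas (\<lambda>t::real. \<theta> (r u (mat_exp (t *\<^sub>R X))))
      (\<lambda>s. \<theta> u ** (s *\<^sub>R (X ** mat_exp (0 *\<^sub>R X)))) 0"
    unfolding triv_D(6)[OF W mat_exp_orth_group[OF X]] has_mderiv_std_std
    by (rule bounded_linear.has_derivative[OF bounded_bilinear.bounded_linear_right[OF bounded_bilinear_matrix_mult]
        mat_exp_has_derivative])
  ultimately have "tmap P std_atlas \<theta> u ?\<zeta> = \<theta> u ** (1 *\<^sub>R (X ** mat_exp (0 *\<^sub>R X)))"
    unfolding fundamental_field_def by (rule has_mderiv_unique[THEN fun_cong])
  then have T\<zeta>: "tmap P std_atlas \<theta> u ?\<zeta> = \<theta> u ** X"
    unfolding mat_exp_zero by simp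
  have \<theta>X: "\<theta> u ** X = tmap P std_atlas \<theta> u \<eta>"
    using orth_group_inverse(2)[OF tD(2)[OF W(2)]] by (simp add: X_def matrix_mul_assoc)
  have "\<eta> - ?\<zeta> = 0"
    by (rule triv_immersion[OF W])
      (simp_all add: linear_diff[OF linear_Tp] linear_diff[OF has_mderiv_linear[OF th]] \<eta>
        Tp_fundamental[OF X] T\<zeta> \<theta>X)
  then have "\<omega> u \<eta> = X" using \<omega>_fundamental[OF X] by simp
  then show "\<omega> u \<eta> \<in> orth_algebra" "tmap P std_atlas \<theta> u \<eta> = \<theta> u ** \<omega> u \<eta>"
    using X \<theta>X by simp_all
qed

section \<open>Local sections\<close>

text \<open>Sections over a coordinate domain are parametrized by the coordinates \<open>z\<close>. The last conjunct
  asks for a single chart of the bundle that contains the image; it makes smoothness a statement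
  about maps between Euclidean spaces.\<close>

definition local_section :: "'x set \<Rightarrow> ('x \<Rightarrow> 'e) \<Rightarrow> 'e set \<Rightarrow> ('e \<Rightarrow> 'p) \<Rightarrow> bool" where
  "local_section U \<phi> S s \<longleftrightarrow> (U,\<phi>) \<in> N \<and> open S \<and> S \<subseteq> \<phi> ` U \<and>
     (\<forall>z\<in>S. p (s z) = inv_into U \<phi> z) \<and>
     (\<exists>V \<psi>. (V,\<psi>) \<in> P \<and> (\<forall>z\<in>S. s z \<in> V) \<and> Cinf S (\<lambda>z. \<psi> (s z)))"

lemma local_section_exists:
  assumes W: "triv W \<theta>" "h \<in> orth_group" and c: "(U,\<phi>) \<in> N" "x \<in> U \<inter> W"
  shows "\<exists>S. \<phi> x \<in> S \<and> S \<subseteq> \<phi> ` (U \<inter> W) \<and> local_section U \<phi> S (\<lambda>z. triv_section W \<theta> h (inv_into U \<phi> z))"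
proof -
  define V \<psi> where "V = fst (chart_at P (triv_section W \<theta> h x))" and "\<psi> = snd (chart_at P (triv_section W \<theta> h x))"
  have d: "(V,\<psi>) \<in> P" "triv_section W \<theta> h x \<in> V"
    using chart_at_chart[OF mfP] by (auto simp: V_def \<psi>_def)
  note ch = smooth_manifold_chart[OF mfN c(1)] and tD = triv_D[OF W(1)]
  have sm: "smooth_map (prod_atlas N std_atlas) P (W \<times> orth_group) (inv_into (p -` W) (\<lambda>u. (p u, \<theta> u)))"
    using W by (simp add: triv_def)
  obtain T F where T: "open T" "(\<phi> x, h) \<in> T" "Cinf T F"
    and F: "\<And>y k. y \<in> U \<inter> W \<Longrightarrow> k \<in> orth_group \<Longrightarrow> triv_section W \<theta> k y \<in> V \<Longrightarrow>
      (\<phi> y, k) \<in> T \<Longrightarrow> F (\<phi> y, k) = \<psi> (triv_section W \<theta> k y)"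
    unfolding triv_section_def
    by (rule smooth_map_prod_extension[OF mfN sm c(1) d(1), of x h])
      (use c d W in \<open>auto simp: triv_section_def\<close>)
  have oW: "open (W \<inter> triv_section W \<theta> h -` V)"
    by (rule continuous_open_preimage[OF triv_section_continuous[OF W] tD(1) smooth_manifold_chart(1)[OF mfP d(1)]])
  have o: "open (\<phi> ` (U \<inter> (W \<inter> triv_section W \<theta> h -` V)))"
    by (rule chart_open_image[OF mfN c(1)]) (use ch oW in auto)
  have oT: "open ((\<lambda>y. (y,h)) -` T)"
    by (rule open_vimage[OF T(1)]) (auto intro!: continuous_intros)
  define S where "S = \<phi> ` (U \<inter> (W \<inter> triv_section W \<theta> h -` V)) \<inter> (\<lambda>y. (y,h)) -` T"
  have oS: "open S" unfolding S_def by (rule open_Int[OF o oT])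
  have "Cinf S (\<lambda>z. F (z, h))"
  proof (rule Cinf_compose[OF oS T(1) _ T(3)])
    have "bounded_linear (\<lambda>z :: 'e. (z, 0 :: 'k emat))"
      by (intro bounded_linear_Pair bounded_linear_ident bounded_linear_zero)
    from Cinf_add[OF oS Cinf_linear[OF this oS Cinf_ident[OF oS]] Cinf_const[of S "(0,h)"]]
    show "Cinf S (\<lambda>z. (z, h))" by simp
  qed (auto simp: S_def)
  then have "Cinf S (\<lambda>z. \<psi> (triv_section W \<theta> h (inv_into U \<phi> z)))"
    by (rule Cinf_cong[OF oS]) (use F[OF _ W(2)] in \<open>auto simp: S_def ch\<close>)
  then have "local_section U \<phi> S (\<lambda>z. triv_section W \<theta> h (inv_into U \<phi> z))"
    unfolding local_section_def using c d oS tD(4)[OF _ W(2)]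
    by (auto simp: S_def ch intro!: exI[of _ V] exI[of _ \<psi>])
  then show ?thesis
    using c d T by (intro exI[of _ S]) (auto simp: S_def)
qed

lemma local_section_mderiv:
  assumes s: "local_section U \<phi> S s" and z: "z \<in> S"
  shows "has_mderiv std_atlas P s (tmap std_atlas P s z) z"
    "Tp (s z) (tmap std_atlas P s z e) = tmap std_atlas N (inv_into U \<phi>) z e"
    "Tp (s z) (tmap std_atlas P s z (tmap N std_atlas \<phi> (inv_into U \<phi> z) w)) = w"
proof -
  obtain V \<psi> where c: "(U,\<phi>) \<in> N" and S: "open S" "S \<subseteq> \<phi> ` U" "\<And>z. z \<in> S \<Longrightarrow> p (s z) = inv_into U \<phi> z"
    and d: "(V,\<psi>) \<in> P" "\<And>z. z \<in> S \<Longrightarrow> s z \<in> V" "Cinf S (\<lambda>z. \<psi> (s z))"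
    using s unfolding local_section_def by blast
  show m: "has_mderiv std_atlas P s (tmap std_atlas P s z) z"
    by (rule has_mderiv_tmap[OF patch_has_mderiv[OF mfP d(1) S(1) z d(2) Cinf_has_derivative[OF d(3) z]]])
  have zU: "inv_into U \<phi> z \<in> U" "\<phi> (inv_into U \<phi> z) = z"
    using S(2) z by (auto simp: smooth_manifold_chart[OF mfN c])
  have "has_mderiv std_atlas N (inv_into U \<phi>) (\<lambda>e. Tp (s z) (tmap std_atlas P s z e)) z"
    by (rule has_mderiv_cong[OF smooth_manifold_std
          has_mderiv_compose[OF smooth_manifold_std mfP m p_mderiv] S(1) z]) (use S(3) in auto)
  then show a: "Tp (s z) (tmap std_atlas P s z e) = tmap std_atlas N (inv_into U \<phi>) z e" for e
    by (simp add: tmap_eq)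
  show "Tp (s z) (tmap std_atlas P s z (tmap N std_atlas \<phi> (inv_into U \<phi> z) w)) = w"
    unfolding a using chart_tmap_inverse(2)[OF mfN c zU(1)] zU(2) by simp
qed

lemma section_through:
  assumes c: "(U,\<phi>) \<in> N" "p u \<in> U"
  obtains S s where "local_section U \<phi> S s" "\<phi> (p u) \<in> S" "s (\<phi> (p u)) = u"
proof -
  obtain W \<theta> where W: "p u \<in> W" "triv W \<theta>" using triv_exists by blast
  obtain S where "\<phi> (p u) \<in> S" "local_section U \<phi> S (\<lambda>z. triv_section W \<theta> (\<theta> u) (inv_into U \<phi> z))"
    using local_section_exists[OF W(2) triv_D(2)[OF W(2,1)] c(1)] c W by blast
  then show thesis
    using that triv_D(3)[OF W(2,1)] smooth_manifold_chart(5)[OF mfN c] by metis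
qed

text \<open>A section through \<open>u\<close> provides a right inverse of \<open>Tp\<close>.\<close>

lemma Tp_surj: "\<exists>\<xi>. Tp u \<xi> = w"
proof -
  note c = chart_at_chart[OF mfN, of "p u"]
  obtain S s where S: "local_section (fst (chart_at N (p u))) (snd (chart_at N (p u))) S s"
     "snd (chart_at N (p u)) (p u) \<in> S" "s (snd (chart_at N (p u)) (p u)) = u"
    by (rule section_through[OF c])
  show ?thesis using local_section_mderiv(3)[OF S(1,2)] S(3) by metis
qed

section \<open>The induced objects\<close>

abbreviation "\<Phi> u \<equiv> phi P N p \<omega> u"

text \<open>The form \<open>pr\<^sub>\<mm> \<circ> \<omega>\<close> and \<open>Tp\<close> have the same kernel and are both surjective, so one
  is the other followed by a unique isomorphism.\<close>

lemma phi_props: "linear (\<Phi> u)" "bij (\<Phi> u)" "\<Phi> u (Tp u \<xi>) = mpart (\<omega> u \<xi>)"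
proof -
  have ker: "Tp u \<xi> = 0 \<longleftrightarrow> mpart (\<omega> u \<xi>) = 0" for \<xi>
  proof
    assume "Tp u \<xi> = 0"
    moreover obtain W \<theta> where "p u \<in> W" "triv W \<theta>" using triv_exists by blast
    ultimately show "mpart (\<omega> u \<xi>) = 0" using vertical_if_Tp_zero mpart_orth_algebra by blast
  next
    assume "mpart (\<omega> u \<xi>) = 0"
    then have "\<omega> u \<xi> \<in> orth_algebra"
      using euc_algebra_decompose[OF \<omega>_mem, of u \<xi>] linear_0[OF linear_m_mat] by (metis add.right_neutral)
    then show "Tp u \<xi> = 0" by (rule Tp_zero_if_vertical)
  qed
  have lin: "linear (\<lambda>\<xi>. mpart (\<omega> u \<xi>))"
    using linear_compose[OF \<omega>_linear linear_mpart] by (simp add: o_def)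
  define f where "f w = mpart (\<omega> u (SOME \<xi>. Tp u \<xi> = w))" for w
  have f: "f (Tp u \<xi>) = mpart (\<omega> u \<xi>)" for \<xi>
  proof -
    have "Tp u (SOME \<eta>. Tp u \<eta> = Tp u \<xi>) = Tp u \<xi>" by (rule someI_ex) blast
    then have "Tp u ((SOME \<eta>. Tp u \<eta> = Tp u \<xi>) - \<xi>) = 0" by (simp add: linear_diff[OF linear_Tp])
    then show ?thesis unfolding ker f_def by (simp add: linear_diff[OF lin])
  qed
  have "linear f"
  proof (rule linearI)
    fix a b :: 'e and c :: real
    obtain \<xi> \<eta> where ab: "a = Tp u \<xi>" "b = Tp u \<eta>" using Tp_surj by metis
    show "f (a + b) = f a + f b"
      unfolding ab by (simp add: f linear_add[OF lin] flip: linear_add[OF linear_Tp])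
    show "f (c *\<^sub>R a) = c *\<^sub>R f a"
      unfolding ab by (simp add: f linear_cmul[OF lin] flip: linear_cmul[OF linear_Tp])
  qed
  moreover have "bij f"
  proof (rule bijI)
    have "a = 0" if "f a = 0" for a
      using that ker f Tp_surj by metis
    then show "inj f" using linear_injective_0[OF \<open>linear f\<close>] by blast
    have "\<exists>a. f a = t" for t using \<omega>_surj[OF m_mat_euc_algebra] f by (metis mpart_m_mat)
    then show "surj f" by (metis surj_def)
  qed
  ultimately have ex: "linear f \<and> bij f \<and> (\<forall>\<xi>. f (Tp u \<xi>) = pr_m (\<omega> u \<xi>))"
    by (simp add: f pr_m_eq \<omega>_mem)
  have "\<Phi> u = f"
    unfolding phi_def
  proof (rule the_equality, rule ex)
    fix g assume g: "linear g \<and> bij g \<and> (\<forall>\<xi>. g (Tp u \<xi>) = pr_m (\<omega> u \<xi>))"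
    show "g = f"
    proof
      fix w
      obtain \<xi> where "w = Tp u \<xi>" using Tp_surj by metis
      then show "g w = f w" using g ex by simp
    qed
  qed
  then show "linear (\<Phi> u)" "bij (\<Phi> u)" "\<Phi> u (Tp u \<xi>) = mpart (\<omega> u \<xi>)"
    using \<open>linear f\<close> \<open>bij f\<close> f by simp_all
qed

lemma phi_inj: "\<Phi> u v = \<Phi> u w \<Longrightarrow> v = w"
  using phi_props(2)[of u] by (simp add: bij_def inj_eq)

lemma phi_inv: "\<Phi> u (inv (\<Phi> u) t) = t"
  using phi_props(2)[of u] by (simp add: bij_is_surj surj_f_inv_f)

lemma gamma_conn_eq: "gamma_conn \<omega> u \<xi> = hpart (\<omega> u \<xi>)"
  by (simp add: gamma_conn_def pr_h_eq \<omega>_mem)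

abbreviation "hor w u \<equiv> horizontal_lift P N p (gamma_conn \<omega>) w u"

text \<open>The horizontal lift of \<open>w\<close> is the vector that \<open>\<omega>\<close> maps to \<open>\<phi>\<^sub>u(w) \<in> \<mm>\<close>.\<close>

lemma hor_iff: "\<xi> = hor w u \<longleftrightarrow> Tp u \<xi> = w \<and> hpart (\<omega> u \<xi>) = 0"
proof -
  obtain \<xi>0 where \<xi>0: "\<omega> u \<xi>0 = m_mat (\<Phi> u w)" using \<omega>_surj[OF m_mat_euc_algebra] by blast
  have "\<Phi> u (Tp u \<xi>0) = \<Phi> u w" by (simp add: phi_props \<xi>0)
  then have "Tp u \<xi>0 = w" by (rule phi_inj)
  then have ex: "Tp u \<xi>0 = w \<and> hpart (\<omega> u \<xi>0) = 0" by (simp add: \<xi>0)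
  have un: "\<xi> = \<xi>0" if "Tp u \<xi> = w \<and> hpart (\<omega> u \<xi>) = 0" for \<xi>
  proof (rule \<omega>_inj)
    have "\<omega> u \<xi> = m_mat (mpart (\<omega> u \<xi>))"
      using euc_algebra_decompose(1)[OF \<omega>_mem, of u \<xi>] that by simp
    also have "\<dots> = \<omega> u \<xi>0" using phi_props(3)[of u \<xi>] that \<xi>0 by simp
    finally show "\<omega> u \<xi> = \<omega> u \<xi>0" .
  qed
  have "hor w u = \<xi>0"
    unfolding horizontal_lift_def gamma_conn_eq by (rule the_equality, rule ex, rule un)
  then show ?thesis using ex un by metis
qed

lemma Tp_hor: "Tp u (hor w u) = w" and hpart_hor: "hpart (\<omega> u (hor w u)) = 0"
  using hor_iff by blast+

lemma hor_add: "hor (v + w) u = hor v u + hor w u"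
  by (rule sym, unfold hor_iff)
    (simp add: linear_add[OF linear_Tp] linear_add[OF \<omega>_linear] linear_add[OF linear_hpart] Tp_hor hpart_hor)

lemma hor_scaleR: "hor (c *\<^sub>R w) u = c *\<^sub>R hor w u"
  by (rule sym, unfold hor_iff)
    (simp add: linear_cmul[OF linear_Tp] linear_cmul[OF \<omega>_linear] linear_cmul[OF linear_hpart] Tp_hor hpart_hor)

lemma Tp_r:
  assumes a: "a \<in> orth_group"
  shows "Tp (r u a) (tmap P P (\<lambda>u. r u a) u \<xi>) = Tp u \<xi>"
proof -
  have "tmap P N (\<lambda>u. p (r u a)) u \<xi> = Tp (r u a) (tmap P P (\<lambda>u. r u a) u \<xi>)"
    by (rule tmap_compose[OF mfP mfP r_mderiv[OF a] p_mderiv])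
  then show ?thesis by (simp add: p_r[OF a])
qed

lemma phi_r:
  assumes a: "a \<in> orth_group"
  shows "\<Phi> (r u a) w = mact (transpose a) (\<Phi> u w)"
proof -
  obtain \<xi> where w: "w = Tp u \<xi>" using Tp_surj by metis
  have "\<Phi> (r u a) (Tp (r u a) (tmap P P (\<lambda>u. r u a) u \<xi>)) = mact (transpose a) (\<Phi> u (Tp u \<xi>))"
    by (simp add: phi_props \<omega>_r[OF a] Ad_matrix_inv[OF a] mpart_conj[OF a])
  then show ?thesis by (simp add: w Tp_r[OF a])
qed

lemma hor_r:
  assumes a: "a \<in> orth_group"
  shows "hor w (r u a) = tmap P P (\<lambda>u. r u a) u (hor w u)"
  by (rule sym, unfold hor_iff)
    (simp add: Tp_r[OF a] Tp_hor \<omega>_r[OF a] Ad_matrix_inv[OF a] hpart_conj[OF a] hpart_hor bounded_bilinear.zero_right[OF bounded_bilinear_matrix_mult] bounded_bilinear.zero_left[OF bounded_bilinear_matrix_mult])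


section \<open>Vector fields as equivariant functions\<close>

abbreviation fV :: "('x \<Rightarrow> 'e) \<Rightarrow> 'p \<Rightarrow> 'k mspace" where
  "fV V u \<equiv> \<Phi> u (V (p u))"

text \<open>The pull-back of \<open>\<omega>\<close> along a section, split into its two parts: a coframe of the base with
  values in \<open>\<mm>\<close>, and the connection form of \<open>\<gamma>\<close> with values in \<open>\<hh>\<close>.\<close>

definition frame :: "('e \<Rightarrow> 'p) \<Rightarrow> 'e \<Rightarrow> 'e \<Rightarrow> 'k mspace" where
  "frame s z e = mpart (\<omega> (s z) (tmap std_atlas P s z e))"

definition conn_form :: "('e \<Rightarrow> 'p) \<Rightarrow> 'e \<Rightarrow> 'e \<Rightarrow> 'k emat" where
  "conn_form s z e = hpart (\<omega> (s z) (tmap std_atlas P s z e))"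

lemma local_section_Cinf:
  assumes s: "local_section U \<phi> S s"
  shows "Cinf S (\<lambda>z. frame s z e)" "Cinf S (\<lambda>z. conn_form s z e)"
proof -
  obtain V \<psi> where S: "open S" and d: "(V,\<psi>) \<in> P" "\<And>z. z \<in> S \<Longrightarrow> s z \<in> V" "Cinf S (\<lambda>z. \<psi> (s z))"
    using s unfolding local_section_def by blast
  note c = smooth_one_form_pullback[OF mfP d(1) S d(2,3) smooth_\<omega>, of e]
  show "Cinf S (\<lambda>z. frame s z e)"
    unfolding frame_def by (rule Cinf_linear[OF bounded_linear_mpart S c])
  show "Cinf S (\<lambda>z. conn_form s z e)"
    unfolding conn_form_def by (rule Cinf_linear[OF bounded_linear_hpart S c])
qed

lemma local_sectionD:
  assumes s: "local_section U \<phi> S s"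
  shows "(U,\<phi>) \<in> N" "open S" "z \<in> S \<Longrightarrow> inv_into U \<phi> z \<in> U" "z \<in> S \<Longrightarrow> \<phi> (inv_into U \<phi> z) = z"
    "z \<in> S \<Longrightarrow> p (s z) = inv_into U \<phi> z"
  using s smooth_manifold_chart(5)[OF mfN] unfolding local_section_def by (auto simp: subset_iff image_iff) 

text \<open>Along a section, \<open>\<phi>\<close> is expressed without reference to vectors on the bundle; this makes it
  possible to see that it depends smoothly on the point.\<close>

lemma frame_eq_phi:
  assumes s: "local_section U \<phi> S s" and z: "z \<in> S"
  shows "\<Phi> (s z) w = frame s z (tmap N std_atlas \<phi> (inv_into U \<phi> z) w)"
  unfolding frame_def phi_props(3)[symmetric] local_section_mderiv(3)[OF s z] ..

lemma frame_linear_bij: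
  assumes s: "local_section U \<phi> S s" and z: "z \<in> S"
  shows "linear (frame s z)" "bij (frame s z)"
proof -
  note D = local_sectionD[OF s]
  let ?J = "tmap N std_atlas \<phi> (inv_into U \<phi> z)" and ?K = "tmap std_atlas N (inv_into U \<phi>) z"
  have JK: "?J (?K v) = v" "?K (?J v) = v" for v
    using chart_tmap_inverse[OF mfN D(1) D(3)[OF z]] D(4)[OF z] by simp_all
  show "linear (frame s z)"
    unfolding frame_def
    using linear_compose[OF linear_compose[OF has_mderiv_linear[OF local_section_mderiv(1)[OF s z]] \<omega>_linear] linear_mpart]
    by (simp add: o_def)
  have "frame s z = \<Phi> (s z) \<circ> ?K"
    using frame_eq_phi[OF s z, of "?K v" for v] by (auto simp: JK)
  moreover have "bij ?K" by (rule o_bij[of ?J]) (auto simp: JK o_def)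
  ultimately show "bij (frame s z)" using phi_props(2) by (simp add: bij_comp)
qed

lemma fV_section_Cinf:
  assumes s: "local_section U \<phi> S s" and V: "smooth_vector_field N V"
  shows "Cinf S (\<lambda>z. fV V (s z))"
proof -
  note D = local_sectionD[OF s]
  have "Cinf S (\<lambda>z. tmap N std_atlas \<phi> (inv_into U \<phi> z) (V (inv_into U \<phi> z)))"
    by (rule Cinf_subset[OF smooth_vector_field_chart[OF mfN V D(1)]])
      (use s in \<open>simp add: local_section_def\<close>)
  from Cinf_linear_family[OF D(2) frame_linear_bij(1)[OF s] local_section_Cinf(1)[OF s] this]
  show ?thesis
    by (rule Cinf_cong[OF D(2)]) (simp_all add: frame_eq_phi[OF s] D)
qed

text \<open>Equivariance determines \<open>f\<^sub>V\<close> by its values on a section with \<open>\<theta> = 1\<close>, as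
  \<open>f\<^sub>V(u) = \<theta>(u)\<^sup>t \<cdot> f\<^sub>V(s(p u))\<close>; the product rule gives the derivative.\<close>

lemma fV_mderiv_section:
  assumes W: "triv W \<theta>" and s: "local_section U \<phi> S s" and V: "smooth_vector_field N V"
    and \<theta>s: "\<And>z. z \<in> S \<Longrightarrow> p (s z) \<in> W \<and> \<theta> (s z) = mat 1" and u: "p u \<in> U" "\<phi> (p u) \<in> S"
  shows "has_mderiv P std_atlas (fV V)
     (\<lambda>\<xi>. mact (transpose (\<theta> u)) (frechet_derivative (\<lambda>z. fV V (s z)) (at (\<phi> (p u)))
             (tmap N std_atlas \<phi> (p u) (Tp u \<xi>)))
        + dact (transpose (tmap P std_atlas \<theta> u \<xi>)) (fV V (s (\<phi> (p u))))) u"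
proof -
  note D = local_sectionD[OF s] and ch = smooth_manifold_chart[OF mfN local_sectionD(1)[OF s]]
  note tD = triv_D[OF W]
  have pu: "p (s (\<phi> (p u))) = p u" using D(5)[OF u(2)] ch(5)[OF u(1)] by simp
  then have uW: "p u \<in> W" using \<theta>s[OF u(2)] by simp
  define F where "F z = fV V (s z)" for z
  define DF where "DF = frechet_derivative F (at (\<phi> (p u)))"
  have F: "(F has_derivative DF) (at (\<phi> (p u)))"
    unfolding DF_def F_def by (rule Cinf_has_derivative[OF fV_section_Cinf[OF s V] u(2)])
  let ?J = "tmap N std_atlas \<phi> (p u)"
  have "has_mderiv P std_atlas (\<lambda>u. \<phi> (p u)) (\<lambda>\<xi>. ?J (Tp u \<xi>)) u"
    by (rule has_mderiv_compose[OF mfP mfN p_mderiv chart_has_mderiv(1)[OF mfN D(1) u(1)]])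
  then have Fm: "has_mderiv P std_atlas (\<lambda>u. F (\<phi> (p u))) (\<lambda>\<xi>. DF (?J (Tp u \<xi>))) u"
    by (rule has_mderiv_compose[OF mfP smooth_manifold_std]) (use F in simp)
  have th: "has_mderiv P std_atlas (\<lambda>u. transpose (\<theta> u)) (\<lambda>\<xi>. transpose (tmap P std_atlas \<theta> u \<xi>)) u"
    by (rule has_mderiv_bounded_linear[OF mfP bounded_linear_transpose theta_mderiv[OF W uW]])
  have "has_mderiv P std_atlas (\<lambda>u. (fst (F (\<phi> (p u))), 0) + dact (transpose (\<theta> u)) (F (\<phi> (p u))))
     (\<lambda>\<xi>. (fst (DF (?J (Tp u \<xi>))), 0) + (dact (transpose (\<theta> u)) (DF (?J (Tp u \<xi>)))
        + dact (transpose (tmap P std_atlas \<theta> u \<xi>)) (F (\<phi> (p u))))) u"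
    by (rule has_mderiv_add[OF mfP has_mderiv_bounded_linear[OF mfP bounded_linear_fst0 Fm]
          has_mderiv_bilinear[OF bounded_bilinear_dact mfP th Fm]])
  then have m: "has_mderiv P std_atlas (\<lambda>u. mact (transpose (\<theta> u)) (F (\<phi> (p u))))
     (\<lambda>\<xi>. mact (transpose (\<theta> u)) (DF (?J (Tp u \<xi>)))
        + dact (transpose (tmap P std_atlas \<theta> u \<xi>)) (F (\<phi> (p u)))) u"
    by (simp add: mact_eq_dact add.assoc)
  have oU: "open (U \<inter> \<phi> -` S)"
    by (rule continuous_open_preimage[OF ch(3,1) D(2)])
  have "has_mderiv P std_atlas (fV V)
     (\<lambda>\<xi>. mact (transpose (\<theta> u)) (DF (?J (Tp u \<xi>)))
        + dact (transpose (tmap P std_atlas \<theta> u \<xi>)) (F (\<phi> (p u)))) u"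
  proof (rule has_mderiv_cong[OF mfP m open_p_vimage[OF oU]])
    show "u \<in> p -` (U \<inter> \<phi> -` S)" using u by simp
    fix y assume "y \<in> p -` (U \<inter> \<phi> -` S)"
    then have y: "p y \<in> U" "\<phi> (p y) \<in> S" by auto
    have py: "p (s (\<phi> (p y))) = p y" using D(5)[OF y(2)] ch(5)[OF y(1)] by simp
    then have yW: "p y \<in> W" "\<theta> y \<in> orth_group" using \<theta>s[OF y(2)] tD(2) by auto
    \<comment> \<open>every point of the bundle is a translate of the section\<close>
    have "y = r (s (\<phi> (p y))) (\<theta> y)"
      by (rule triv_eq[OF W yW(1)]) (use py yW \<theta>s[OF y(2)] in \<open>simp_all add: p_r tD(6)\<close>)
    then have "\<Phi> y w = mact (transpose (\<theta> y)) (\<Phi> (s (\<phi> (p y))) w)" for w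
      using phi_r[OF yW(2), of "s (\<phi> (p y))"] by simp
    then show "mact (transpose (\<theta> y)) (F (\<phi> (p y))) = fV V y"
      by (simp add: F_def py)
  qed
  then show ?thesis by (simp add: DF_def F_def[abs_def])
qed

lemma unit_section_exists:
  assumes c: "(U,\<phi>) \<in> N" "x \<in> U"
  obtains W \<theta> S s where "triv W \<theta>" "local_section U \<phi> S s" "\<phi> x \<in> S"
    "\<And>z. z \<in> S \<Longrightarrow> p (s z) \<in> W \<and> \<theta> (s z) = mat 1"
proof -
  obtain W \<theta> where W: "x \<in> W" "triv W \<theta>" using triv_exists by blast
  obtain S where S: "\<phi> x \<in> S" "S \<subseteq> \<phi> ` (U \<inter> W)"
    "local_section U \<phi> S (\<lambda>z. triv_section W \<theta> (mat 1) (inv_into U \<phi> z))"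
    using local_section_exists[OF W(2) orth_group_mat1 c(1)] c W by blast
  show thesis
  proof (rule that[OF W(2) S(3,1)])
    fix z assume "z \<in> S"
    then have "inv_into U \<phi> z \<in> W" using S(2) smooth_manifold_chart(5)[OF mfN c(1)] by auto
    then show "p (triv_section W \<theta> (mat 1) (inv_into U \<phi> z)) \<in> W \<and> \<theta> (triv_section W \<theta> (mat 1) (inv_into U \<phi> z)) = mat 1"
      using triv_D(4,5)[OF W(2) _ orth_group_mat1] by simp
  qed
qed

lemma fV_mderiv:
  assumes V: "smooth_vector_field N V"
  shows "has_mderiv P std_atlas (fV V) (tmap P std_atlas (fV V) u) u"
proof -
  note c = chart_at_chart[OF mfN, of "p u"]
  obtain W \<theta> S s where *: "triv W \<theta>" "local_section (fst (chart_at N (p u))) (snd (chart_at N (p u))) S s"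
     "snd (chart_at N (p u)) (p u) \<in> S" "\<And>z. z \<in> S \<Longrightarrow> p (s z) \<in> W \<and> \<theta> (s z) = mat 1"
    by (rule unit_section_exists[OF c]) blast
  from fV_mderiv_section[OF *(1,2) V *(4) c(2) *(3)] show ?thesis by (rule has_mderiv_tmap)
qed

section \<open>The induced connection\<close>

abbreviation "AD X V u \<equiv> assoc_deriv P N p \<omega> (gamma_conn \<omega>) X V u"
abbreviation "DD X V x \<equiv> nabla P N p \<omega> (gamma_conn \<omega>) X V x"

lemma AD_eq: "AD X V u = tmap P std_atlas (fV V) u (hor (X (p u)) u)"
  by (simp add: assoc_deriv_def)

lemma fibre_point: "p (fibre_point p x) = x"
proof -
  obtain W \<theta> where W: "x \<in> W" "triv W \<theta>" using triv_exists by blast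
  show ?thesis unfolding fibre_point_def
    by (rule someI) (rule triv_D(4)[OF W(2,1) orth_group_mat1])
qed

lemma phi_DD_fibre_point: "\<Phi> (fibre_point p x) (DD X V x) = AD X V (fibre_point p x)"
  by (simp add: nabla_def phi_inv)

lemma fV_r: "a \<in> orth_group \<Longrightarrow> fV V (r u a) = mact (transpose a) (fV V u)"
  by (simp add: phi_r p_r)

text \<open>Horizontal lifts are invariant under right translations and \<open>f\<^sub>V\<close> is equivariant. Therefore
  \<open>nabla\<close>, which is defined at a chosen point of the fibre, is given by the same formula at every
  point.\<close>

lemma AD_r:
  assumes a: "a \<in> orth_group" and V: "smooth_vector_field N V"
  shows "AD X V (r u a) = mact (transpose a) (AD X V u)"
proof -
  have eq: "(\<lambda>u. fV V (r u a)) = (\<lambda>u. mact (transpose a) (fV V u))" by (simp add: fV_r[OF a])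
  have 1: "tmap P std_atlas (\<lambda>u. fV V (r u a)) u \<xi> =
      tmap P std_atlas (fV V) (r u a) (tmap P P (\<lambda>u. r u a) u \<xi>)" for \<xi>
    by (rule tmap_compose[OF mfP mfP r_mderiv[OF a] fV_mderiv[OF V]])
  have "bounded_linear (mact (transpose a))"
    using linear_mact by (rule linear_conv_bounded_linear[THEN iffD1])
  then have 2: "tmap P std_atlas (\<lambda>u. mact (transpose a) (fV V u)) u \<xi> = mact (transpose a) (tmap P std_atlas (fV V) u \<xi>)" for \<xi>
    by (rule tmap_eq[THEN fun_cong, OF has_mderiv_bounded_linear[OF mfP _ fV_mderiv[OF V]]])
  show ?thesis
    unfolding AD_eq hor_r[OF a] by (subst p_r[OF a]) (rule trans[OF 1[symmetric, unfolded eq] 2])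
qed

lemma phi_DD:
  assumes V: "smooth_vector_field N V"
  shows "\<Phi> u (DD X V (p u)) = AD X V u"
proof -
  have "p (fibre_point p (p u)) = p u" by (rule fibre_point)
  then obtain a where a: "a \<in> orth_group" "u = r (fibre_point p (p u)) a"
    using fibre_transitive by blast
  have "\<Phi> u (DD X V (p u)) = mact (transpose a) (\<Phi> (fibre_point p (p u)) (DD X V (p u)))"
    using phi_r[OF a(1)] a(2) by metis
  also have "\<dots> = mact (transpose a) (AD X V (fibre_point p (p u)))" by (simp add: phi_DD_fibre_point)
  also have "\<dots> = AD X V u" using AD_r[OF a(1) V] a(2) by metis
  finally show ?thesis .
qed

text \<open>The local formula \<open>\<nabla>\<^sub>X V = D\<^sub>w F + A(w) F\<close>, where \<open>F\<close> represents \<open>V\<close> in the frame given by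
  the section. It arises by splitting the horizontal lift into the image \<open>Ts(w)\<close>, on which \<open>T\<theta>\<close>
  vanishes, and a vertical vector, which is determined by \<open>\<gamma> = 0\<close>.\<close>

lemma AD_section:
  assumes W: "triv W \<theta>" and s: "local_section U \<phi> S s" and V: "smooth_vector_field N V"
    and \<theta>s: "\<And>z. z \<in> S \<Longrightarrow> p (s z) \<in> W \<and> \<theta> (s z) = mat 1" and z: "z \<in> S"
    and w: "w = tmap N std_atlas \<phi> (inv_into U \<phi> z) (X (inv_into U \<phi> z))"
  shows "AD X V (s z) = frechet_derivative (\<lambda>z. fV V (s z)) (at z) w + dact (conn_form s z w) (fV V (s z))"
proof -
  note D = local_sectionD[OF s]
  define u where "u = s z"
  have pu: "p u = inv_into U \<phi> z" "\<phi> (p u) = z" using D(4,5)[OF z] by (simp_all add: u_def)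
  have u: "p u \<in> U" "\<phi> (p u) \<in> S" "p u \<in> W" "\<theta> u = mat 1"
    using D(3)[OF z] z \<theta>s[OF z] unfolding pu by (simp_all add: u_def D(4,5)[OF z])
  note T = fun_cong[OF tmap_eq[OF fV_mderiv_section[OF W s V _ u(1,2)]]]
  have "AD X V u = frechet_derivative (\<lambda>z. fV V (s z)) (at z) w
        + dact (transpose (tmap P std_atlas \<theta> u (hor (X (p u)) u))) (fV V (s z))"
    unfolding AD_eq by (subst T) (simp_all add: \<theta>s u pu w transpose_mat Tp_hor D(4)[OF z])
  moreover have "transpose (tmap P std_atlas \<theta> u (hor (X (p u)) u)) = conn_form s z w"
  proof -
    define \<eta> where "\<eta> = hor (X (p u)) u - tmap std_atlas P s z w"
    have "Tp u \<eta> = 0"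
      unfolding \<eta>_def linear_diff[OF linear_Tp] Tp_hor
      using local_section_mderiv(3)[OF s z, of "X (p u)"] by (simp add: w pu u_def[symmetric])
    note vert = vertical_if_Tp_zero[OF W u(3) this]
    have th: "has_mderiv P std_atlas \<theta> (tmap P std_atlas \<theta> u) (s z)"
      using theta_mderiv[OF W u(3)] by (simp add: u_def)
    have "has_mderiv std_atlas std_atlas (\<lambda>z. \<theta> (s z)) (\<lambda>v. tmap P std_atlas \<theta> u (tmap std_atlas P s z v)) z"
      by (rule has_mderiv_compose[OF smooth_manifold_std mfP local_section_mderiv(1)[OF s z] th])
    moreover have "has_mderiv std_atlas std_atlas (\<lambda>z. \<theta> (s z)) (\<lambda>v. 0) z"
      by (rule has_mderiv_cong[OF smooth_manifold_std has_mderiv_const[of _ _ "mat 1"] D(2) z]) (simp add: \<theta>s)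
    ultimately have "tmap P std_atlas \<theta> u (tmap std_atlas P s z w) = 0"
      by (rule has_mderiv_unique[THEN fun_cong])
    then have "tmap P std_atlas \<theta> u (hor (X (p u)) u) = tmap P std_atlas \<theta> u \<eta>"
      by (simp add: \<eta>_def linear_diff[OF has_mderiv_linear[OF th]])
    also have "\<dots> = hpart (\<omega> u \<eta>)" using vert by (simp add: u hpart_orth_algebra)
    also have "\<dots> = - conn_form s z w"
      by (simp add: \<eta>_def linear_diff[OF \<omega>_linear] linear_diff[OF linear_hpart] hpart_hor conn_form_def u_def)
    finally have eq: "tmap P std_atlas \<theta> u (hor (X (p u)) u) = - conn_form s z w" .
    have "conn_form s z w \<in> orth_algebra"
      unfolding conn_form_def by (rule euc_algebra_decompose(2)[OF \<omega>_mem])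
    then show ?thesis
      unfolding eq linear_neg[OF bounded_linear.linear[OF bounded_linear_transpose]]
      by (simp add: orth_algebra_iff')
  qed
  ultimately show ?thesis by (simp add: u_def)
qed

text \<open>The right-hand side of the local formula is smooth, and the coordinates of \<open>\<nabla>\<^sub>X V\<close> solve a
  linear equation for it with the smooth invertible coefficients \<open>frame s\<close>.\<close>

lemma DD_smooth:
  assumes X: "smooth_vector_field N X" and V: "smooth_vector_field N V"
  shows "smooth_vector_field N (DD X V)"
proof (rule smooth_vector_field_local[OF mfN])
  fix U \<phi> z0 assume c: "(U,\<phi>) \<in> N" and z0: "z0 \<in> \<phi> ` U"
  define x where "x = inv_into U \<phi> z0"
  have x: "x \<in> U" "\<phi> x = z0" using z0 by (auto simp: x_def smooth_manifold_chart[OF mfN c])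
  obtain W \<theta> S s where W: "triv W \<theta>" and s: "local_section U \<phi> S s" and xS: "\<phi> x \<in> S"
     and \<theta>s: "\<And>z. z \<in> S \<Longrightarrow> p (s z) \<in> W \<and> \<theta> (s z) = mat 1"
    by (rule unit_section_exists[OF c x(1)]) blast
  note D = local_sectionD[OF s]
  define J where "J z = tmap N std_atlas \<phi> (inv_into U \<phi> z)" for z
  define w where "w z = J z (X (inv_into U \<phi> z))" for z
  have w: "Cinf S w" unfolding w_def[abs_def] J_def
    by (rule Cinf_subset[OF smooth_vector_field_chart[OF mfN X c]]) (use s in \<open>simp add: local_section_def\<close>)
  have lin_form: "linear (conn_form s z)" if z: "z \<in> S" for z
    unfolding conn_form_def
    using linear_compose[OF linear_compose[OF has_mderiv_linear[OF local_section_mderiv(1)[OF s z]] \<omega>_linear] linear_hpart]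
    by (simp add: o_def)
  have form: "Cinf S (\<lambda>z. frechet_derivative (\<lambda>z. fV V (s z)) (at z) (w z) + dact (conn_form s z (w z)) (fV V (s z)))"
    by (intro Cinf_add[OF D(2)] Cinf_bilinear[OF bounded_bilinear_dact D(2)] Cinf_frechet[OF D(2)]
        Cinf_linear_family[OF D(2) lin_form local_section_Cinf(2)[OF s]] fV_section_Cinf[OF s V] w)
  have "Cinf S (\<lambda>z. J z (DD X V (inv_into U \<phi> z)))"
  proof (rule Cinf_inverse_family[OF D(2) frame_linear_bij[OF s] local_section_Cinf(1)[OF s] form])
    fix z assume z: "z \<in> S"
    have "frame s z (J z (DD X V (inv_into U \<phi> z))) = \<Phi> (s z) (DD X V (p (s z)))"
      by (simp add: frame_eq_phi[OF s z] J_def D(5)[OF z])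
    also have "\<dots> = AD X V (s z)" by (rule phi_DD[OF V])
    also have "\<dots> = frechet_derivative (\<lambda>z. fV V (s z)) (at z) (w z) + dact (conn_form s z (w z)) (fV V (s z))"
      by (rule AD_section[OF W s V \<theta>s z]) (auto simp: w_def J_def)
    finally show "frame s z (J z (DD X V (inv_into U \<phi> z))) =
      frechet_derivative (\<lambda>z. fV V (s z)) (at z) (w z) + dact (conn_form s z (w z)) (fV V (s z))" .
  qed
  then show "\<exists>S. open S \<and> z0 \<in> S \<and>
       Cinf S (\<lambda>z. tmap N std_atlas \<phi> (inv_into U \<phi> z) (DD X V (inv_into U \<phi> z)))"
    unfolding J_def using D(2) xS x by blast
qed

text \<open>A function on the base can be differentiated on the bundle along horizontal lifts. Its own
  differentiability is inherited from the bundle because it is the composition with a section.\<close>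

lemma vderiv_lift:
  assumes f: "has_mderiv P std_atlas (\<lambda>u. f (p u)) Q u"
  shows "vderiv N X f (p u) = Q (hor (X (p u)) u)"
proof -
  define U \<phi> where "U = fst (chart_at N (p u))" and "\<phi> = snd (chart_at N (p u))"
  note c = chart_at_chart[OF mfN, of "p u", folded U_def \<phi>_def]
  obtain S s where s: "local_section U \<phi> S s" "\<phi> (p u) \<in> S" "s (\<phi> (p u)) = u"
    by (rule section_through[OF c])
  note D = local_sectionD[OF s(1)] and ch = smooth_manifold_chart[OF mfN c(1)]
  have "has_mderiv N P (\<lambda>x. s (\<phi> x)) (\<lambda>v. tmap std_atlas P s (\<phi> (p u)) (tmap N std_atlas \<phi> (p u) v)) (p u)"
    by (rule has_mderiv_compose[OF mfN smooth_manifold_std chart_has_mderiv(1)[OF mfN c]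
          local_section_mderiv(1)[OF s(1,2)]])
  from has_mderiv_compose[OF mfN mfP this, of std_atlas "\<lambda>u. f (p u)" Q] f s(3)
  have m: "has_mderiv N std_atlas (\<lambda>x. f (p (s (\<phi> x))))
      (\<lambda>v. Q (tmap std_atlas P s (\<phi> (p u)) (tmap N std_atlas \<phi> (p u) v))) (p u)"
    by simp
  have oU: "open (U \<inter> \<phi> -` S)"
    by (rule continuous_open_preimage[OF ch(3,1) D(2)])
  have fm: "has_mderiv N std_atlas f
      (\<lambda>v. Q (tmap std_atlas P s (\<phi> (p u)) (tmap N std_atlas \<phi> (p u) v))) (p u)"
    by (rule has_mderiv_cong[OF mfN m oU]) (use c s D ch in auto)
  have "has_mderiv P std_atlas (\<lambda>u. f (p u)) (\<lambda>\<xi>. tmap N std_atlas f (p u) (Tp u \<xi>)) u"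
    by (rule has_mderiv_compose[OF mfP mfN p_mderiv has_mderiv_tmap[OF fm]])
  from has_mderiv_unique[OF f this] show ?thesis by (simp add: vderiv_def Tp_hor)
qed

lemma fV_derivative_linear: "linear (tmap P std_atlas (fV V) u)" if "smooth_vector_field N V"
  by (rule has_mderiv_linear[OF fV_mderiv[OF that]])

lemma DD_eqI:
  assumes "\<And>u. p u = x \<Longrightarrow> AD X V u = \<Phi> u w"
  shows "DD X V x = w"
  using assms[OF fibre_point] phi_DD_fibre_point[of x X V] phi_inj by metis

lemma DD_linear_connection: "linear_connection N (\<lambda>X V. DD X V)"
  unfolding linear_connection_def
proof (intro conjI allI impI)
  fix X V assume "smooth_vector_field N X" "smooth_vector_field N V"
  then show "smooth_vector_field N (DD X V)" by (rule DD_smooth)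
next
  fix X Y V x assume V: "smooth_vector_field N V"
  show "DD (\<lambda>y. X y + Y y) V x = DD X V x + DD Y V x"
  proof (rule DD_eqI)
    fix u assume "p u = x"
    then show "AD (\<lambda>y. X y + Y y) V u = \<Phi> u (DD X V x + DD Y V x)"
      using phi_DD[OF V, of u] by (simp add: AD_eq hor_add linear_add[OF fV_derivative_linear[OF V]] linear_add[OF phi_props(1)])
  qed
next
  fix f :: "'x \<Rightarrow> real" and X V x assume V: "smooth_vector_field N V"
  show "DD (\<lambda>y. f y *\<^sub>R X y) V x = f x *\<^sub>R DD X V x"
  proof (rule DD_eqI)
    fix u assume "p u = x"
    then show "AD (\<lambda>y. f y *\<^sub>R X y) V u = \<Phi> u (f x *\<^sub>R DD X V x)"
      using phi_DD[OF V, of u] by (simp add: AD_eq hor_scaleR linear_cmul[OF fV_derivative_linear[OF V]] linear_cmul[OF phi_props(1)])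
  qed
next
  fix X V W x assume V: "smooth_vector_field N V" and W: "smooth_vector_field N W"
  show "DD X (\<lambda>y. V y + W y) x = DD X V x + DD X W x"
  proof (rule DD_eqI)
    fix u assume "p u = x"
    moreover have "tmap P std_atlas (\<lambda>u. fV V u + fV W u) u \<xi> =
       tmap P std_atlas (fV V) u \<xi> + tmap P std_atlas (fV W) u \<xi>" for \<xi>
      by (simp add: tmap_eq[OF has_mderiv_add[OF mfP fV_mderiv[OF V] fV_mderiv[OF W]]])
    ultimately show "AD X (\<lambda>y. V y + W y) u = \<Phi> u (DD X V x + DD X W x)"
      using phi_DD[OF V, of u] phi_DD[OF W, of u] by (simp add: AD_eq linear_add[OF phi_props(1)])
  qed
next
  fix f :: "'x \<Rightarrow> real" and X V x assume f: "smooth_map N std_atlas UNIV f" and V: "smooth_vector_field N V"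
  show "DD X (\<lambda>y. f y *\<^sub>R V y) x = vderiv N X f x *\<^sub>R V x + f x *\<^sub>R DD X V x"
  proof (rule DD_eqI)
    fix u assume u: "p u = x"
    have fm: "has_mderiv P std_atlas (\<lambda>u. f (p u)) (\<lambda>\<xi>. tmap N std_atlas f (p u) (Tp u \<xi>)) u"
      by (rule has_mderiv_compose[OF mfP mfN p_mderiv smooth_map_has_mderiv[OF mfN smooth_manifold_std f]]) auto
    have "tmap P std_atlas (\<lambda>u. f (p u) *\<^sub>R fV V u) u \<xi> =
       f (p u) *\<^sub>R tmap P std_atlas (fV V) u \<xi> + tmap N std_atlas f (p u) (Tp u \<xi>) *\<^sub>R fV V u" for \<xi>
      by (simp add: tmap_eq[OF has_mderiv_bilinear[OF bounded_bilinear_scaleR mfP fm fV_mderiv[OF V]]])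
    then show "AD X (\<lambda>y. f y *\<^sub>R V y) u = \<Phi> u (vderiv N X f x *\<^sub>R V x + f x *\<^sub>R DD X V x)"
      using phi_DD[OF V, of u] u
      by (simp add: AD_eq linear_add[OF phi_props(1)] linear_cmul[OF phi_props(1)] vderiv_def Tp_hor)
  qed
qed

section \<open>Parallel objects\<close>

text \<open>The induced objects are defined at a chosen point of each fibre; a change of that point acts
  through \<open>H\<close>, which preserves the corresponding objects on \<open>\<mm>\<close>.\<close>

lemma phi_change:
  assumes "p u = x"
  obtains a where "a \<in> orth_group" "\<And>w. \<Phi> (fibre_point p x) w = mact (transpose a) (\<Phi> u w)"
    "\<And>w. \<Phi> u w = mact a (\<Phi> (fibre_point p x) w)"
proof -
  obtain a where a: "a \<in> orth_group" "fibre_point p x = r u a"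
    using fibre_transitive[of u "fibre_point p x"] fibre_point[of x] assms by auto
  show thesis
    by (rule that[OF a(1)]) (simp_all add: a(2) phi_r[OF a(1)] mact_inverse[OF a(1)])
qed

lemma ind_metric_eq: "ind_metric P N p \<omega> (p u) v w = \<Phi> u v \<bullet> \<Phi> u w"
proof -
  obtain a where "a \<in> orth_group" "\<And>w. \<Phi> u w = mact a (\<Phi> (fibre_point p (p u)) w)"
    by (rule phi_change[OF refl]) blast
  then show ?thesis by (simp add: ind_metric_def mact_inner)
qed

lemma phi_ind_U: "\<Phi> u (ind_U P N p \<omega> (p u)) = e0"
proof -
  obtain a where "a \<in> orth_group" "\<And>w. \<Phi> u w = mact a (\<Phi> (fibre_point p (p u)) w)"
    by (rule phi_change[OF refl]) blast
  then show ?thesis by (simp add: ind_U_def phi_inv mact_e0)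
qed

lemma ind_alpha_eq: "ind_alpha P N p \<omega> (p u) v = e0 \<bullet> \<Phi> u v"
  by (simp add: ind_alpha_def ind_metric_eq phi_ind_U)

lemma ind_E_iff: "v \<in> ind_E P N p \<omega> (p u) \<longleftrightarrow> \<Phi> u v \<in> E_space"
proof -
  obtain a where "\<And>w. \<Phi> (fibre_point p (p u)) w = mact (transpose a) (\<Phi> u w)"
     "\<And>w. \<Phi> u w = mact a (\<Phi> (fibre_point p (p u)) w)"
    by (rule phi_change[OF refl]) blast
  then show ?thesis unfolding ind_E_def vimage_eq by (metis mact_E_space)
qed

lemma ind_B_iff: "v \<in> ind_B P N p \<omega> (p u) \<longleftrightarrow> \<Phi> u v \<in> B_space"
proof -
  obtain a where "\<And>w. \<Phi> (fibre_point p (p u)) w = mact (transpose a) (\<Phi> u w)"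
     "\<And>w. \<Phi> u w = mact a (\<Phi> (fibre_point p (p u)) w)"
    by (rule phi_change[OF refl]) blast
  then show ?thesis unfolding ind_B_def vimage_eq by (metis mact_B_space)
qed

lemma phi_ind_Psi: "\<Phi> u (ind_Psi P N p \<omega> (p u) v) = psi (\<Phi> u v)"
proof -
  obtain a where "a \<in> orth_group" "\<And>w. \<Phi> u w = mact a (\<Phi> (fibre_point p (p u)) w)"
    by (rule phi_change[OF refl]) blast
  then show ?thesis by (simp add: ind_Psi_def phi_inv mact_psi)
qed

text \<open>If a linear map is constant on \<open>f\<^sub>V\<close>, then it kills the derivative; the subspaces \<open>E\<close> and
  \<open>B\<close> are kernels of linear maps.\<close>

lemma AD_linear:
  assumes V: "smooth_vector_field N V" and h: "bounded_linear h" and c: "\<And>u. h (fV V u) = (c :: 'v::euclidean_space)"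
  shows "h (AD X V u) = 0"
proof -
  have "has_mderiv P std_atlas (\<lambda>u. h (fV V u)) (\<lambda>\<xi>. h (tmap P std_atlas (fV V) u \<xi>)) u"
    by (rule has_mderiv_bounded_linear[OF mfP h fV_mderiv[OF V]])
  moreover have "has_mderiv P std_atlas (\<lambda>u. h (fV V u)) (\<lambda>\<xi>. 0) u"
    unfolding c by (rule has_mderiv_const)
  ultimately show ?thesis unfolding AD_eq by (rule has_mderiv_unique[THEN fun_cong])
qed

lemma DD_metric: "parallel_metric N (\<lambda>X V. DD X V) (ind_metric P N p \<omega>)"
  unfolding parallel_metric_def
proof (intro allI impI)
  fix X Y Z x assume Y: "smooth_vector_field N Y" and Z: "smooth_vector_field N Z"
  define u where "u = fibre_point p x"
  have u: "p u = x" by (simp add: u_def fibre_point)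
  have "has_mderiv P std_atlas (\<lambda>u. ind_metric P N p \<omega> (p u) (Y (p u)) (Z (p u)))
     (\<lambda>\<xi>. fV Y u \<bullet> tmap P std_atlas (fV Z) u \<xi> + tmap P std_atlas (fV Y) u \<xi> \<bullet> fV Z u) u"
    unfolding ind_metric_eq by (rule has_mderiv_bilinear[OF bounded_bilinear_inner mfP fV_mderiv[OF Y] fV_mderiv[OF Z]])
  from vderiv_lift[OF this, of X]
  have "vderiv N X (\<lambda>y. ind_metric P N p \<omega> y (Y y) (Z y)) (p u) = fV Y u \<bullet> AD X Z u + AD X Y u \<bullet> fV Z u"
    by (simp add: AD_eq)
  then show "vderiv N X (\<lambda>y. ind_metric P N p \<omega> y (Y y) (Z y)) x
     - ind_metric P N p \<omega> x (DD X Y x) (Z x) - ind_metric P N p \<omega> x (Y x) (DD X Z x) = 0"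
    using ind_metric_eq[of u] phi_DD[OF Y, of u] phi_DD[OF Z, of u] by (simp add: u)
qed

lemma DD_U: "parallel_field N (\<lambda>X V. DD X V) (ind_U P N p \<omega>)"
  unfolding parallel_field_def
proof (intro allI impI)
  fix X x
  show "DD X (ind_U P N p \<omega>) x = 0"
  proof (rule DD_eqI)
    fix u
    show "AD X (ind_U P N p \<omega>) u = \<Phi> u 0"
      by (simp add: AD_eq phi_ind_U tmap_eq[OF has_mderiv_const] linear_0[OF phi_props(1)])
  qed
qed

lemma DD_alpha: "parallel_one_form N (\<lambda>X V. DD X V) (ind_alpha P N p \<omega>)"
  unfolding parallel_one_form_def
proof (intro allI impI)
  fix X Y x assume Y: "smooth_vector_field N Y"
  define u where "u = fibre_point p x"
  have u: "p u = x" by (simp add: u_def fibre_point)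
  have "has_mderiv P std_atlas (\<lambda>u. ind_alpha P N p \<omega> (p u) (Y (p u)))
     (\<lambda>\<xi>. e0 \<bullet> tmap P std_atlas (fV Y) u \<xi>) u"
    unfolding ind_alpha_eq by (rule has_mderiv_bounded_linear[OF mfP bounded_linear_inner_right fV_mderiv[OF Y]])
  from vderiv_lift[OF this, of X]
  have "vderiv N X (\<lambda>y. ind_alpha P N p \<omega> y (Y y)) (p u) = e0 \<bullet> AD X Y u"
    by (simp add: AD_eq)
  then show "vderiv N X (\<lambda>y. ind_alpha P N p \<omega> y (Y y)) x - ind_alpha P N p \<omega> x (DD X Y x) = 0"
    using ind_alpha_eq[of u] phi_DD[OF Y, of u] by (simp add: u)
qed

lemma DD_E: "preserves_distribution N (\<lambda>X V. DD X V) (ind_E P N p \<omega>)"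
  unfolding preserves_distribution_def sections_def
proof (intro allI impI CollectI conjI; elim CollectE conjE)
  fix X V assume "smooth_vector_field N X" "smooth_vector_field N V"
  then show "smooth_vector_field N (DD X V)" by (rule DD_smooth)
next
  fix X V x assume V: "smooth_vector_field N V" and E: "\<forall>x. V x \<in> ind_E P N p \<omega> x"
  define u where "u = fibre_point p x"
  have u: "p u = x" by (simp add: u_def fibre_point)
  define h :: "'k mspace \<Rightarrow> real \<times> (real^'k)" where "h t = (fst t, snd (snd t))" for t
  have h: "t \<in> E_space \<longleftrightarrow> h t = 0" for t by (cases t) (auto simp: E_space_eq h_def zero_prod_def)
  have "bounded_linear h" unfolding h_def[abs_def] by (intro bounded_linear_intros)
  moreover have "h (fV V u) = 0" for u using E h ind_E_iff by blast
  ultimately have "h (AD X V u) = 0" by (rule AD_linear[OF V])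
  then show "DD X V x \<in> ind_E P N p \<omega> x"
    using ind_E_iff[of "DD X V x" u] phi_DD[OF V, of u] by (simp add: u h)
qed

lemma DD_B: "preserves_distribution N (\<lambda>X V. DD X V) (ind_B P N p \<omega>)"
  unfolding preserves_distribution_def sections_def
proof (intro allI impI CollectI conjI; elim CollectE conjE)
  fix X V assume "smooth_vector_field N X" "smooth_vector_field N V"
  then show "smooth_vector_field N (DD X V)" by (rule DD_smooth)
next
  fix X V x assume V: "smooth_vector_field N V" and B: "\<forall>x. V x \<in> ind_B P N p \<omega> x"
  define u where "u = fibre_point p x"
  have u: "p u = x" by (simp add: u_def fibre_point)
  define h :: "'k mspace \<Rightarrow> real \<times> (real^'k)" where "h t = (fst t, fst (snd t))" for t
  have h: "t \<in> B_space \<longleftrightarrow> h t = 0" for t by (cases t) (auto simp: B_space_eq h_def zero_prod_def)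
  have "bounded_linear h" unfolding h_def[abs_def] by (intro bounded_linear_intros)
  moreover have "h (fV V u) = 0" for u using B h ind_B_iff by blast
  ultimately have "h (AD X V u) = 0" by (rule AD_linear[OF V])
  then show "DD X V x \<in> ind_B P N p \<omega> x"
    using ind_B_iff[of "DD X V x" u] phi_DD[OF V, of u] by (simp add: u h)
qed

lemma DD_Psi: "parallel_endo N (\<lambda>X V. DD X V) (ind_Psi P N p \<omega>)"
  unfolding parallel_endo_def
proof (intro allI impI)
  fix X Y x assume Y: "smooth_vector_field N Y"
  have "DD X (\<lambda>y. ind_Psi P N p \<omega> y (Y y)) x = ind_Psi P N p \<omega> x (DD X Y x)"
  proof (rule DD_eqI)
    fix u assume u: "p u = x"
    have "AD X (\<lambda>y. ind_Psi P N p \<omega> y (Y y)) u = psi (AD X Y u)"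
      unfolding AD_eq phi_ind_Psi
      by (simp add: tmap_eq[OF has_mderiv_bounded_linear[OF mfP bounded_linear_psi fV_mderiv[OF Y]]])
    then show "AD X (\<lambda>y. ind_Psi P N p \<omega> y (Y y)) u = \<Phi> u (ind_Psi P N p \<omega> x (DD X Y x))"
      using phi_ind_Psi[of u] phi_DD[OF Y, of u] by (simp add: u)
  qed
  then show "DD X (\<lambda>y. ind_Psi P N p \<omega> y (Y y)) x - ind_Psi P N p \<omega> x (DD X Y x) = 0" by simp
qed

lemma gamma_principal: "principal_connection orth_group orth_algebra P r (gamma_conn \<omega>)"
proof -
  have \<gamma>: "gamma_conn \<omega> = (\<lambda>u \<xi>. hpart (\<omega> u \<xi>))" by (intro ext) (rule gamma_conn_eq)
  show ?thesis
    unfolding principal_connection_def \<gamma>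
    using smooth_one_form_linear[OF smooth_\<omega> bounded_linear_hpart mfP]
    by (auto simp: euc_algebra_decompose(2)[OF \<omega>_mem] \<omega>_r Ad_matrix_inv hpart_conj \<omega>_fundamental hpart_orth_algebra)
qed

end

theorem proposition4p4:
  fixes P :: "('p::{t2_space,second_countable_topology}, 'q::euclidean_space) chart set"
    and N :: "('x::{t2_space,second_countable_topology}, 'e::euclidean_space) chart set"
    and p :: "'p \<Rightarrow> 'x"
    and r :: "'p \<Rightarrow> ('k::finite) emat \<Rightarrow> 'p"
    and \<omega> :: "'p \<Rightarrow> 'q \<Rightarrow> 'k emat"
  assumes "connected (UNIV :: 'x set)"
    and "cartan_geometry orth_group euc_algebra orth_algebra P N p r \<omega>"
  shows "let \<gamma> = gamma_conn \<omega>; D = nabla P N p \<omega> \<gamma> in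
      principal_connection orth_group orth_algebra P r \<gamma> \<and>
      linear_connection N D \<and>
      (\<forall>W V u. smooth_vector_field N W \<longrightarrow> smooth_vector_field N V \<longrightarrow>
         phi P N p \<omega> u (D W V (p u)) = assoc_deriv P N p \<omega> \<gamma> W V u) \<and>
      parallel_metric N D (ind_metric P N p \<omega>) \<and>
      parallel_field N D (ind_U P N p \<omega>) \<and>
      parallel_one_form N D (ind_alpha P N p \<omega>) \<and>
      preserves_distribution N D (ind_E P N p \<omega>) \<and>
      preserves_distribution N D (ind_B P N p \<omega>) \<and>
      parallel_endo N D (ind_Psi P N p \<omega>)"
proof -
  interpret euc_cartan_geometry P N p r \<omega> by unfold_locales (rule assms(2))
  show ?thesis
    unfolding Let_def
    using gamma_principal DD_linear_connection phi_DD DD_metric DD_U DD_alpha DD_E DD_B DD_Psi by blast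
qed

end
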